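(* Let $\mathcal R$ be a module category over the affine Kauffman category $\mathcal{AK}(z,t)$ that is either a locally finite abelian or a schurian category, and let $L\in\mathcal R$ be a brick, i.e. $\mathrm{End}_{\mathcal R}(L)=\Bbbk$. Let $m_L$ be the monic minimal polynomial of the dot on $KL$, $d_L=\deg m_L$, $M=m_L(0)\ne0$, and let $\mathbf O_L(u)$, $\widetilde{\mathbf O}_L(u)$ be the series by which $\beta_r(u)$, $\beta_l(u)$ act on $L$. Then $$\mathbf O_L(u)=\mathbf O_{m_L}(u)\qquad\text{and}\qquad \widetilde{\mathbf O}_L(u)=\widetilde{\mathbf O}_{m_L}(u)=\mathbf O_{m_L}(u^{-1}),$$ where the last equality is an equality of rational functions. If $d_L$ is even, then $z=t^{-1}M-tM^{-1}$. If $d_L$ is odd, then $M=\pm t$.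
   Context: $\Bbbk$ is a field and $z,t\in\Bbbk^\times$. The affine Kauffman category $\mathcal{AK}=\mathcal{AK}(z,t)$ is the strict $\Bbbk$-linear monoidal category (unit object $\mathbf 1$) generated by an object $K$ and morphisms $\mathrm{cap}\colon K\otimes K\to\mathbf 1$, $\mathrm{cup}\colon\mathbf 1\to K\otimes K$, $\sigma_+,\sigma_-\colon K\otimes K\to K\otimes K$ (positive and negative crossings), $x,x^{-1}\colon K\to K$ ($x$ is the dot), subject to (with $I=1_K$): $\sigma_+\sigma_-=1_{K\otimes K}=\sigma_-\sigma_+$; $(\sigma_+\otimes I)(I\otimes\sigma_+)(\sigma_+\otimes I)=(I\otimes\sigma_+)(\sigma_+\otimes I)(I\otimes\sigma_+)$; $(I\otimes\mathrm{cap})(\mathrm{cup}\otimes I)=I=(\mathrm{cap}\otimes I)(I\otimes\mathrm{cup})$; $\mathrm{cap}\circ\sigma_-=t\,\mathrm{cap}$; $(I\otimes\mathrm{cap})(\sigma_-\otimes I)=(\mathrm{cap}\otimes I)(I\otimes\sigma_+)$; $\sigma_+-\sigma_-=z(1_{K\otimes K}-\mathrm{cup}\circ\mathrm{cap})$; $\mathrm{cap}\circ\mathrm{cup}=\left(\frac{t-t^{-1}}z+1\right)1_{\mathbf 1}$; $\sigma_-(x\otimes I)=(I\otimes x)\sigma_+$; $\mathrm{cap}(x\otimes I)=\mathrm{cap}(I\otimes x^{-1})$; $x^{-1}x=I=xx^{-1}$. Define, with rational functions expanded in powers of $u^{-1}$, $$\beta_r(u)=\frac{(t^{-1}-z)u^2-t^{-1}}{u^2-zu-1}1_{\mathbf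 1}+\frac{z(u^2-1)}{u^2-zu-1}\sum_{n\ge0}\left(\mathrm{cap}\circ(I\otimes x^n)\circ\mathrm{cup}\right)u^{-n},$$ $$\beta_l(u)=\frac{(t+z)u^2-t}{u^2+zu-1}1_{\mathbf 1}-\frac{z(u^2-1)}{u^2+zu-1}\sum_{n\ge0}\left(\mathrm{cap}\circ(x^n\otimes I)\circ\mathrm{cup}\right)u^{-n}.$$ A module category over $\mathcal{AK}$ is a $\Bbbk$-linear category $\mathcal R$ with a strict $\Bbbk$-linear monoidal functor from $\mathcal{AK}$ to the category of $\Bbbk$-linear endofunctors of $\mathcal R$ and natural transformations; write $XL$ for the value at $L$ of the functor attached to $X$, and let morphisms act by components of the corresponding natural transformations. Locally finite abelian means abelian with all objects of finite length and all morphism spaces finite-dimensional over $\Bbbk$; schurian means equivalent to the category of locally finite-dimensional modules over a locally finite-dimensional locally unital $\Bbbk$-algebra. For a brick $L$, let $J_L$ be the kernel of the algebra homomorphism $\Bbbk[u,u^{-1}]\to\mathrm{End}_{\mathcal R}(KL)$, $f(u)\mapsto f(x)_L$; $m_L$ is the unique generator of $J_L$ that lies in $\Bbbk[u]$, is monic, and has nonzero constant term. On a brick $L$ the series $\beta_r(u)$ and $\beta_l(u)$ act by $\mathbf O_L(u)\in t+u^{-1}\Bbbk[[u^{-1}]]$ and $\widetilde{\mathbf O}_L(u)\in t^{-1}+u^{-1}\Bbbk[[u^{-1}]]$. For monic $f\in\Bbbk[u]$ with $f(0)\ne0$, put $\check f(u)=f(0)^{-1}u^{\deg f}f(u^{-1})$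 and $$\mathbf O_f(u)=\frac{tu^2-zf(0)-t}{u^2-zu-1}\cdot\frac{\check f(u)}{f(u)},\quad \widetilde{\mathbf O}_f(u)=\frac{t^{-1}u^2+zf(0)^{-1}-t^{-1}}{u^2+zu-1}\cdot\frac{f(u)}{\check f(u)}\quad(\deg f\text{ even}),$$ $$\mathbf O_f(u)=\frac{tu^2-zf(0)u-t}{u^2-zu-1}\cdot\frac{\check f(u)}{f(u)},\quad \widetilde{\mathbf O}_f(u)=\frac{t^{-1}u^2+zf(0)^{-1}u-t^{-1}}{u^2+zu-1}\cdot\frac{f(u)}{\check f(u)}\quad(\deg f\text{ odd}),$$ rational functions also viewed as power series in $u^{-1}$ by expansion at $u=\infty$. *)

theory Defs
  imports
    "HOL-Library.FuncSet"
    "HOL-Library.Poly_Mapping"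
    "HOL-Computational_Algebra.Computational_Algebra"
begin

section \<open>Vector spaces on carrier sets\<close>

locale vspace_on =
  fixes V :: "'v set" and add :: "'v \<Rightarrow> 'v \<Rightarrow> 'v" and zero :: 'v
    and scal :: "'k::field \<Rightarrow> 'v \<Rightarrow> 'v"
  assumes add_closed: "\<lbrakk>x \<in> V; y \<in> V\<rbrakk> \<Longrightarrow> add x y \<in> V"
    and zero_closed: "zero \<in> V"
    and scal_closed: "x \<in> V \<Longrightarrow> scal c x \<in> V"
    and add_assoc: "\<lbrakk>x \<in> V; y \<in> V; w \<in> V\<rbrakk> \<Longrightarrow> add (add x y) w = add x (add y w)"
    and add_comm: "\<lbrakk>x \<in> V; y \<in> V\<rbrakk> \<Longrightarrow> add x y = add y x"
    and add_zero: "x \<in> V \<Longrightarrow> add zero x = x"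
    and add_inverse: "x \<in> V \<Longrightarrow> \<exists>y\<in>V. add x y = zero"
    and scal_add_right: "\<lbrakk>x \<in> V; y \<in> V\<rbrakk> \<Longrightarrow> scal c (add x y) = add (scal c x) (scal c y)"
    and scal_add_left: "x \<in> V \<Longrightarrow> scal (c + d) x = add (scal c x) (scal d x)"
    and scal_scal: "x \<in> V \<Longrightarrow> scal c (scal d x) = scal (c * d) x"
    and scal_one: "x \<in> V \<Longrightarrow> scal 1 x = x"

definition subspace_on ::
  "'v set \<Rightarrow> ('v \<Rightarrow> 'v \<Rightarrow> 'v) \<Rightarrow> 'v \<Rightarrow> ('k::field \<Rightarrow> 'v \<Rightarrow> 'v) \<Rightarrow> 'v set \<Rightarrow> bool" where
  "subspace_on V add zero scal W \<longleftrightarrow>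
     W \<subseteq> V \<and> zero \<in> W \<and> (\<forall>x\<in>W. \<forall>y\<in>W. add x y \<in> W) \<and> (\<forall>c. \<forall>x\<in>W. scal c x \<in> W)"

definition span_on ::
  "'v set \<Rightarrow> ('v \<Rightarrow> 'v \<Rightarrow> 'v) \<Rightarrow> 'v \<Rightarrow> ('k::field \<Rightarrow> 'v \<Rightarrow> 'v) \<Rightarrow> 'v set \<Rightarrow> 'v set" where
  "span_on V add zero scal B = \<Inter>{W. subspace_on V add zero scal W \<and> B \<subseteq> W}"

definition finite_dim_on ::
  "'v set \<Rightarrow> ('v \<Rightarrow> 'v \<Rightarrow> 'v) \<Rightarrow> 'v \<Rightarrow> ('k::field \<Rightarrow> 'v \<Rightarrow> 'v) \<Rightarrow> bool" where
  "finite_dim_on V add zero scal \<longleftrightarrow>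
     (\<exists>B. finite B \<and> B \<subseteq> V \<and> span_on V add zero scal B = V)"


section \<open>Linear categories, functors, natural transformations\<close>

record ('o, 'm, 'k) lincat =
  Obj :: "'o set"
  Arr :: "'m set"
  Src :: "'m \<Rightarrow> 'o"
  Tgt :: "'m \<Rightarrow> 'o"
  Ident :: "'o \<Rightarrow> 'm"
  Cmp :: "'m \<Rightarrow> 'm \<Rightarrow> 'm"
  Plus :: "'m \<Rightarrow> 'm \<Rightarrow> 'm"
  Zer :: "'o \<Rightarrow> 'o \<Rightarrow> 'm"
  Smul :: "'k \<Rightarrow> 'm \<Rightarrow> 'm"

text \<open>\<open>Cmp C g f\<close> is the composite \<open>g \<circ> f\<close>; \<open>Zer C a b\<close> is the zero morphism from
  \<open>a\<close> to \<open>b\<close>.\<close>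

definition Hom :: "('o, 'm, 'k, 'x) lincat_scheme \<Rightarrow> 'o \<Rightarrow> 'o \<Rightarrow> 'm set" where
  "Hom C a b = {f \<in> Arr C. Src C f = a \<and> Tgt C f = b}"

locale lin_category =
  fixes C :: "('o, 'm, 'k::field, 'x) lincat_scheme"
  assumes src_obj: "f \<in> Arr C \<Longrightarrow> Src C f \<in> Obj C"
    and tgt_obj: "f \<in> Arr C \<Longrightarrow> Tgt C f \<in> Obj C"
    and ident_hom: "a \<in> Obj C \<Longrightarrow> Ident C a \<in> Hom C a a"
    and cmp_hom: "\<lbrakk>f \<in> Hom C a b; g \<in> Hom C b c\<rbrakk> \<Longrightarrow> Cmp C g f \<in> Hom C a c"
    and ident_left: "f \<in> Hom C a b \<Longrightarrow> Cmp C (Ident C b) f = f"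
    and ident_right: "f \<in> Hom C a b \<Longrightarrow> Cmp C f (Ident C a) = f"
    and cmp_assoc: "\<lbrakk>f \<in> Hom C a b; g \<in> Hom C b c; h \<in> Hom C c d\<rbrakk>
      \<Longrightarrow> Cmp C (Cmp C h g) f = Cmp C h (Cmp C g f)"
    and hom_vspace: "\<lbrakk>a \<in> Obj C; b \<in> Obj C\<rbrakk>
      \<Longrightarrow> vspace_on (Hom C a b) (Plus C) (Zer C a b) (Smul C)"
    and cmp_plus_left: "\<lbrakk>f \<in> Hom C a b; g \<in> Hom C b c; h \<in> Hom C b c\<rbrakk>
      \<Longrightarrow> Cmp C (Plus C g h) f = Plus C (Cmp C g f) (Cmp C h f)"
    and cmp_plus_right: "\<lbrakk>f \<in> Hom C a b; g \<in> Hom C a b; h \<in> Hom C b c\<rbrakk>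
      \<Longrightarrow> Cmp C h (Plus C f g) = Plus C (Cmp C h f) (Cmp C h g)"
    and cmp_smul_left: "\<lbrakk>f \<in> Hom C a b; g \<in> Hom C b c\<rbrakk>
      \<Longrightarrow> Cmp C (Smul C s g) f = Smul C s (Cmp C g f)"
    and cmp_smul_right: "\<lbrakk>f \<in> Hom C a b; g \<in> Hom C b c\<rbrakk>
      \<Longrightarrow> Cmp C g (Smul C s f) = Smul C s (Cmp C g f)"

record ('o, 'm, 'p, 'n) funct =
  FObj :: "'o \<Rightarrow> 'p"
  FArr :: "'m \<Rightarrow> 'n"

text \<open>Functors and natural transformations are required to be extensional (\<open>undefined\<close> off the
  relevant carrier), so that equality of the HOL objects is equality of functors and of
  transformations; strict monoidal functors into endofunctors depend on this.\<close>

definition lin_functor ::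
  "('o, 'm, 'k::field, 'x) lincat_scheme \<Rightarrow> ('p, 'n, 'k, 'y) lincat_scheme
    \<Rightarrow> ('o, 'm, 'p, 'n) funct \<Rightarrow> bool" where
  "lin_functor C D F \<longleftrightarrow>
     FObj F \<in> extensional (Obj C) \<and> FArr F \<in> extensional (Arr C) \<and>
     (\<forall>a\<in>Obj C. FObj F a \<in> Obj D) \<and>
     (\<forall>a b. \<forall>f\<in>Hom C a b. FArr F f \<in> Hom D (FObj F a) (FObj F b)) \<and>
     (\<forall>a\<in>Obj C. FArr F (Ident C a) = Ident D (FObj F a)) \<and>
     (\<forall>a b c. \<forall>f\<in>Hom C a b. \<forall>g\<in>Hom C b c.
        FArr F (Cmp C g f) = Cmp D (FArr F g) (FArr F f)) \<and>
     (\<forall>a b. \<forall>f\<in>Hom C a b. \<forall>g\<in>Hom C a b.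
        FArr F (Plus C f g) = Plus D (FArr F f) (FArr F g)) \<and>
     (\<forall>a b s. \<forall>f\<in>Hom C a b. FArr F (Smul C s f) = Smul D s (FArr F f))"

definition id_functor :: "('o, 'm, 'k, 'x) lincat_scheme \<Rightarrow> ('o, 'm, 'o, 'm) funct" where
  "id_functor C = \<lparr>FObj = (\<lambda>a\<in>Obj C. a), FArr = (\<lambda>f\<in>Arr C. f)\<rparr>"

definition comp_functor ::
  "('o, 'm, 'k, 'x) lincat_scheme \<Rightarrow> ('p, 'n, 'q, 'r) funct \<Rightarrow> ('o, 'm, 'p, 'n) funct
    \<Rightarrow> ('o, 'm, 'q, 'r) funct" where
  "comp_functor C G F =
     \<lparr>FObj = compose (Obj C) (FObj G) (FObj F), FArr = compose (Arr C) (FArr G) (FArr F)\<rparr>"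

definition nat_trans ::
  "('o, 'm, 'k::field, 'x) lincat_scheme \<Rightarrow> ('p, 'n, 'k, 'y) lincat_scheme
    \<Rightarrow> ('o, 'm, 'p, 'n) funct \<Rightarrow> ('o, 'm, 'p, 'n) funct \<Rightarrow> ('o \<Rightarrow> 'n) \<Rightarrow> bool" where
  "nat_trans C D F G \<eta> \<longleftrightarrow>
     \<eta> \<in> extensional (Obj C) \<and>
     (\<forall>a\<in>Obj C. \<eta> a \<in> Hom D (FObj F a) (FObj G a)) \<and>
     (\<forall>a b. \<forall>f\<in>Hom C a b. Cmp D (\<eta> b) (FArr F f) = Cmp D (FArr G f) (\<eta> a))"

definition iso_in :: "('o, 'm, 'k::field, 'x) lincat_scheme \<Rightarrow> 'm \<Rightarrow> bool" where
  "iso_in C f \<longleftrightarrow> f \<in> Arr C \<and>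
     (\<exists>g\<in>Hom C (Tgt C f) (Src C f).
        Cmp C g f = Ident C (Src C f) \<and> Cmp C f g = Ident C (Tgt C f))"

definition nat_iso ::
  "('o, 'm, 'k::field, 'x) lincat_scheme \<Rightarrow> ('p, 'n, 'k, 'y) lincat_scheme
    \<Rightarrow> ('o, 'm, 'p, 'n) funct \<Rightarrow> ('o, 'm, 'p, 'n) funct \<Rightarrow> ('o \<Rightarrow> 'n) \<Rightarrow> bool" where
  "nat_iso C D F G \<eta> \<longleftrightarrow> nat_trans C D F G \<eta> \<and> (\<forall>a\<in>Obj C. iso_in D (\<eta> a))"

definition lin_equivalent ::
  "('o, 'm, 'k::field, 'x) lincat_scheme \<Rightarrow> ('p, 'n, 'k, 'y) lincat_scheme \<Rightarrow> bool" where
  "lin_equivalent C D \<longleftrightarrow>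
     (\<exists>F G \<eta> \<epsilon>. lin_functor C D F \<and> lin_functor D C G \<and>
        nat_iso C C (id_functor C) (comp_functor C G F) \<eta> \<and>
        nat_iso D D (comp_functor D F G) (id_functor D) \<epsilon>)"


section \<open>Strict monoidal linear categories and the category of endofunctors\<close>

record ('o, 'm, 'k) moncat = "('o, 'm, 'k) lincat" +
  One :: 'o
  TensO :: "'o \<Rightarrow> 'o \<Rightarrow> 'o"
  TensM :: "'m \<Rightarrow> 'm \<Rightarrow> 'm"

definition strict_mon_functor ::
  "('o, 'm, 'k::field, 'x) moncat_scheme \<Rightarrow> ('p, 'n, 'k, 'y) moncat_scheme
    \<Rightarrow> ('o, 'm, 'p, 'n) funct \<Rightarrow> bool" where
  "strict_mon_functor C D F \<longleftrightarrow> lin_functor C D F \<and>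
     FObj F (One C) = One D \<and>
     (\<forall>a\<in>Obj C. \<forall>b\<in>Obj C. FObj F (TensO C a b) = TensO D (FObj F a) (FObj F b)) \<and>
     (\<forall>f\<in>Arr C. \<forall>g\<in>Arr C. FArr F (TensM C f g) = TensM D (FArr F f) (FArr F g))"

text \<open>Morphisms of the endofunctor category are triples (source, target, components).  The tensor
  product of functors is composition, and that of \<open>\<eta> : F \<Rightarrow> F'\<close> and \<open>\<theta> : G \<Rightarrow> G'\<close> has component
  \<open>\<eta> (G' a) \<circ> F (\<theta> a) : F (G a) \<rightarrow> F' (G' a)\<close> at \<open>a\<close>.\<close>

type_synonym ('o, 'm) endofunct = "('o, 'm, 'o, 'm) funct"
type_synonym ('o, 'm) endotrans = "('o, 'm) endofunct \<times> ('o, 'm) endofunct \<times> ('o \<Rightarrow> 'm)"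

definition component :: "('o, 'm) endotrans \<Rightarrow> 'o \<Rightarrow> 'm" where
  "component \<phi> = snd (snd \<phi>)"

definition End_cat ::
  "('o, 'm, 'k::field) lincat \<Rightarrow> (('o, 'm) endofunct, ('o, 'm) endotrans, 'k) moncat" where
  "End_cat R =
     \<lparr>Obj = {F. lin_functor R R F},
      Arr = {(F, G, \<eta>). lin_functor R R F \<and> lin_functor R R G \<and> nat_trans R R F G \<eta>},
      Src = (\<lambda>\<phi>. fst \<phi>),
      Tgt = (\<lambda>\<phi>. fst (snd \<phi>)),
      Ident = (\<lambda>F. (F, F, \<lambda>a\<in>Obj R. Ident R (FObj F a))),
      Cmp = (\<lambda>\<psi> \<phi>. (fst \<phi>, fst (snd \<psi>), \<lambda>a\<in>Obj R. Cmp R (component \<psi> a) (component \<phi> a))),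
      Plus = (\<lambda>\<phi> \<psi>. (fst \<phi>, fst (snd \<phi>), \<lambda>a\<in>Obj R. Plus R (component \<phi> a) (component \<psi> a))),
      Zer = (\<lambda>F G. (F, G, \<lambda>a\<in>Obj R. Zer R (FObj F a) (FObj G a))),
      Smul = (\<lambda>c \<phi>. (fst \<phi>, fst (snd \<phi>), \<lambda>a\<in>Obj R. Smul R c (component \<phi> a))),
      One = id_functor R,
      TensO = comp_functor R,
      TensM = (\<lambda>\<phi> \<psi>. (comp_functor R (fst \<phi>) (fst \<psi>),
                        comp_functor R (fst (snd \<phi>)) (fst (snd \<psi>)),
                        \<lambda>a\<in>Obj R. Cmp R (component \<phi> (FObj (fst (snd \<psi>)) a))
                                          (FArr (fst \<phi>) (component \<psi> a))))\<rparr>"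


section \<open>Locally finite abelian categories\<close>

definition zero_object :: "('o, 'm, 'k::field, 'x) lincat_scheme \<Rightarrow> 'o \<Rightarrow> bool" where
  "zero_object C a \<longleftrightarrow> a \<in> Obj C \<and>
     (\<forall>b\<in>Obj C. (\<exists>!f. f \<in> Hom C a b) \<and> (\<exists>!f. f \<in> Hom C b a))"

definition has_biproducts :: "('o, 'm, 'k::field, 'x) lincat_scheme \<Rightarrow> bool" where
  "has_biproducts C \<longleftrightarrow> (\<forall>a\<in>Obj C. \<forall>b\<in>Obj C. \<exists>c\<in>Obj C.
     \<exists>i\<in>Hom C a c. \<exists>j\<in>Hom C b c. \<exists>p\<in>Hom C c a. \<exists>q\<in>Hom C c b.
       Cmp C p i = Ident C a \<and> Cmp C q j = Ident C b \<and>
       Cmp C q i = Zer C a b \<and> Cmp C p j = Zer C b a \<and>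
       Plus C (Cmp C i p) (Cmp C j q) = Ident C c)"

definition mono_in :: "('o, 'm, 'k::field, 'x) lincat_scheme \<Rightarrow> 'm \<Rightarrow> bool" where
  "mono_in C f \<longleftrightarrow> f \<in> Arr C \<and>
     (\<forall>a. \<forall>g\<in>Hom C a (Src C f). \<forall>h\<in>Hom C a (Src C f). Cmp C f g = Cmp C f h \<longrightarrow> g = h)"

definition epi_in :: "('o, 'm, 'k::field, 'x) lincat_scheme \<Rightarrow> 'm \<Rightarrow> bool" where
  "epi_in C f \<longleftrightarrow> f \<in> Arr C \<and>
     (\<forall>b. \<forall>g\<in>Hom C (Tgt C f) b. \<forall>h\<in>Hom C (Tgt C f) b. Cmp C g f = Cmp C h f \<longrightarrow> g = h)"

definition is_kernel :: "('o, 'm, 'k::field, 'x) lincat_scheme \<Rightarrow> 'm \<Rightarrow> 'm \<Rightarrow> bool" where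
  "is_kernel C f i \<longleftrightarrow> f \<in> Arr C \<and> i \<in> Arr C \<and> Tgt C i = Src C f \<and>
     Cmp C f i = Zer C (Src C i) (Tgt C f) \<and>
     (\<forall>a. \<forall>g\<in>Hom C a (Src C f). Cmp C f g = Zer C a (Tgt C f) \<longrightarrow>
        (\<exists>!h. h \<in> Hom C a (Src C i) \<and> Cmp C i h = g))"

definition is_cokernel :: "('o, 'm, 'k::field, 'x) lincat_scheme \<Rightarrow> 'm \<Rightarrow> 'm \<Rightarrow> bool" where
  "is_cokernel C f p \<longleftrightarrow> f \<in> Arr C \<and> p \<in> Arr C \<and> Src C p = Tgt C f \<and>
     Cmp C p f = Zer C (Src C f) (Tgt C p) \<and>
     (\<forall>b. \<forall>g\<in>Hom C (Tgt C f) b. Cmp C g f = Zer C (Src C f) b \<longrightarrow>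
        (\<exists>!h. h \<in> Hom C (Tgt C p) b \<and> Cmp C h p = g))"

definition abelian :: "('o, 'm, 'k::field, 'x) lincat_scheme \<Rightarrow> bool" where
  "abelian C \<longleftrightarrow> lin_category C \<and> (\<exists>a. zero_object C a) \<and> has_biproducts C \<and>
     (\<forall>f\<in>Arr C. (\<exists>i. is_kernel C f i) \<and> (\<exists>p. is_cokernel C f p)) \<and>
     (\<forall>f. mono_in C f \<longrightarrow> (\<exists>g. is_kernel C g f)) \<and>
     (\<forall>f. epi_in C f \<longrightarrow> (\<exists>g. is_cokernel C g f))"

definition simple_object :: "('o, 'm, 'k::field, 'x) lincat_scheme \<Rightarrow> 'o \<Rightarrow> bool" where
  "simple_object C a \<longleftrightarrow> a \<in> Obj C \<and> \<not> zero_object C a \<and>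
     (\<forall>f. mono_in C f \<and> Tgt C f = a \<longrightarrow> zero_object C (Src C f) \<or> iso_in C f)"

text \<open>An object of an abelian category has finite length iff it is reached from a zero object by
  finitely many extensions \<open>0 \<rightarrow> a \<rightarrow> b \<rightarrow> s \<rightarrow> 0\<close> with \<open>s\<close> simple (a composition series).\<close>

inductive finite_length :: "('o, 'm, 'k::field, 'x) lincat_scheme \<Rightarrow> 'o \<Rightarrow> bool"
  for C where
  zero: "zero_object C a \<Longrightarrow> finite_length C a"
| extend: "\<lbrakk>finite_length C (Src C i); mono_in C i; is_cokernel C i p; simple_object C (Tgt C p)\<rbrakk>
    \<Longrightarrow> finite_length C (Tgt C i)"

definition locally_finite_abelian :: "('o, 'm, 'k::field, 'x) lincat_scheme \<Rightarrow> bool" where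
  "locally_finite_abelian C \<longleftrightarrow> abelian C \<and>
     (\<forall>a\<in>Obj C. finite_length C a) \<and>
     (\<forall>a\<in>Obj C. \<forall>b\<in>Obj C. finite_dim_on (Hom C a b) (Plus C) (Zer C a b) (Smul C))"


section \<open>Schurian categories\<close>

record ('i, 'a, 'k) lu_alg =
  Idx :: "'i set"
  Idem :: "'i \<Rightarrow> 'a"
  ACar :: "'a set"
  AAdd :: "'a \<Rightarrow> 'a \<Rightarrow> 'a"
  AZero :: 'a
  AScal :: "'k \<Rightarrow> 'a \<Rightarrow> 'a"
  AMul :: "'a \<Rightarrow> 'a \<Rightarrow> 'a"

definition peirce :: "('i, 'a, 'k) lu_alg \<Rightarrow> 'i \<Rightarrow> 'i \<Rightarrow> 'a set" where
  "peirce A i j = (\<lambda>a. AMul A (AMul A (Idem A i) a) (Idem A j)) ` ACar A"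

text \<open>A locally unital algebra is the direct sum of the spaces \<open>peirce A i j\<close>; the sum is
  automatically direct because the idempotents are orthogonal, so only the spanning is stated.\<close>

definition locally_unital_algebra :: "('i, 'a, 'k::field) lu_alg \<Rightarrow> bool" where
  "locally_unital_algebra A \<longleftrightarrow>
     vspace_on (ACar A) (AAdd A) (AZero A) (AScal A) \<and>
     (\<forall>a\<in>ACar A. \<forall>b\<in>ACar A. AMul A a b \<in> ACar A) \<and>
     (\<forall>a\<in>ACar A. \<forall>b\<in>ACar A. \<forall>c\<in>ACar A. AMul A (AMul A a b) c = AMul A a (AMul A b c)) \<and>
     (\<forall>a\<in>ACar A. \<forall>b\<in>ACar A. \<forall>c\<in>ACar A.
        AMul A (AAdd A a b) c = AAdd A (AMul A a c) (AMul A b c) \<and>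
        AMul A c (AAdd A a b) = AAdd A (AMul A c a) (AMul A c b)) \<and>
     (\<forall>s. \<forall>a\<in>ACar A. \<forall>b\<in>ACar A.
        AMul A (AScal A s a) b = AScal A s (AMul A a b) \<and>
        AMul A a (AScal A s b) = AScal A s (AMul A a b)) \<and>
     (\<forall>i\<in>Idx A. Idem A i \<in> ACar A) \<and>
     (\<forall>i\<in>Idx A. \<forall>j\<in>Idx A. AMul A (Idem A i) (Idem A j) = (if i = j then Idem A i else AZero A)) \<and>
     span_on (ACar A) (AAdd A) (AZero A) (AScal A) (\<Union>i\<in>Idx A. \<Union>j\<in>Idx A. peirce A i j) = ACar A"

definition locally_fd_algebra :: "('i, 'a, 'k::field) lu_alg \<Rightarrow> bool" where
  "locally_fd_algebra A \<longleftrightarrow> locally_unital_algebra A \<and>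
     (\<forall>i\<in>Idx A. \<forall>j\<in>Idx A. finite_dim_on (peirce A i j) (AAdd A) (AZero A) (AScal A))"

record ('a, 'v, 'k) amod =
  MCar :: "'v set"
  MAdd :: "'v \<Rightarrow> 'v \<Rightarrow> 'v"
  MZero :: 'v
  MScal :: "'k \<Rightarrow> 'v \<Rightarrow> 'v"
  MAct :: "'a \<Rightarrow> 'v \<Rightarrow> 'v"

text \<open>Left modules \<open>V\<close> that are the (automatically direct) sum of their subspaces \<open>1\<^sub>i V\<close>,
  all of which are finite-dimensional.\<close>

definition lfd_module :: "('i, 'a, 'k::field) lu_alg \<Rightarrow> ('a, 'v, 'k) amod \<Rightarrow> bool" where
  "lfd_module A V \<longleftrightarrow>
     vspace_on (MCar V) (MAdd V) (MZero V) (MScal V) \<and>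
     (\<forall>a\<in>ACar A. \<forall>v\<in>MCar V. MAct V a v \<in> MCar V) \<and>
     (\<forall>a\<in>ACar A. \<forall>b\<in>ACar A. \<forall>v\<in>MCar V. MAct V (AMul A a b) v = MAct V a (MAct V b v)) \<and>
     (\<forall>a\<in>ACar A. \<forall>b\<in>ACar A. \<forall>v\<in>MCar V. MAct V (AAdd A a b) v = MAdd V (MAct V a v) (MAct V b v)) \<and>
     (\<forall>a\<in>ACar A. \<forall>v\<in>MCar V. \<forall>w\<in>MCar V. MAct V a (MAdd V v w) = MAdd V (MAct V a v) (MAct V a w)) \<and>
     (\<forall>s. \<forall>a\<in>ACar A. \<forall>v\<in>MCar V.
        MAct V (AScal A s a) v = MScal V s (MAct V a v) \<and>
        MAct V a (MScal V s v) = MScal V s (MAct V a v)) \<and>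
     span_on (MCar V) (MAdd V) (MZero V) (MScal V)
       (\<Union>i\<in>Idx A. MAct V (Idem A i) ` MCar V) = MCar V \<and>
     (\<forall>i\<in>Idx A. finite_dim_on (MAct V (Idem A i) ` MCar V) (MAdd V) (MZero V) (MScal V))"

definition lfd_module_hom ::
  "('i, 'a, 'k::field) lu_alg \<Rightarrow> ('a, 'v, 'k) amod \<Rightarrow> ('a, 'v, 'k) amod \<Rightarrow> ('v \<Rightarrow> 'v) \<Rightarrow> bool" where
  "lfd_module_hom A V W f \<longleftrightarrow>
     f \<in> extensional (MCar V) \<and> f ` MCar V \<subseteq> MCar W \<and>
     (\<forall>v\<in>MCar V. \<forall>w\<in>MCar V. f (MAdd V v w) = MAdd W (f v) (f w)) \<and>
     (\<forall>s. \<forall>v\<in>MCar V. f (MScal V s v) = MScal W s (f v)) \<and>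
     (\<forall>a\<in>ACar A. \<forall>v\<in>MCar V. f (MAct V a v) = MAct W a (f v))"

text \<open>The underlying sets of the modules are taken inside the type \<open>'i \<times> nat \<Rightarrow> 'k\<close>.  This loses
  nothing up to equivalence: a locally finite-dimensional module is, as a vector space, a direct sum
  of spaces \<open>k\<^sup>n\<close> indexed by elements of \<open>'i\<close>, so it is isomorphic to one with such a carrier.\<close>

type_synonym ('i, 'a, 'k) lfdmod_obj = "('a, 'i \<times> nat \<Rightarrow> 'k, 'k) amod"
type_synonym ('i, 'a, 'k) lfdmod_arr =
  "('i, 'a, 'k) lfdmod_obj \<times> ('i, 'a, 'k) lfdmod_obj \<times> (('i \<times> nat \<Rightarrow> 'k) \<Rightarrow> ('i \<times> nat \<Rightarrow> 'k))"

definition lfd_modules ::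
  "('i, 'a, 'k::field) lu_alg \<Rightarrow> (('i, 'a, 'k) lfdmod_obj, ('i, 'a, 'k) lfdmod_arr, 'k) lincat" where
  "lfd_modules A =
     \<lparr>Obj = {V. lfd_module A V},
      Arr = {(V, W, f). lfd_module A V \<and> lfd_module A W \<and> lfd_module_hom A V W f},
      Src = (\<lambda>\<phi>. fst \<phi>),
      Tgt = (\<lambda>\<phi>. fst (snd \<phi>)),
      Ident = (\<lambda>V. (V, V, \<lambda>v\<in>MCar V. v)),
      Cmp = (\<lambda>\<psi> \<phi>. (fst \<phi>, fst (snd \<psi>), compose (MCar (fst \<phi>)) (snd (snd \<psi>)) (snd (snd \<phi>)))),
      Plus = (\<lambda>\<phi> \<psi>. (fst \<phi>, fst (snd \<phi>),
        \<lambda>v\<in>MCar (fst \<phi>). MAdd (fst (snd \<phi>)) (snd (snd \<phi>) v) (snd (snd \<psi>) v))),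
      Zer = (\<lambda>V W. (V, W, \<lambda>v\<in>MCar V. MZero W)),
      Smul = (\<lambda>c \<phi>. (fst \<phi>, fst (snd \<phi>),
        \<lambda>v\<in>MCar (fst \<phi>). MScal (fst (snd \<phi>)) c (snd (snd \<phi>) v)))\<rparr>"

text \<open>HOL cannot quantify over types inside a formula; the two type arguments say over which types
  the index set and the algebra range.  With \<open>'i\<close> and \<open>'a\<close> free in a theorem's hypothesis, the
  algebra is arbitrary.\<close>

definition schurian ::
  "'i itself \<Rightarrow> 'a itself \<Rightarrow> ('o, 'm, 'k::field, 'x) lincat_scheme \<Rightarrow> bool" where
  "schurian TI TA C \<longleftrightarrow> lin_category C \<and>
     (\<exists>A :: ('i, 'a, 'k) lu_alg. locally_fd_algebra A \<and> lin_equivalent C (lfd_modules A))"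


section \<open>The affine Kauffman category\<close>

text \<open>The object \<open>K\<^sup>\<otimes>\<^sup>n\<close> is the natural number \<open>n\<close>.  Morphisms are classes of well-typed terms in
  the generators modulo the congruence generated by the axioms of a strict linear monoidal category
  and the defining relations.  \<open>Comp s r\<close> is \<open>s \<circ> r\<close>.\<close>

datatype 'k ak_term =
    Cap | Cup | CrossP | CrossM | Dot | DotInv
  | Idt nat
  | Zero nat nat
  | Comp "'k ak_term" "'k ak_term"
  | Tens "'k ak_term" "'k ak_term"
  | Add "'k ak_term" "'k ak_term"
  | Scal 'k "'k ak_term"

inductive ak_typed :: "nat \<Rightarrow> nat \<Rightarrow> 'k ak_term \<Rightarrow> bool" where
  "ak_typed 2 0 Cap"
| "ak_typed 0 2 Cup"
| "ak_typed 2 2 CrossP"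
| "ak_typed 2 2 CrossM"
| "ak_typed 1 1 Dot"
| "ak_typed 1 1 DotInv"
| "ak_typed n n (Idt n)"
| "ak_typed m n (Zero m n)"
| "\<lbrakk>ak_typed m n r; ak_typed n p s\<rbrakk> \<Longrightarrow> ak_typed m p (Comp s r)"
| "\<lbrakk>ak_typed m n r; ak_typed m' n' s\<rbrakk> \<Longrightarrow> ak_typed (m + m') (n + n') (Tens r s)"
| "\<lbrakk>ak_typed m n r; ak_typed m n s\<rbrakk> \<Longrightarrow> ak_typed m n (Add r s)"
| "ak_typed m n r \<Longrightarrow> ak_typed m n (Scal c r)"

abbreviation (input) ak_minus :: "'k::field ak_term \<Rightarrow> 'k ak_term \<Rightarrow> 'k ak_term" where
  "ak_minus r s \<equiv> Add r (Scal (- 1) s)"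

inductive ak_eq :: "'k::field \<Rightarrow> 'k \<Rightarrow> nat \<Rightarrow> nat \<Rightarrow> 'k ak_term \<Rightarrow> 'k ak_term \<Rightarrow> bool"
  for z t :: "'k::field" where
  \<comment> \<open>congruence\<close>
  refl: "ak_typed m n r \<Longrightarrow> ak_eq z t m n r r"
| sym: "ak_eq z t m n r s \<Longrightarrow> ak_eq z t m n s r"
| trans: "\<lbrakk>ak_eq z t m n r s; ak_eq z t m n s q\<rbrakk> \<Longrightarrow> ak_eq z t m n r q"
| comp_cong: "\<lbrakk>ak_eq z t m n r r'; ak_eq z t n p s s'\<rbrakk>
    \<Longrightarrow> ak_eq z t m p (Comp s r) (Comp s' r')"
| tens_cong: "\<lbrakk>ak_eq z t m n r r'; ak_eq z t m' n' s s'\<rbrakk>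
    \<Longrightarrow> ak_eq z t (m + m') (n + n') (Tens r s) (Tens r' s')"
| add_cong: "\<lbrakk>ak_eq z t m n r r'; ak_eq z t m n s s'\<rbrakk> \<Longrightarrow> ak_eq z t m n (Add r s) (Add r' s')"
| scal_cong: "ak_eq z t m n r r' \<Longrightarrow> ak_eq z t m n (Scal c r) (Scal c r')"
  \<comment> \<open>category\<close>
| id_left: "ak_typed m n r \<Longrightarrow> ak_eq z t m n (Comp (Idt n) r) r"
| id_right: "ak_typed m n r \<Longrightarrow> ak_eq z t m n (Comp r (Idt m)) r"
| comp_assoc: "\<lbrakk>ak_typed m n r; ak_typed n p s; ak_typed p q w\<rbrakk>
    \<Longrightarrow> ak_eq z t m q (Comp (Comp w s) r) (Comp w (Comp s r))"
  \<comment> \<open>vector space structure on morphism spaces\<close>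
| add_assoc: "\<lbrakk>ak_typed m n r; ak_typed m n s; ak_typed m n w\<rbrakk>
    \<Longrightarrow> ak_eq z t m n (Add (Add r s) w) (Add r (Add s w))"
| add_comm: "\<lbrakk>ak_typed m n r; ak_typed m n s\<rbrakk> \<Longrightarrow> ak_eq z t m n (Add r s) (Add s r)"
| add_zero: "ak_typed m n r \<Longrightarrow> ak_eq z t m n (Add (Zero m n) r) r"
| add_inverse: "ak_typed m n r \<Longrightarrow> ak_eq z t m n (ak_minus r r) (Zero m n)"
| scal_add_right: "\<lbrakk>ak_typed m n r; ak_typed m n s\<rbrakk>
    \<Longrightarrow> ak_eq z t m n (Scal c (Add r s)) (Add (Scal c r) (Scal c s))"
| scal_add_left: "ak_typed m n r
    \<Longrightarrow> ak_eq z t m n (Scal (c + d) r) (Add (Scal c r) (Scal d r))"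
| scal_scal: "ak_typed m n r \<Longrightarrow> ak_eq z t m n (Scal c (Scal d r)) (Scal (c * d) r)"
| scal_one: "ak_typed m n r \<Longrightarrow> ak_eq z t m n (Scal 1 r) r"
  \<comment> \<open>bilinearity of composition and tensor product\<close>
| comp_add_left: "\<lbrakk>ak_typed m n r; ak_typed n p s; ak_typed n p w\<rbrakk>
    \<Longrightarrow> ak_eq z t m p (Comp (Add s w) r) (Add (Comp s r) (Comp w r))"
| comp_add_right: "\<lbrakk>ak_typed m n r; ak_typed m n s; ak_typed n p w\<rbrakk>
    \<Longrightarrow> ak_eq z t m p (Comp w (Add r s)) (Add (Comp w r) (Comp w s))"
| comp_scal_left: "\<lbrakk>ak_typed m n r; ak_typed n p s\<rbrakk>
    \<Longrightarrow> ak_eq z t m p (Comp (Scal c s) r) (Scal c (Comp s r))"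
| comp_scal_right: "\<lbrakk>ak_typed m n r; ak_typed n p s\<rbrakk>
    \<Longrightarrow> ak_eq z t m p (Comp s (Scal c r)) (Scal c (Comp s r))"
| tens_add_left: "\<lbrakk>ak_typed m n r; ak_typed m n s; ak_typed m' n' w\<rbrakk>
    \<Longrightarrow> ak_eq z t (m + m') (n + n') (Tens (Add r s) w) (Add (Tens r w) (Tens s w))"
| tens_add_right: "\<lbrakk>ak_typed m n r; ak_typed m' n' s; ak_typed m' n' w\<rbrakk>
    \<Longrightarrow> ak_eq z t (m + m') (n + n') (Tens r (Add s w)) (Add (Tens r s) (Tens r w))"
| tens_scal_left: "\<lbrakk>ak_typed m n r; ak_typed m' n' s\<rbrakk>
    \<Longrightarrow> ak_eq z t (m + m') (n + n') (Tens (Scal c r) s) (Scal c (Tens r s))"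
| tens_scal_right: "\<lbrakk>ak_typed m n r; ak_typed m' n' s\<rbrakk>
    \<Longrightarrow> ak_eq z t (m + m') (n + n') (Tens r (Scal c s)) (Scal c (Tens r s))"
  \<comment> \<open>strict monoidal structure\<close>
| tens_id: "ak_eq z t (m + n) (m + n) (Tens (Idt m) (Idt n)) (Idt (m + n))"
| interchange: "\<lbrakk>ak_typed m n r; ak_typed n p s; ak_typed m' n' r'; ak_typed n' p' s'\<rbrakk>
    \<Longrightarrow> ak_eq z t (m + m') (p + p') (Tens (Comp s r) (Comp s' r')) (Comp (Tens s s') (Tens r r'))"
| tens_assoc: "\<lbrakk>ak_typed m n r; ak_typed m' n' s; ak_typed m'' n'' w\<rbrakk>
    \<Longrightarrow> ak_eq z t (m + m' + m'') (n + n' + n'') (Tens (Tens r s) w) (Tens r (Tens s w))"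
| unit_left: "ak_typed m n r \<Longrightarrow> ak_eq z t m n (Tens (Idt 0) r) r"
| unit_right: "ak_typed m n r \<Longrightarrow> ak_eq z t m n (Tens r (Idt 0)) r"
  \<comment> \<open>defining relations\<close>
| cross_pm: "ak_eq z t 2 2 (Comp CrossP CrossM) (Idt 2)"
| cross_mp: "ak_eq z t 2 2 (Comp CrossM CrossP) (Idt 2)"
| braid: "ak_eq z t 3 3
    (Comp (Tens CrossP (Idt 1)) (Comp (Tens (Idt 1) CrossP) (Tens CrossP (Idt 1))))
    (Comp (Tens (Idt 1) CrossP) (Comp (Tens CrossP (Idt 1)) (Tens (Idt 1) CrossP)))"
| zigzag_left: "ak_eq z t 1 1 (Comp (Tens (Idt 1) Cap) (Tens Cup (Idt 1))) (Idt 1)"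
| zigzag_right: "ak_eq z t 1 1 (Comp (Tens Cap (Idt 1)) (Tens (Idt 1) Cup)) (Idt 1)"
| curl: "ak_eq z t 2 0 (Comp Cap CrossM) (Scal t Cap)"
| cap_cross: "ak_eq z t 3 1
    (Comp (Tens (Idt 1) Cap) (Tens CrossM (Idt 1)))
    (Comp (Tens Cap (Idt 1)) (Tens (Idt 1) CrossP))"
| skein: "ak_eq z t 2 2
    (ak_minus CrossP CrossM) (Scal z (ak_minus (Idt 2) (Comp Cup Cap)))"
| loop: "ak_eq z t 0 0 (Comp Cap Cup) (Scal ((t - inverse t) / z + 1) (Idt 0))"
| dot_cross: "ak_eq z t 2 2
    (Comp CrossM (Tens Dot (Idt 1))) (Comp (Tens (Idt 1) Dot) CrossP)"
| dot_cap: "ak_eq z t 2 0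
    (Comp Cap (Tens Dot (Idt 1))) (Comp Cap (Tens (Idt 1) DotInv))"
| dot_inv_left: "ak_eq z t 1 1 (Comp DotInv Dot) (Idt 1)"
| dot_inv_right: "ak_eq z t 1 1 (Comp Dot DotInv) (Idt 1)"

type_synonym 'k ak_arr = "nat \<times> nat \<times> 'k ak_term set"

definition ak_class :: "'k::field \<Rightarrow> 'k \<Rightarrow> nat \<Rightarrow> nat \<Rightarrow> 'k ak_term \<Rightarrow> 'k ak_arr" where
  "ak_class z t m n r = (m, n, {s. ak_eq z t m n r s})"

definition ak_rep :: "'k ak_arr \<Rightarrow> 'k ak_term" where
  "ak_rep f = (SOME r. r \<in> snd (snd f))"

definition AK :: "'k::field \<Rightarrow> 'k \<Rightarrow> (nat, 'k ak_arr, 'k) moncat" where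
  "AK z t =
     \<lparr>Obj = UNIV,
      Arr = {ak_class z t m n r | m n r. ak_typed m n r},
      Src = (\<lambda>f. fst f),
      Tgt = (\<lambda>f. fst (snd f)),
      Ident = (\<lambda>n. ak_class z t n n (Idt n)),
      Cmp = (\<lambda>g f. ak_class z t (fst f) (fst (snd g)) (Comp (ak_rep g) (ak_rep f))),
      Plus = (\<lambda>f g. ak_class z t (fst f) (fst (snd f)) (Add (ak_rep f) (ak_rep g))),
      Zer = (\<lambda>m n. ak_class z t m n (Zero m n)),
      Smul = (\<lambda>c f. ak_class z t (fst f) (fst (snd f)) (Scal c (ak_rep f))),
      One = 0,
      TensO = (+),
      TensM = (\<lambda>f g. ak_class z t (fst f + fst g) (fst (snd f) + fst (snd g))
                                   (Tens (ak_rep f) (ak_rep g)))\<rparr>"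


section \<open>Module categories and the action on bricks\<close>

definition AK_module_category ::
  "'k::field \<Rightarrow> 'k \<Rightarrow> ('o, 'm, 'k) lincat \<Rightarrow> (nat, 'k ak_arr, ('o, 'm) endofunct, ('o, 'm) endotrans) funct
    \<Rightarrow> bool" where
  "AK_module_category z t R \<Psi> \<longleftrightarrow> lin_category R \<and> strict_mon_functor (AK z t) (End_cat R) \<Psi>"

text \<open>The component at \<open>L\<close> of the natural transformation attached to the morphism \<open>K\<^sup>\<otimes>\<^sup>m \<rightarrow> K\<^sup>\<otimes>\<^sup>n\<close>
  represented by the term \<open>r\<close>.\<close>

definition ak_act ::
  "'k::field \<Rightarrow> 'k \<Rightarrow> (nat, 'k ak_arr, ('o, 'm) endofunct, ('o, 'm) endotrans) funct
    \<Rightarrow> nat \<Rightarrow> nat \<Rightarrow> 'k ak_term \<Rightarrow> 'o \<Rightarrow> 'm" where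
  "ak_act z t \<Psi> m n r L = component (FArr \<Psi> (ak_class z t m n r)) L"

definition brick :: "('o, 'm, 'k::field, 'x) lincat_scheme \<Rightarrow> 'o \<Rightarrow> bool" where
  "brick C L \<longleftrightarrow> L \<in> Obj C \<and> bij_betw (\<lambda>c. Smul C c (Ident C L)) UNIV (Hom C L L)"

definition brick_scalar :: "('o, 'm, 'k::field, 'x) lincat_scheme \<Rightarrow> 'o \<Rightarrow> 'm \<Rightarrow> 'k" where
  "brick_scalar C L f = (THE c. f = Smul C c (Ident C L))"

definition ak_sum :: "nat \<Rightarrow> nat \<Rightarrow> 'k ak_term list \<Rightarrow> 'k ak_term" where
  "ak_sum m n rs = foldr Add rs (Zero m n)"

definition dot_pow :: "int \<Rightarrow> 'k ak_term" where
  "dot_pow n = (if n \<ge> 0 then (Comp Dot ^^ nat n) (Idt 1) else (Comp DotInv ^^ nat (- n)) (Idt 1))"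

text \<open>Laurent polynomials \<open>k[u, u\<^sup>-\<^sup>1]\<close> are the group algebra \<open>int \<Rightarrow>\<^sub>0 'k\<close>, with \<open>u\<^sup>n\<close> being
  \<open>Poly_Mapping.single n 1\<close>.\<close>

definition laurent_of_poly :: "'k::field poly \<Rightarrow> (int \<Rightarrow>\<^sub>0 'k)" where
  "laurent_of_poly p = (\<Sum>i\<le>degree p. Poly_Mapping.single (int i) (coeff p i))"

definition laurent_at_dot :: "(int \<Rightarrow>\<^sub>0 'k::field) \<Rightarrow> 'k ak_term" where
  "laurent_at_dot f = ak_sum 1 1
     (map (\<lambda>n. Scal (Poly_Mapping.lookup f n) (dot_pow n)) (sorted_list_of_set (Poly_Mapping.keys f)))"

definition dot_ideal ::
  "'k::field \<Rightarrow> 'k \<Rightarrow> ('o, 'm, 'k) lincat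
    \<Rightarrow> (nat, 'k ak_arr, ('o, 'm) endofunct, ('o, 'm) endotrans) funct \<Rightarrow> 'o
    \<Rightarrow> (int \<Rightarrow>\<^sub>0 'k) set" where
  "dot_ideal z t R \<Psi> L =
     {f. ak_act z t \<Psi> 1 1 (laurent_at_dot f) L
           = Zer R (FObj (FObj \<Psi> 1) L) (FObj (FObj \<Psi> 1) L)}"

text \<open>At most one polynomial \<open>m\<close> satisfies the following predicate.  One exists exactly if the ideal
  is nonzero, which is automatic when \<open>End(KL)\<close> is finite-dimensional.\<close>

definition is_dot_min_poly ::
  "'k::field \<Rightarrow> 'k \<Rightarrow> ('o, 'm, 'k) lincat
    \<Rightarrow> (nat, 'k ak_arr, ('o, 'm) endofunct, ('o, 'm) endotrans) funct \<Rightarrow> 'o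
    \<Rightarrow> 'k poly \<Rightarrow> bool" where
  "is_dot_min_poly z t R \<Psi> L m \<longleftrightarrow>
     lead_coeff m = 1 \<and> poly m 0 \<noteq> 0 \<and>
     dot_ideal z t R \<Psi> L = {g * laurent_of_poly m | g. True}"


section \<open>Rational functions and the bubble series\<close>

text \<open>The value of the rational function \<open>r\<close> at the point \<open>y\<close> of an extension, where \<open>\<iota>\<close> is the
  embedding of the ground field.\<close>

definition eval_ratfun :: "('k::field \<Rightarrow> 'f::field) \<Rightarrow> 'f \<Rightarrow> 'k poly fract \<Rightarrow> 'f" where
  "eval_ratfun \<iota> y r =
     (THE s. \<exists>p q. r = Fraction_Field.Fract p q \<and> poly (map_poly \<iota> q) y \<noteq> 0 \<and>
                    s = poly (map_poly \<iota> p) y / poly (map_poly \<iota> q) y)"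

text \<open>Power series in \<open>u\<^sup>-\<^sup>1\<close> are formal series in \<open>fls_X = u\<^sup>-\<^sup>1\<close>, so expansion at infinity puts
  \<open>u = fls_X_inv\<close>.\<close>

definition at_infinity_fls :: "'k::field poly fract \<Rightarrow> 'k fls" where
  "at_infinity_fls = eval_ratfun fls_const fls_X_inv"

definition invert_variable :: "'k::field poly fract \<Rightarrow> 'k poly fract" where
  "invert_variable =
     eval_ratfun (\<lambda>c. Fraction_Field.Fract [:c:] 1) (Fraction_Field.Fract 1 [:0, 1:])"

definition bubble_r :: "nat \<Rightarrow> 'k ak_term" where
  "bubble_r n = Comp Cap (Comp (Tens (Idt 1) (dot_pow (int n))) Cup)"

definition bubble_l :: "nat \<Rightarrow> 'k ak_term" where
  "bubble_l n = Comp Cap (Comp (Tens (dot_pow (int n)) (Idt 1)) Cup)"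

text \<open>The coefficient of \<open>u\<^sup>-\<^sup>n\<close> in \<open>a(u) 1 + b(u) \<Sum>\<^sub>i c\<^sub>i u\<^sup>-\<^sup>i\<close>, for rational functions \<open>a\<close>, \<open>b\<close> that
  are regular at infinity.\<close>

definition bubble_coeff ::
  "'k::field poly fract \<Rightarrow> 'k poly fract \<Rightarrow> (nat \<Rightarrow> 'k ak_term) \<Rightarrow> nat \<Rightarrow> 'k ak_term" where
  "bubble_coeff a b c n =
     Add (Scal (fls_nth (at_infinity_fls a) (int n)) (Idt 0))
         (ak_sum 0 0 (map (\<lambda>i. Scal (fls_nth (at_infinity_fls b) (int (n - i))) (c i)) [0..<Suc n]))"

definition beta_r :: "'k::field \<Rightarrow> 'k \<Rightarrow> nat \<Rightarrow> 'k ak_term" where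
  "beta_r z t = bubble_coeff
     (Fraction_Field.Fract [:- inverse t, 0, inverse t - z:] [:- 1, - z, 1:])
     (Fraction_Field.Fract [:- z, 0, z:] [:- 1, - z, 1:])
     bubble_r"

definition beta_l :: "'k::field \<Rightarrow> 'k \<Rightarrow> nat \<Rightarrow> 'k ak_term" where
  "beta_l z t = bubble_coeff
     (Fraction_Field.Fract [:- t, 0, t + z:] [:- 1, z, 1:])
     (- Fraction_Field.Fract [:- z, 0, z:] [:- 1, z, 1:])
     bubble_l"

definition O_brick ::
  "'k::field \<Rightarrow> 'k \<Rightarrow> ('o, 'm, 'k) lincat
    \<Rightarrow> (nat, 'k ak_arr, ('o, 'm) endofunct, ('o, 'm) endotrans) funct \<Rightarrow> 'o \<Rightarrow> 'k fps" where
  "O_brick z t R \<Psi> L = Abs_fps (\<lambda>n. brick_scalar R L (ak_act z t \<Psi> 0 0 (beta_r z t n) L))"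

definition O_tilde_brick ::
  "'k::field \<Rightarrow> 'k \<Rightarrow> ('o, 'm, 'k) lincat
    \<Rightarrow> (nat, 'k ak_arr, ('o, 'm) endofunct, ('o, 'm) endotrans) funct \<Rightarrow> 'o \<Rightarrow> 'k fps" where
  "O_tilde_brick z t R \<Psi> L = Abs_fps (\<lambda>n. brick_scalar R L (ak_act z t \<Psi> 0 0 (beta_l z t n) L))"

definition check_poly :: "'k::field poly \<Rightarrow> 'k poly" where
  "check_poly f = smult (inverse (poly f 0)) (reflect_poly f)"

definition O_poly :: "'k::field \<Rightarrow> 'k \<Rightarrow> 'k poly \<Rightarrow> 'k poly fract" where
  "O_poly z t f =
     (if even (degree f)
      then Fraction_Field.Fract [:- (z * poly f 0) - t, 0, t:] [:- 1, - z, 1:]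
      else Fraction_Field.Fract [:- t, - (z * poly f 0), t:] [:- 1, - z, 1:])
     * Fraction_Field.Fract (check_poly f) f"

definition O_tilde_poly :: "'k::field \<Rightarrow> 'k \<Rightarrow> 'k poly \<Rightarrow> 'k poly fract" where
  "O_tilde_poly z t f =
     (if even (degree f)
      then Fraction_Field.Fract [:z * inverse (poly f 0) - inverse t, 0, inverse t:] [:- 1, z, 1:]
      else Fraction_Field.Fract [:- inverse t, z * inverse (poly f 0), inverse t:] [:- 1, z, 1:])
     * Fraction_Field.Fract f (check_poly f)"

end

theory Submission
  imports Defs
begin

text \<open>
  Evaluating transformations at objects turns a module category into an endofunctor \<open>K\<close> with natural
  transformations for the dot \<open>x\<close>, the cap, the cup and the crossings.  On a brick \<open>L\<close> the bubble
  with \<open>n\<close> dots on its right side (\<open>n\<close> any integer) is a scalar \<open>b\<^sub>n\<close>, and a bubble with \<open>n\<close> dots on its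
  left side is \<open>b\<^sub>-\<^sub>n\<close>.  Let \<open>m\<close> be the minimal polynomial of the dot, \<open>d\<close> its degree,
  \<open>M = m(0)\<close>, and \<open>m*(u) = u\<^sup>d m(u\<^sup>-\<^sup>1)\<close>.

  Two things follow from \<open>m(x) = 0\<close> on \<open>K L\<close>.  First, bubbles carrying \<open>u\<^sup>k m(u)\<close> vanish, so
  \<open>\<Sum>\<^sub>i m\<^sub>i b\<^sub>i\<^sub>+\<^sub>k = 0\<close> for every integer \<open>k\<close> (\<open>bubble_recurrence\<close>).  Therefore
  \<open>\<Sum>\<^sub>n b\<^sub>n v\<^sup>n\<close>, \<open>n \<ge> 0\<close>, is a rational function \<open>Q(v) / m*(v)\<close>, and the series of the \<open>b\<^sub>-\<^sub>n\<close> is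
  determined by the same \<open>Q\<close> (\<open>right_series\<close>, \<open>left_series\<close>).

  Secondly, a strand with a curl to its right vanishes when the far side of the curl, which is the
  strand next to \<open>L\<close>, carries \<open>m(x)\<close>.  On the other hand, the curl can be computed: a dot moves from
  the far side over the cup and through the crossing onto the strand, which changes the sign of
  the crossing, and the skein relation restores the sign at the cost of a bubble and a straight
  strand (\<open>curl_dot\<close>); the undotted curl is \<open>t\<^sup>-\<^sup>1\<close> (\<open>curl_undotted\<close>).  So
  \<open>x\<^sup>n\<close> times the curl with \<open>n\<close> dots is
  \<open>D\<^sub>n(x) = t\<^sup>-\<^sup>1 + z \<Sum>\<^sub>k\<^sub><\<^sub>n (b\<^sub>k x\<^sup>k - x\<^sup>2\<^sup>k)\<close>, and \<open>m\<close> divides \<open>\<Sum>\<^sub>i m\<^sub>i u\<^sup>d\<^sup>-\<^sup>i D\<^sub>i(u)\<close>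
  (\<open>min_poly_dvd_curl_poly\<close>).  Multiplication by \<open>u\<^sup>2 - 1\<close> sums the geometric progressions and gives
  \<open>(t\<^sup>-\<^sup>1 (u\<^sup>2 - 1) + z) m*(u) + z (u\<^sup>2 - 1) Q(u) = q(u) m(u)\<close> with
  \<open>q(u) = z u\<^sup>d + (u\<^sup>2 - 1) H(u)\<close> for some polynomial \<open>H\<close>.

  By degrees, \<open>q\<close> is quadratic.  Its extreme coefficients are \<open>t\<^sup>-\<^sup>1 M\<close> and \<open>- t M\<^sup>-\<^sup>1\<close>, and it is
  congruent to \<open>z u\<^sup>d\<close> modulo \<open>u\<^sup>2 - 1\<close>; comparing the residues yields the middle coefficient
  and the restriction on \<open>M\<close> in both parities (\<open>key_identity\<close>).  Solving the identity for the bubble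
  series at \<open>u\<^sup>-\<^sup>1\<close> and at \<open>u\<close> gives the two stated rational functions, and the restriction
  on \<open>M\<close> makes them exchange under \<open>u \<mapsto> u\<^sup>-\<^sup>1\<close>.
\<close>

section \<open>Calculus in linear categories\<close>

context vspace_on
begin

lemma plus_zero: "x \<in> V \<Longrightarrow> add x zero = x"
  by (metis add_comm add_zero zero_closed)

lemma add_left_commute:
  "\<lbrakk>x \<in> V; y \<in> V; w \<in> V\<rbrakk> \<Longrightarrow> add x (add y w) = add y (add x w)"
  by (metis add_assoc add_comm)

lemma add_left_cancel:
  assumes "x \<in> V" "y \<in> V" "w \<in> V" "add x y = add x w"
  shows "y = w"
proof -
  obtain v where v: "v \<in> V" "add x v = zero"
    using add_inverse assms(1) by blast
  then have v': "add v x = zero"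
    using assms(1) add_comm by simp
  have "y = add (add v x) y"
    using v' add_zero assms by simp
  also have "\<dots> = add v (add x w)"
    using add_assoc v assms by simp
  also have "\<dots> = w"
    using add_assoc[symmetric] v v' assms add_zero by simp
  finally show ?thesis .
qed

lemma scal_0: "x \<in> V \<Longrightarrow> scal 0 x = zero"
  using add_left_cancel[of "scal 0 x" "scal 0 x" zero] scal_add_left[of x 0 0]
  by (simp add: scal_closed zero_closed plus_zero)

lemma scal_zero: "scal c zero = zero"
  using add_left_cancel[of "scal c zero" "scal c zero" zero] scal_add_right[of zero zero c]
  by (simp add: scal_closed zero_closed plus_zero)

lemma add_minus: "x \<in> V \<Longrightarrow> add x (scal (- 1) x) = zero"
  using scal_add_left[of x 1 "-1"] by (simp add: scal_one scal_0)

text \<open>A Laurent polynomial is a finitely supported family of coefficients; this is the linear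
  combination with these coefficients of a family of vectors.  The list of exponents is explicit
  in the auxiliary form because the supports of \<open>f\<close>, \<open>g\<close> and \<open>f + g\<close> differ.\<close>

definition comb_over :: "(int \<Rightarrow> 'v) \<Rightarrow> int list \<Rightarrow> (int \<Rightarrow>\<^sub>0 'k) \<Rightarrow> 'v" where
  "comb_over v ns f = foldr add (map (\<lambda>n. scal (Poly_Mapping.lookup f n) (v n)) ns) zero"

definition comb :: "(int \<Rightarrow> 'v) \<Rightarrow> (int \<Rightarrow>\<^sub>0 'k) \<Rightarrow> 'v" where
  "comb v f = comb_over v (sorted_list_of_set (Poly_Mapping.keys f)) f"

lemma comb_over_closed: "range v \<subseteq> V \<Longrightarrow> comb_over v ns f \<in> V"
  by (induction ns) (auto simp: comb_over_def zero_closed add_closed scal_closed image_subset_iff)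

lemma comb_closed: "range v \<subseteq> V \<Longrightarrow> comb v f \<in> V"
  by (simp add: comb_def comb_over_closed)

lemma comb_over_keys:
  assumes "range v \<subseteq> V"
  shows "comb_over v (filter (\<lambda>n. n \<in> Poly_Mapping.keys f) ns) f = comb_over v ns f"
proof (induction ns)
  case Nil
  then show ?case by (simp add: comb_over_def)
next
  case (Cons n ns)
  have "comb_over v ns f \<in> V"
    using assms by (rule comb_over_closed)
  moreover have "v n \<in> V"
    using assms by auto
  ultimately show ?case
    using Cons by (auto simp: comb_over_def in_keys_iff scal_0 add_zero)
qed

lemma comb_eq_comb_over:
  assumes "range v \<subseteq> V" "finite S" "Poly_Mapping.keys f \<subseteq> S"
  shows "comb v f = comb_over v (sorted_list_of_set S) f"
proof -
  have "filter (\<lambda>n. n \<in> Poly_Mapping.keys f) (sorted_list_of_set S)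
      = sorted_list_of_set (Poly_Mapping.keys f)"
    by (rule sorted_distinct_set_unique)
       (use assms in \<open>auto simp: sorted_wrt_filter\<close>)
  then show ?thesis
    using comb_over_keys[OF assms(1), of f "sorted_list_of_set S"] by (simp add: comb_def)
qed

lemma comb_over_add:
  assumes "range v \<subseteq> V"
  shows "comb_over v ns (f + g) = add (comb_over v ns f) (comb_over v ns g)"
proof (induction ns)
  case Nil
  then show ?case by (simp add: comb_over_def add_zero zero_closed)
next
  case (Cons n ns)
  let ?f = "scal (Poly_Mapping.lookup f n) (v n)" and ?g = "scal (Poly_Mapping.lookup g n) (v n)"
  let ?F = "comb_over v ns f" and ?G = "comb_over v ns g"
  have v: "v n \<in> V" "?F \<in> V" "?G \<in> V" "?f \<in> V" "?g \<in> V"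
    using assms by (auto simp: comb_over_closed image_subset_iff intro: scal_closed)
  have "comb_over v (n # ns) (f + g) = add (add ?f ?g) (add ?F ?G)"
    using Cons v by (simp add: comb_over_def lookup_add scal_add_left)
  also have "\<dots> = add (add ?f ?F) (add ?g ?G)"
    using v by (simp add: add_assoc add_left_commute add_closed)
  finally show ?case
    by (simp add: comb_over_def)
qed

lemma comb_add:
  assumes "range v \<subseteq> V"
  shows "comb v (f + g) = add (comb v f) (comb v g)"
proof -
  let ?S = "Poly_Mapping.keys f \<union> Poly_Mapping.keys g"
  have "comb v h = comb_over v (sorted_list_of_set ?S) h" if "h \<in> {f, g, f + g}" for h
    using that Poly_Mapping.keys_add[of f g]
    by (intro comb_eq_comb_over assms) auto
  then show ?thesis
    by (simp add: comb_over_add[OF assms])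
qed

lemma comb_0: "comb v 0 = zero"
  by (simp add: comb_def comb_over_def)

lemma comb_single:
  assumes "range v \<subseteq> V"
  shows "comb v (Poly_Mapping.single n c) = scal c (v n)"
proof -
  have "v n \<in> V"
    using assms by auto
  then show ?thesis
    using comb_eq_comb_over[OF assms, of "{n}" "Poly_Mapping.single n c"]
    by (simp add: comb_over_def scal_closed plus_zero)
qed

end

lemma laurent_induct [case_names zero single add]:
  fixes f :: "'a \<Rightarrow>\<^sub>0 'b::comm_monoid_add"
  assumes "P 0" "\<And>n c. P (Poly_Mapping.single n c)" "\<And>f g. P f \<Longrightarrow> P g \<Longrightarrow> P (f + g)"
  shows "P f"
proof -
  have sum: "P (\<Sum>n\<in>A. F n)" if "finite A" "\<And>n. P (F n)" for A and F :: "'a \<Rightarrow> 'a \<Rightarrow>\<^sub>0 'b"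
    using that by (induction A rule: finite_induct) (auto simp: assms)
  have "f = (\<Sum>n\<in>Poly_Mapping.keys f. Poly_Mapping.single n (Poly_Mapping.lookup f n))"
    by (rule poly_mapping_eqI) (simp add: lookup_sum lookup_single when_def in_keys_iff)
  then show ?thesis
    using sum[of "Poly_Mapping.keys f"] assms(2) by (metis finite_keys)
qed

text \<open>Composability is expressed through sources and targets, which turns the axioms into
  conditional rewrite rules whose side conditions the simplifier discharges.\<close>

context lin_category
begin

abbreviation cmp (infixr \<open>\<cdot>\<close> 70) where "g \<cdot> f \<equiv> Cmp C g f"
abbreviation plus (infixl \<open>\<oplus>\<close> 65) where "f \<oplus> g \<equiv> Plus C f g"
abbreviation smul (infixr \<open>\<odot>\<close> 75) where "c \<odot> f \<equiv> Smul C c f"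
abbreviation ident (\<open>\<one>\<close>) where "\<one> a \<equiv> Ident C a"

lemma Hom_iff: "f \<in> Hom C a b \<longleftrightarrow> f \<in> Arr C \<and> Src C f = a \<and> Tgt C f = b"
  by (auto simp: Hom_def)

lemma ident_typing [simp]:
  assumes "a \<in> Obj C"
  shows "\<one> a \<in> Arr C" "Src C (\<one> a) = a" "Tgt C (\<one> a) = a"
  using ident_hom[OF assms] by (auto simp: Hom_iff)

lemma cmp_typing [simp]:
  assumes "f \<in> Arr C" "g \<in> Arr C" "Tgt C f = Src C g"
  shows "g \<cdot> f \<in> Arr C" "Src C (g \<cdot> f) = Src C f" "Tgt C (g \<cdot> f) = Tgt C g"
  using cmp_hom[of f "Src C f" "Tgt C f" g "Tgt C g"] assms by (auto simp: Hom_iff)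

lemma vspace_arr: "f \<in> Arr C \<Longrightarrow> vspace_on (Hom C (Src C f) (Tgt C f)) (Plus C) (Zer C (Src C f) (Tgt C f)) (Smul C)"
  by (intro hom_vspace src_obj tgt_obj)

lemma plus_typing [simp]:
  assumes "f \<in> Arr C" "g \<in> Arr C" "Src C f = Src C g" "Tgt C f = Tgt C g"
  shows "f \<oplus> g \<in> Arr C" "Src C (f \<oplus> g) = Src C g" "Tgt C (f \<oplus> g) = Tgt C g"
  using vspace_on.add_closed[OF vspace_arr[of g], of f g] assms by (auto simp: Hom_iff)

lemma smul_typing [simp]:
  assumes "f \<in> Arr C"
  shows "c \<odot> f \<in> Arr C" "Src C (c \<odot> f) = Src C f" "Tgt C (c \<odot> f) = Tgt C f"
  using vspace_on.scal_closed[OF vspace_arr[of f], of f c] assms by (auto simp: Hom_iff)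

lemma Zer_typing [simp]:
  assumes "a \<in> Obj C" "b \<in> Obj C"
  shows "Zer C a b \<in> Arr C" "Src C (Zer C a b) = a" "Tgt C (Zer C a b) = b"
  using vspace_on.zero_closed[OF hom_vspace[OF assms]] by (auto simp: Hom_iff)

lemma ident_cmp [simp]: "f \<in> Arr C \<Longrightarrow> Tgt C f = b \<Longrightarrow> \<one> b \<cdot> f = f"
  by (rule ident_left[of f "Src C f" b]) (simp add: Hom_iff)

lemma cmp_ident [simp]: "f \<in> Arr C \<Longrightarrow> Src C f = a \<Longrightarrow> f \<cdot> \<one> a = f"
  by (rule ident_right[of f a "Tgt C f"]) (simp add: Hom_iff)

lemma assoc:
  "\<lbrakk>f \<in> Arr C; g \<in> Arr C; h \<in> Arr C; Tgt C f = Src C g; Tgt C g = Src C h\<rbrakk>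
    \<Longrightarrow> (h \<cdot> g) \<cdot> f = h \<cdot> g \<cdot> f"
  by (rule cmp_assoc[of f "Src C f" "Tgt C f" g "Tgt C g" h "Tgt C h"]) (simp_all add: Hom_iff)

lemma plus_cmp:
  "\<lbrakk>f \<in> Arr C; g \<in> Arr C; h \<in> Arr C; Src C g = Tgt C f; Src C h = Tgt C f; Tgt C g = Tgt C h\<rbrakk>
    \<Longrightarrow> (g \<oplus> h) \<cdot> f = g \<cdot> f \<oplus> h \<cdot> f"
  by (rule cmp_plus_left[of f "Src C f" "Tgt C f" g "Tgt C h" h]) (simp_all add: Hom_iff)

lemma cmp_plus:
  "\<lbrakk>f \<in> Arr C; g \<in> Arr C; h \<in> Arr C; Tgt C f = Src C h; Tgt C g = Src C h; Src C f = Src C g\<rbrakk>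
    \<Longrightarrow> h \<cdot> (f \<oplus> g) = h \<cdot> f \<oplus> h \<cdot> g"
  by (rule cmp_plus_right[of f "Src C g" "Src C h" g h "Tgt C h"]) (simp_all add: Hom_iff)

lemma smul_cmp:
  "\<lbrakk>f \<in> Arr C; g \<in> Arr C; Tgt C f = Src C g\<rbrakk> \<Longrightarrow> (s \<odot> g) \<cdot> f = s \<odot> (g \<cdot> f)"
  by (rule cmp_smul_left[of f "Src C f" "Tgt C f" g "Tgt C g"]) (simp_all add: Hom_iff)

lemma cmp_smul:
  "\<lbrakk>f \<in> Arr C; g \<in> Arr C; Tgt C f = Src C g\<rbrakk> \<Longrightarrow> g \<cdot> (s \<odot> f) = s \<odot> (g \<cdot> f)"
  by (rule cmp_smul_right[of f "Src C f" "Tgt C f" g "Tgt C g"]) (simp_all add: Hom_iff)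

lemma plus_assoc:
  "\<lbrakk>f \<in> Arr C; g \<in> Arr C; h \<in> Arr C; Src C g = Src C f; Src C h = Src C f;
    Tgt C g = Tgt C f; Tgt C h = Tgt C f\<rbrakk> \<Longrightarrow> (f \<oplus> g) \<oplus> h = f \<oplus> (g \<oplus> h)"
  using vspace_on.add_assoc[OF vspace_arr[of f], of f g h] by (simp add: Hom_iff)

lemma plus_comm:
  "\<lbrakk>f \<in> Arr C; g \<in> Arr C; Src C g = Src C f; Tgt C g = Tgt C f\<rbrakk> \<Longrightarrow> f \<oplus> g = g \<oplus> f"
  using vspace_on.add_comm[OF vspace_arr[of f], of f g] by (simp add: Hom_iff)

lemma smul_plus:
  "\<lbrakk>f \<in> Arr C; g \<in> Arr C; Src C g = Src C f; Tgt C g = Tgt C f\<rbrakk>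
    \<Longrightarrow> c \<odot> (f \<oplus> g) = c \<odot> f \<oplus> c \<odot> g"
  using vspace_on.scal_add_right[OF vspace_arr[of f], of f g c] by (simp add: Hom_iff)

lemma add_smul: "f \<in> Arr C \<Longrightarrow> (c + d) \<odot> f = c \<odot> f \<oplus> d \<odot> f"
  using vspace_on.scal_add_left[OF vspace_arr[of f], of f c d] by (simp add: Hom_iff)

lemma smul_smul [simp]: "f \<in> Arr C \<Longrightarrow> c \<odot> d \<odot> f = (c * d) \<odot> f"
  using vspace_on.scal_scal[OF vspace_arr[of f], of f c d] by (simp add: Hom_iff)

lemma smul_1 [simp]: "f \<in> Arr C \<Longrightarrow> 1 \<odot> f = f"
  using vspace_on.scal_one[OF vspace_arr[of f], of f] by (simp add: Hom_iff)

lemma smul_0: "f \<in> Arr C \<Longrightarrow> 0 \<odot> f = Zer C (Src C f) (Tgt C f)"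
  using vspace_on.scal_0[OF vspace_arr[of f], of f] by (simp add: Hom_iff)

lemma smul_Zer [simp]: "\<lbrakk>a \<in> Obj C; b \<in> Obj C\<rbrakk> \<Longrightarrow> c \<odot> Zer C a b = Zer C a b"
  using vspace_on.scal_zero[OF hom_vspace] by blast

lemma plus_Zer: "\<lbrakk>f \<in> Arr C; Src C f = a; Tgt C f = b\<rbrakk> \<Longrightarrow> f \<oplus> Zer C a b = f"
  using vspace_on.plus_zero[OF vspace_arr[of f], of f] by (simp add: Hom_iff)

lemma Zer_plus: "\<lbrakk>f \<in> Arr C; Src C f = a; Tgt C f = b\<rbrakk> \<Longrightarrow> Zer C a b \<oplus> f = f"
  using vspace_on.add_zero[OF vspace_arr[of f], of f] by (simp add: Hom_iff)

lemma cmp_Zer: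
  assumes "g \<in> Arr C" "a \<in> Obj C" "Src C g = b"
  shows "g \<cdot> Zer C a b = Zer C a (Tgt C g)"
proof -
  have "b \<in> Obj C"
    using assms src_obj by auto
  then have "g \<cdot> (0 \<odot> Zer C a b) = 0 \<odot> (g \<cdot> Zer C a b)"
    using assms by (intro cmp_smul) auto
  then show ?thesis
    using assms \<open>b \<in> Obj C\<close> by (simp add: smul_0 del: smul_Zer)
qed

lemma eq_plus_of_minus:
  assumes "f \<in> Arr C" "g \<in> Arr C" "h \<in> Arr C" "Src C f = Src C g" "Tgt C f = Tgt C g"
    "Src C h = Src C g" "Tgt C h = Tgt C g" "f \<oplus> (- 1) \<odot> g = h"
  shows "f = g \<oplus> h"
proof -
  have "g \<oplus> h = (g \<oplus> f) \<oplus> (- 1) \<odot> g"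
    unfolding assms(8)[symmetric] using assms by (simp add: plus_assoc)
  also have "g \<oplus> f = f \<oplus> g"
    using assms by (simp add: plus_comm[of g f])
  also have "(f \<oplus> g) \<oplus> (- 1) \<odot> g = f \<oplus> (g \<oplus> (- 1) \<odot> g)"
    using assms by (simp add: plus_assoc)
  also have "g \<oplus> (- 1) \<odot> g = 0 \<odot> g"
    using add_smul[of g 1 "-1"] assms by simp
  also have "f \<oplus> 0 \<odot> g = f"
    using assms by (simp add: smul_0 plus_Zer)
  finally show ?thesis by simp
qed

end


section \<open>Strands acting on a linear category\<close>

text \<open>The endofunctor \<open>K\<close> is the action of one strand, and the object on which a diagram acts sits
  at the right of the diagram.  Hence a diagram with \<open>n\<close> further strands at its right is its
  component at \<open>K\<^sup>n a\<close>, one with a further strand at its left is obtained by applying \<open>Km\<close>, and the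
  interchange law becomes naturality.\<close>

locale kauffman_action = lin_category C
  for C :: "('o, 'm, 'k::field, 'x) lincat_scheme" +
  fixes z t :: 'k and K :: "'o \<Rightarrow> 'o" and Km :: "'m \<Rightarrow> 'm"
    and x xi cap cup sp sm :: "'o \<Rightarrow> 'm"
  assumes t_nonzero: "t \<noteq> 0"
    and K_obj [simp]: "a \<in> Obj C \<Longrightarrow> K a \<in> Obj C"
    and Km_hom: "f \<in> Hom C a b \<Longrightarrow> Km f \<in> Hom C (K a) (K b)"
    and Km_ident: "a \<in> Obj C \<Longrightarrow> Km (Ident C a) = Ident C (K a)"
    and Km_cmp': "\<lbrakk>f \<in> Hom C a b; g \<in> Hom C b c\<rbrakk> \<Longrightarrow> Km (Cmp C g f) = Cmp C (Km g) (Km f)"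
    and Km_plus': "\<lbrakk>f \<in> Hom C a b; g \<in> Hom C a b\<rbrakk> \<Longrightarrow> Km (Plus C f g) = Plus C (Km f) (Km g)"
    and Km_smul': "f \<in> Hom C a b \<Longrightarrow> Km (Smul C s f) = Smul C s (Km f)"
    and x_hom: "a \<in> Obj C \<Longrightarrow> x a \<in> Hom C (K a) (K a)"
    and xi_hom: "a \<in> Obj C \<Longrightarrow> xi a \<in> Hom C (K a) (K a)"
    and cap_hom: "a \<in> Obj C \<Longrightarrow> cap a \<in> Hom C (K (K a)) a"
    and cup_hom: "a \<in> Obj C \<Longrightarrow> cup a \<in> Hom C a (K (K a))"
    and sp_hom: "a \<in> Obj C \<Longrightarrow> sp a \<in> Hom C (K (K a)) (K (K a))"
    and sm_hom: "a \<in> Obj C \<Longrightarrow> sm a \<in> Hom C (K (K a)) (K (K a))"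
    and x_nat': "f \<in> Hom C a b \<Longrightarrow> Cmp C (x b) (Km f) = Cmp C (Km f) (x a)"
    and xi_nat': "f \<in> Hom C a b \<Longrightarrow> Cmp C (xi b) (Km f) = Cmp C (Km f) (xi a)"
    and cap_nat': "f \<in> Hom C a b \<Longrightarrow> Cmp C (cap b) (Km (Km f)) = Cmp C f (cap a)"
    and cup_nat': "f \<in> Hom C a b \<Longrightarrow> Cmp C (cup b) f = Cmp C (Km (Km f)) (cup a)"
    and sp_nat': "f \<in> Hom C a b \<Longrightarrow> Cmp C (sp b) (Km (Km f)) = Cmp C (Km (Km f)) (sp a)"
    and cross_pm: "a \<in> Obj C \<Longrightarrow> Cmp C (sp a) (sm a) = Ident C (K (K a))"
    and cross_mp: "a \<in> Obj C \<Longrightarrow> Cmp C (sm a) (sp a) = Ident C (K (K a))"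
    and zigzag_left: "a \<in> Obj C \<Longrightarrow> Cmp C (Km (cap a)) (cup (K a)) = Ident C (K a)"
    and zigzag_right: "a \<in> Obj C \<Longrightarrow> Cmp C (cap (K a)) (Km (cup a)) = Ident C (K a)"
    and curl_minus: "a \<in> Obj C \<Longrightarrow> Cmp C (cap a) (sm a) = Smul C t (cap a)"
    and cap_cross: "a \<in> Obj C \<Longrightarrow>
      Cmp C (Km (cap a)) (sm (K a)) = Cmp C (cap (K a)) (Km (sp a))"
    and skein: "a \<in> Obj C \<Longrightarrow> Plus C (sp a) (Smul C (- 1) (sm a)) =
      Smul C z (Plus C (Ident C (K (K a))) (Smul C (- 1) (Cmp C (cup a) (cap a))))"
    and loop: "a \<in> Obj C \<Longrightarrow>
      Cmp C (cap a) (cup a) = Smul C ((t - inverse t) / z + 1) (Ident C a)"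
    and dot_cross: "a \<in> Obj C \<Longrightarrow> Cmp C (sm a) (x (K a)) = Cmp C (Km (x a)) (sp a)"
    and dot_cap: "a \<in> Obj C \<Longrightarrow> Cmp C (cap a) (x (K a)) = Cmp C (cap a) (Km (xi a))"
    and xi_x: "a \<in> Obj C \<Longrightarrow> Cmp C (xi a) (x a) = Ident C (K a)"
    and x_xi: "a \<in> Obj C \<Longrightarrow> Cmp C (x a) (xi a) = Ident C (K a)"
begin

lemma Km_typing [simp]:
  assumes "f \<in> Arr C"
  shows "Km f \<in> Arr C" "Src C (Km f) = K (Src C f)" "Tgt C (Km f) = K (Tgt C f)"
  using Km_hom[of f "Src C f" "Tgt C f"] assms by (auto simp: Hom_iff)

lemma generator_typing [simp]:
  assumes "a \<in> Obj C"
  shows "x a \<in> Arr C" "Src C (x a) = K a" "Tgt C (x a) = K a"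
    "xi a \<in> Arr C" "Src C (xi a) = K a" "Tgt C (xi a) = K a"
    "cap a \<in> Arr C" "Src C (cap a) = K (K a)" "Tgt C (cap a) = a"
    "cup a \<in> Arr C" "Src C (cup a) = a" "Tgt C (cup a) = K (K a)"
    "sp a \<in> Arr C" "Src C (sp a) = K (K a)" "Tgt C (sp a) = K (K a)"
    "sm a \<in> Arr C" "Src C (sm a) = K (K a)" "Tgt C (sm a) = K (K a)"
  using x_hom[OF assms] xi_hom[OF assms] cap_hom[OF assms] cup_hom[OF assms]
    sp_hom[OF assms] sm_hom[OF assms]
  by (simp_all add: Hom_iff)

lemma Km_cmp: "\<lbrakk>f \<in> Arr C; g \<in> Arr C; Tgt C f = Src C g\<rbrakk> \<Longrightarrow> Km (g \<cdot> f) = Km g \<cdot> Km f"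
  by (rule Km_cmp'[of f "Src C f" "Tgt C f" g "Tgt C g"]) (simp_all add: Hom_iff)

lemma Km_plus:
  "\<lbrakk>f \<in> Arr C; g \<in> Arr C; Src C f = Src C g; Tgt C f = Tgt C g\<rbrakk> \<Longrightarrow> Km (f \<oplus> g) = Km f \<oplus> Km g"
  by (rule Km_plus'[of f "Src C f" "Tgt C f" g]) (simp_all add: Hom_iff)

lemma Km_smul: "f \<in> Arr C \<Longrightarrow> Km (c \<odot> f) = c \<odot> Km f"
  by (rule Km_smul'[of f "Src C f" "Tgt C f"]) (simp_all add: Hom_iff)

lemma naturality:
  assumes "f \<in> Arr C" "Src C f = a" "Tgt C f = b"
  shows x_nat: "x b \<cdot> Km f = Km f \<cdot> x a"
    and xi_nat: "xi b \<cdot> Km f = Km f \<cdot> xi a"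
    and cap_nat: "cap b \<cdot> Km (Km f) = f \<cdot> cap a"
    and cup_nat: "cup b \<cdot> f = Km (Km f) \<cdot> cup a"
    and sp_nat: "sp b \<cdot> Km (Km f) = Km (Km f) \<cdot> sp a"
  using assms by (auto intro!: x_nat' xi_nat' cap_nat' cup_nat' sp_nat' simp: Hom_iff)

lemma sp_eq:
  assumes "a \<in> Obj C"
  shows "sp a = sm a \<oplus> (z \<odot> \<one> (K (K a)) \<oplus> (- z) \<odot> (cup a \<cdot> cap a))"
proof (rule eq_plus_of_minus)
  show "sp a \<oplus> (- 1) \<odot> sm a = z \<odot> \<one> (K (K a)) \<oplus> (- z) \<odot> (cup a \<cdot> cap a)"
    using assms by (simp add: skein smul_plus)
qed (use assms in simp_all)

lemma cap_sp: "a \<in> Obj C \<Longrightarrow> cap a \<cdot> sp a = inverse t \<odot> cap a"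
proof -
  assume a: "a \<in> Obj C"
  have "cap a = (cap a \<cdot> sm a) \<cdot> sp a"
    using a by (simp add: assoc cross_mp)
  also have "\<dots> = t \<odot> (cap a \<cdot> sp a)"
    using a by (simp add: curl_minus smul_cmp)
  finally have "inverse t \<odot> cap a = inverse t \<odot> t \<odot> (cap a \<cdot> sp a)"
    by simp
  then show ?thesis
    using a t_nonzero by (simp del: smul_1 add: smul_1[of "cap a \<cdot> sp a"])
qed

text \<open>By the skein relation, exchanging the signs of the crossings in \<open>cap_cross\<close> adds \<open>z\<close> times the
  same difference \<open>Km (cap a) - cap (K a)\<close> to both sides: the cup-cap term of each side contains a
  zigzag and straightens to the cap on the other side.\<close>

lemma cap_cross_opposite:
  assumes "a \<in> Obj C"
  shows "Km (cap a) \<cdot> sp (K a) = cap (K a) \<cdot> Km (sm a)"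
proof -
  let ?L = "Km (cap a)" and ?R = "cap (K a)"
  have hook_left: "?L \<cdot> cup (K a) \<cdot> cap (K a) = ?R"
    using assms zigzag_left[OF assms] by (simp add: assoc[symmetric])
  have hook_right: "?R \<cdot> Km (cup a) \<cdot> Km (cap a) = ?L"
    using assms zigzag_right[OF assms] by (simp add: assoc[symmetric])
  have left: "?L \<cdot> sp (K a) = ?L \<cdot> sm (K a) \<oplus> (z \<odot> ?L \<oplus> (- z) \<odot> ?R)"
    using assms by (simp add: sp_eq cmp_plus cmp_smul hook_left)
  have right: "?R \<cdot> Km (sp a) = ?R \<cdot> Km (sm a) \<oplus> (z \<odot> ?R \<oplus> (- z) \<odot> ?L)"
    using assms by (simp add: sp_eq Km_plus Km_smul Km_cmp Km_ident cmp_plus cmp_smul hook_right)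
  have cancel: "(z \<odot> ?R \<oplus> (- z) \<odot> ?L) \<oplus> (z \<odot> ?L \<oplus> (- z) \<odot> ?R) = 0 \<odot> ?R"
  proof -
    have "(z \<odot> ?R \<oplus> (- z) \<odot> ?L) \<oplus> (z \<odot> ?L \<oplus> (- z) \<odot> ?R)
        = z \<odot> ?R \<oplus> (((- z) \<odot> ?L \<oplus> z \<odot> ?L) \<oplus> (- z) \<odot> ?R)"
      using assms by (simp add: plus_assoc)
    also have "(- z) \<odot> ?L \<oplus> z \<odot> ?L = 0 \<odot> ?L"
      using assms add_smul[of ?L "- z" z] by simp
    also have "0 \<odot> ?L \<oplus> (- z) \<odot> ?R = (- z) \<odot> ?R"
      using assms by (simp add: smul_0 Zer_plus)
    also have "z \<odot> ?R \<oplus> (- z) \<odot> ?R = 0 \<odot> ?R"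
      using assms add_smul[of ?R z "- z"] by simp
    finally show ?thesis .
  qed
  have "?L \<cdot> sp (K a) = (?R \<cdot> Km (sm a) \<oplus> (z \<odot> ?R \<oplus> (- z) \<odot> ?L)) \<oplus> (z \<odot> ?L \<oplus> (- z) \<odot> ?R)"
    using left right cap_cross[OF assms] by simp
  also have "\<dots> = ?R \<cdot> Km (sm a) \<oplus> 0 \<odot> ?R"
    using assms cancel by (simp add: plus_assoc)
  also have "\<dots> = ?R \<cdot> Km (sm a)"
    using assms by (simp add: smul_0 plus_Zer)
  finally show ?thesis .
qed

text \<open>\<open>cap_cross_opposite\<close> carries the positive crossing to the other side of the cap and changes its
  sign; what is left of the cup and the cap is a zigzag.\<close>

lemma sm_rotated:
  assumes "a \<in> Obj C"
  shows "sm a = Km (Km (cap a)) \<cdot> Km (sp (K a)) \<cdot> cup (K (K a))"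
proof -
  have "Km (Km (cap a)) \<cdot> Km (sp (K a)) = Km (Km (cap a) \<cdot> sp (K a))"
    using assms by (simp add: Km_cmp)
  also have "\<dots> = Km (cap (K a)) \<cdot> Km (Km (sm a))"
    using assms by (simp add: cap_cross_opposite Km_cmp)
  finally have "(Km (Km (cap a)) \<cdot> Km (sp (K a))) \<cdot> cup (K (K a))
      = Km (cap (K a)) \<cdot> Km (Km (sm a)) \<cdot> cup (K (K a))"
    using assms by (simp add: assoc)
  also have "Km (Km (sm a)) \<cdot> cup (K (K a)) = cup (K (K a)) \<cdot> sm a"
    using assms by (simp add: cup_nat)
  also have "Km (cap (K a)) \<cdot> cup (K (K a)) \<cdot> sm a = (Km (cap (K a)) \<cdot> cup (K (K a))) \<cdot> sm a"
    using assms by (simp add: assoc)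
  also have "\<dots> = sm a"
    using assms by (simp add: zigzag_left)
  finally show ?thesis
    using assms by (simp add: assoc)
qed

text \<open>A quarter turn of the crossing turns the curl into a zigzag whose cap sits directly on a positive
  crossing, and there the crossing is the scalar \<open>inverse t\<close>.\<close>

lemma curl_undotted:
  assumes "a \<in> Obj C"
  shows "Km (cap a) \<cdot> sm (K a) \<cdot> Km (cup a) = inverse t \<odot> \<one> (K a)"
proof -
  have slide: "Km (Km (cap (K a))) \<cdot> Km (sp (K (K a))) \<cdot> cup (K (K (K a))) \<cdot> Km (cup a)
      = Km (sp a) \<cdot> cup (K a)"
  proof -
    have "Km (Km (cap (K a))) \<cdot> Km (sp (K (K a))) \<cdot> cup (K (K (K a))) \<cdot> Km (cup a)
        = Km (Km (cap (K a))) \<cdot> Km (sp (K (K a))) \<cdot> Km (Km (Km (cup a))) \<cdot> cup (K a)"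
      using assms cup_nat[of "Km (cup a)" "K a" "K (K (K a))"] by simp
    also have "\<dots> = Km (Km (cap (K a)) \<cdot> sp (K (K a)) \<cdot> Km (Km (cup a))) \<cdot> cup (K a)"
      using assms by (simp add: Km_cmp assoc)
    also have "Km (cap (K a)) \<cdot> sp (K (K a)) \<cdot> Km (Km (cup a))
        = Km (cap (K a) \<cdot> Km (cup a)) \<cdot> sp a"
      using assms sp_nat[of "cup a" a "K (K a)"] by (simp add: Km_cmp assoc)
    finally show ?thesis
      using assms by (simp add: zigzag_right Km_ident)
  qed
  have "Km (cap a) \<cdot> sm (K a) \<cdot> Km (cup a)
      = Km (cap a) \<cdot> Km (Km (cap (K a))) \<cdot> Km (sp (K (K a))) \<cdot> cup (K (K (K a))) \<cdot> Km (cup a)"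
    using assms by (simp add: sm_rotated[of "K a"] assoc)
  also have "\<dots> = Km (cap a \<cdot> sp a) \<cdot> cup (K a)"
    using assms by (simp add: slide Km_cmp assoc)
  also have "\<dots> = inverse t \<odot> \<one> (K a)"
    using assms by (simp add: cap_sp Km_smul smul_cmp zigzag_left)
  finally show ?thesis .
qed

text \<open>A morphism \<open>g\<close> into \<open>K (K a)\<close> is recovered from \<open>cap (K a) \<cdot> Km g\<close> by bending the strand
  back, and the cap version of the relation is an axiom.\<close>

lemma dot_cup:
  assumes "a \<in> Obj C"
  shows "Km (x a) \<cdot> cup a = xi (K a) \<cdot> cup a"
proof -
  let ?g = "xi (K a) \<cdot> cup a"
  have "cap (K a) \<cdot> Km ?g = cap (K a) \<cdot> Km (xi (K a)) \<cdot> Km (cup a)"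
    using assms by (simp add: Km_cmp)
  also have "\<dots> = (cap (K a) \<cdot> x (K (K a))) \<cdot> Km (cup a)"
    using assms by (simp add: dot_cap assoc)
  also have "\<dots> = (cap (K a) \<cdot> Km (cup a)) \<cdot> x a"
    using assms x_nat[of "cup a" a "K (K a)"] by (simp add: assoc)
  also have "\<dots> = x a"
    using assms by (simp add: zigzag_right)
  finally have "Km (x a) \<cdot> cup a = Km (cap (K a) \<cdot> Km ?g) \<cdot> cup a"
    by simp
  also have "\<dots> = Km (cap (K a)) \<cdot> Km (Km ?g) \<cdot> cup a"
    using assms by (simp add: Km_cmp assoc)
  also have "Km (Km ?g) \<cdot> cup a = cup (K (K a)) \<cdot> ?g"
    using assms by (intro cup_nat[symmetric]) simp_all
  also have "Km (cap (K a)) \<cdot> cup (K (K a)) \<cdot> ?g = (Km (cap (K a)) \<cdot> cup (K (K a))) \<cdot> ?g"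
    using assms by (simp add: assoc)
  finally show ?thesis
    using assms by (simp add: zigzag_left)
qed

lemma dot_inv_cross:
  assumes "a \<in> Obj C"
  shows "sm a \<cdot> Km (xi a) = xi (K a) \<cdot> sp a"
proof -
  have 1: "x (K a) \<cdot> sm a = sp a \<cdot> Km (x a)"
  proof -
    have "x (K a) \<cdot> sm a = (sp a \<cdot> sm a) \<cdot> x (K a) \<cdot> sm a"
      using assms by (simp add: cross_pm)
    also have "\<dots> = sp a \<cdot> (sm a \<cdot> x (K a)) \<cdot> sm a"
      using assms by (simp add: assoc)
    also have "\<dots> = sp a \<cdot> Km (x a) \<cdot> sp a \<cdot> sm a"
      using assms by (simp add: assoc dot_cross)
    finally show ?thesis
      using assms by (simp add: cross_pm)
  qed
  have "sm a \<cdot> Km (xi a) = (xi (K a) \<cdot> x (K a)) \<cdot> sm a \<cdot> Km (xi a)"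
    using assms by (simp add: xi_x)
  also have "\<dots> = xi (K a) \<cdot> (x (K a) \<cdot> sm a) \<cdot> Km (xi a)"
    using assms by (simp add: assoc)
  also have "\<dots> = xi (K a) \<cdot> sp a \<cdot> Km (x a \<cdot> xi a)"
    using assms by (simp add: 1 assoc Km_cmp)
  finally show ?thesis
    using assms by (simp add: x_xi Km_ident)
qed

text \<open>A right curl on one strand with the endomorphism \<open>f\<close> on its far side, next to the object.\<close>

definition curl :: "'o \<Rightarrow> 'm \<Rightarrow> 'm" where
  "curl a f = Km (cap a) \<cdot> sm (K a) \<cdot> Km (Km f \<cdot> cup a)"

definition bubble :: "'o \<Rightarrow> 'm \<Rightarrow> 'm" where
  "bubble a f = cap a \<cdot> Km f \<cdot> cup a"

text \<open>Moving the dot over the cup and through the crossing changes the sign of the crossing; the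
  skein relation changes it back at the cost of a bubble and of a straight strand.\<close>

lemma curl_dot:
  assumes a: "a \<in> Obj C" and f: "f \<in> Arr C" "Src C f = K a" "Tgt C f = K a"
  shows "x a \<cdot> curl a (f \<cdot> x a) = curl a f \<oplus> (z \<odot> Km (bubble a f) \<oplus> (- z) \<odot> f)"
proof -
  let ?g = "Km (Km f \<cdot> cup a)"
  note [simp] = a f
  have "Km (f \<cdot> x a) \<cdot> cup a = Km f \<cdot> xi (K a) \<cdot> cup a"
    by (simp add: Km_cmp assoc dot_cup)
  also have "\<dots> = xi (K a) \<cdot> Km f \<cdot> cup a"
    using xi_nat[of f "K a" "K a"] by (simp add: assoc[symmetric])
  finally have "curl a (f \<cdot> x a) = Km (cap a) \<cdot> (sm (K a) \<cdot> Km (xi (K a))) \<cdot> ?g"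
    by (simp add: curl_def Km_cmp assoc)
  also have "\<dots> = (Km (cap a) \<cdot> xi (K (K a))) \<cdot> sp (K a) \<cdot> ?g"
    by (simp add: dot_inv_cross assoc)
  also have "Km (cap a) \<cdot> xi (K (K a)) = xi a \<cdot> Km (cap a)"
    by (simp add: xi_nat)
  finally have "x a \<cdot> curl a (f \<cdot> x a) = (x a \<cdot> xi a) \<cdot> Km (cap a) \<cdot> sp (K a) \<cdot> ?g"
    by (simp add: assoc)
  also have "\<dots> = Km (cap a) \<cdot> sp (K a) \<cdot> ?g"
    by (simp add: x_xi)
  also have "\<dots> = curl a f \<oplus> (z \<odot> (Km (cap a) \<cdot> ?g)
      \<oplus> (- z) \<odot> (Km (cap a) \<cdot> (cup (K a) \<cdot> cap (K a)) \<cdot> ?g))"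
    by (simp add: sp_eq plus_cmp cmp_plus smul_cmp cmp_smul curl_def)
  also have "Km (cap a) \<cdot> ?g = Km (bubble a f)"
    by (simp add: bubble_def Km_cmp)
  also have "Km (cap a) \<cdot> (cup (K a) \<cdot> cap (K a)) \<cdot> ?g
      = (Km (cap a) \<cdot> cup (K a)) \<cdot> (cap (K a) \<cdot> Km (Km f)) \<cdot> Km (cup a)"
    by (simp add: Km_cmp assoc)
  also have "\<dots> = f \<cdot> cap (K a) \<cdot> Km (cup a)"
    by (simp add: zigzag_left cap_nat assoc)
  also have "\<dots> = f"
    by (simp add: zigzag_right)
  finally show ?thesis .
qed

end


section \<open>Laurent polynomials\<close>

lemma poly_add_induct [case_names zero monom add]:
  fixes p :: "'a::comm_monoid_add poly"
  assumes "P 0" "\<And>n c. P (monom c n)" "\<And>p q. P p \<Longrightarrow> P q \<Longrightarrow> P (p + q)"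
  shows "P p"
proof -
  have "P (\<Sum>i\<in>A. monom (coeff p i) i)" if "finite A" for A
    using that by (induction A rule: finite_induct) (auto simp: assms)
  then show ?thesis
    by (metis poly_as_sum_of_monoms finite_atMost)
qed

lemma lookup_laurent_of_poly:
  "Poly_Mapping.lookup (laurent_of_poly p) n = (if n \<ge> 0 then coeff p (nat n) else 0)"
proof -
  have "Poly_Mapping.lookup (laurent_of_poly p) n
      = (\<Sum>i\<le>degree p. if i = nat n \<and> n \<ge> 0 then coeff p (nat n) else 0)"
    unfolding laurent_of_poly_def lookup_sum
    by (rule sum.cong) (auto simp: lookup_single when_def)
  also have "\<dots> = (if n \<ge> 0 then coeff p (nat n) else 0)"
    by (cases "n \<ge> 0") (auto simp: coeff_eq_0)
  finally show ?thesis .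
qed

lemma laurent_of_poly_add: "laurent_of_poly (p + q) = laurent_of_poly p + laurent_of_poly q"
  by (rule poly_mapping_eqI) (simp add: lookup_laurent_of_poly lookup_add)

lemma laurent_of_poly_0 [simp]: "laurent_of_poly 0 = 0"
  by (rule poly_mapping_eqI) (simp add: lookup_laurent_of_poly)

lemma laurent_of_poly_monom: "laurent_of_poly (monom c n) = Poly_Mapping.single (int n) c"
  by (rule poly_mapping_eqI) (auto simp: lookup_laurent_of_poly lookup_single when_def)

lemma laurent_of_poly_mult: "laurent_of_poly (p * q) = laurent_of_poly p * laurent_of_poly q"
proof (induction p rule: poly_add_induct)
  case (monom n c)
  show ?case
    by (induction q rule: poly_add_induct)
       (simp_all add: laurent_of_poly_monom mult_monom mult_single laurent_of_poly_add algebra_simps)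
qed (simp_all add: laurent_of_poly_add algebra_simps)

lemma laurent_of_poly_inject: "laurent_of_poly p = laurent_of_poly q \<Longrightarrow> p = q"
proof (rule poly_eqI)
  fix n assume "laurent_of_poly p = laurent_of_poly q"
  then show "coeff p n = coeff q n"
    using lookup_laurent_of_poly[of p "int n"] lookup_laurent_of_poly[of q "int n"] by simp
qed

lemma laurent_clear_denominator:
  "\<exists>N q. Poly_Mapping.single (int N) 1 * g = laurent_of_poly (q :: 'a::field poly)"
proof (induction g rule: laurent_induct)
  case zero
  then show ?case by (intro exI[of _ 0]) simp
next
  case (single n c)
  show ?case
    by (intro exI[of _ "nat (- n)"] exI[of _ "monom c (nat (n + nat (- n)))"])
       (simp add: laurent_of_poly_monom mult_single add.commute)
next
  case (add f g)
  then obtain N p M q where "Poly_Mapping.single (int N) 1 * f = laurent_of_poly p"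
    "Poly_Mapping.single (int M) 1 * g = laurent_of_poly q"
    by blast
  then have "Poly_Mapping.single (int (N + M)) 1 * (f + g)
      = laurent_of_poly (monom 1 M * p + monom 1 N * q)"
    by (simp add: laurent_of_poly_add laurent_of_poly_mult laurent_of_poly_monom distrib_left
        mult.assoc[symmetric] mult_single add.commute flip: \<open>_ = laurent_of_poly p\<close> \<open>_ = laurent_of_poly q\<close>)
  then show ?case by blast
qed

lemma dvd_monom_cancel:
  fixes m p :: "'a::field poly"
  assumes "poly m 0 \<noteq> 0" "m dvd monom 1 N * p"
  shows "m dvd p"
  using assms(2)
proof (induction N)
  case (Suc N)
  then obtain q where q: "monom 1 (Suc N) * p = m * q" by (auto simp: dvd_def)
  then have "poly (m * q) 0 = 0"
    by (metis mult_eq_0_iff poly_monom poly_mult power_0_Suc)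
  then have "[:0, 1:] dvd q"
    using assms(1) by (simp add: dvd_iff_poly_eq_0)
  then obtain r where "q = [:0, 1:] * r" by (auto simp: dvd_def)
  then have "[:0, 1:] * (monom 1 N * p) = [:0, 1:] * (m * r)"
    using q by (simp add: monom_Suc)
  then have "monom 1 N * p = m * r"
    by (subst (asm) mult_cancel_left) simp
  then show ?case using Suc by simp
qed (simp add: one_pCons[symmetric] monom_0)

text \<open>Multiplication by a power of \<open>u\<close> clears the negative exponents of \<open>g\<close>, and that power can be
  cancelled again because \<open>u\<close> does not divide \<open>m\<close>.\<close>

lemma laurent_multiple_imp_dvd:
  fixes m p :: "'a::field poly"
  assumes "laurent_of_poly p = g * laurent_of_poly m" "poly m 0 \<noteq> 0"
  shows "m dvd p"
proof -
  obtain N q where q: "Poly_Mapping.single (int N) 1 * g = laurent_of_poly q"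
    using laurent_clear_denominator by blast
  have "laurent_of_poly (monom 1 N * p) = laurent_of_poly (q * m)"
    by (simp add: laurent_of_poly_mult laurent_of_poly_monom assms(1) mult.assoc[symmetric] flip: q)
  then have "monom 1 N * p = q * m"
    by (rule laurent_of_poly_inject)
  then show ?thesis
    using assms(2) dvd_monom_cancel[of m N p] by simp
qed


section \<open>Evaluation of Laurent polynomials at the dot\<close>

context kauffman_action
begin

definition dpow :: "int \<Rightarrow> 'o \<Rightarrow> 'm" where
  "dpow n a = (if n \<ge> 0 then (cmp (x a) ^^ nat n) (\<one> (K a)) else (cmp (xi a) ^^ nat (- n)) (\<one> (K a)))"

lemma dpow_typing [simp]:
  assumes "a \<in> Obj C"
  shows "dpow n a \<in> Arr C" "Src C (dpow n a) = K a" "Tgt C (dpow n a) = K a"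
proof -
  have "(cmp (x a) ^^ k) (\<one> (K a)) \<in> Hom C (K a) (K a)"
    "(cmp (xi a) ^^ k) (\<one> (K a)) \<in> Hom C (K a) (K a)" for k
    using assms by (induction k) (auto simp: Hom_iff)
  then show "dpow n a \<in> Arr C" "Src C (dpow n a) = K a" "Tgt C (dpow n a) = K a"
    by (auto simp: dpow_def Hom_iff)
qed

lemma dpow_0 [simp]: "dpow 0 a = \<one> (K a)"
  by (simp add: dpow_def)

lemma x_dpow:
  assumes "a \<in> Obj C"
  shows "x a \<cdot> dpow n a = dpow (n + 1) a"
proof (cases "n \<ge> 0")
  case True
  then show ?thesis
    by (simp add: dpow_def nat_add_distrib)
next
  case False
  define k where "k = nat (- n - 1)"
  have k: "n = - int (Suc k)"
    using False by (simp add: k_def)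
  have h: "(cmp (xi a) ^^ k) (\<one> (K a)) = dpow (- int k) a"
    by (cases k) (auto simp: dpow_def nat_add_distrib)
  have "dpow n a = xi a \<cdot> dpow (- int k) a"
    by (simp add: k dpow_def nat_add_distrib flip: h)
  then have "x a \<cdot> dpow n a = (x a \<cdot> xi a) \<cdot> dpow (- int k) a"
    using assms by (simp add: assoc)
  then show ?thesis
    using assms k by (simp add: x_xi)
qed

lemma xi_dpow:
  assumes "a \<in> Obj C"
  shows "xi a \<cdot> dpow n a = dpow (n - 1) a"
proof -
  have "xi a \<cdot> dpow n a = xi a \<cdot> x a \<cdot> dpow (n - 1) a"
    using assms by (simp add: x_dpow)
  also have "\<dots> = dpow (n - 1) a"
    using assms by (simp add: xi_x assoc[symmetric])
  finally show ?thesis .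
qed

lemma dpow_add:
  assumes "a \<in> Obj C"
  shows "dpow k a \<cdot> dpow n a = dpow (k + n) a"
proof (induction k rule: int_induct[where k = 0])
  case base
  show ?case using assms by simp
next
  case (step1 k)
  have "dpow (k + 1) a \<cdot> dpow n a = x a \<cdot> dpow k a \<cdot> dpow n a"
    using assms by (simp add: x_dpow[symmetric] assoc)
  then show ?case
    using assms step1 by (simp add: x_dpow algebra_simps)
next
  case (step2 k)
  have "dpow (k - 1) a \<cdot> dpow n a = xi a \<cdot> dpow k a \<cdot> dpow n a"
    using assms by (simp add: xi_dpow[symmetric] assoc)
  then show ?case
    using assms step2 by (simp add: xi_dpow algebra_simps)
qed

lemma dpow_x:
  assumes "a \<in> Obj C"
  shows "dpow n a \<cdot> x a = dpow (n + 1) a"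
  using dpow_add[OF assms, of n 1] x_dpow[OF assms, of 0] assms by simp

text \<open>The dots pass over the cap one at a time, and each of them is inverted on the way.\<close>

lemma bubble_left:
  assumes a: "a \<in> Obj C"
  shows "cap a \<cdot> dpow (int n) (K a) \<cdot> cup a = bubble a (dpow (- int n) a)"
proof -
  note [simp] = a
  have slide: "cap a \<cdot> dpow (int n) (K a) \<cdot> g = cap a \<cdot> Km (dpow (- int n) a) \<cdot> g"
    if "g \<in> Arr C" "Tgt C g = K (K a)" for g
    using that
  proof (induction n arbitrary: g)
    case 0
    then show ?case by (simp add: Km_ident)
  next
    case (Suc n)
    have nat: "x (K a) \<cdot> Km (dpow (- int n) a) = Km (dpow (- int n) a) \<cdot> x (K a)"
      by (rule x_nat) simp_all
    have xpow: "dpow (int (Suc n)) (K a) = dpow (int n) (K a) \<cdot> x (K a)"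
      by (simp add: dpow_x add.commute)
    have "cap a \<cdot> dpow (int (Suc n)) (K a) \<cdot> g = cap a \<cdot> dpow (int n) (K a) \<cdot> x (K a) \<cdot> g"
      unfolding xpow using Suc.prems by (simp add: assoc)
    also have "\<dots> = cap a \<cdot> (Km (dpow (- int n) a) \<cdot> x (K a)) \<cdot> g"
      using Suc by (simp add: assoc)
    also have "\<dots> = (cap a \<cdot> x (K a)) \<cdot> Km (dpow (- int n) a) \<cdot> g"
      using Suc.prems by (simp add: assoc flip: nat)
    also have "\<dots> = cap a \<cdot> Km (xi a \<cdot> dpow (- int n) a) \<cdot> g"
      using Suc.prems by (simp add: dot_cap Km_cmp assoc)
    also have "xi a \<cdot> dpow (- int n) a = dpow (- int (Suc n)) a"
      by (simp add: xi_dpow minus_diff_commute)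
    finally show ?case .
  qed
  show ?thesis
    using slide[of "cup a"] by (simp add: bubble_def)
qed

definition ev :: "'o \<Rightarrow> (int \<Rightarrow>\<^sub>0 'k) \<Rightarrow> 'm" where
  "ev a f = vspace_on.comb (Plus C) (Zer C (K a) (K a)) (Smul C) (\<lambda>n. dpow n a) f"

context
  fixes a assumes a: "a \<in> Obj C"
begin

lemma vspace_K: "vspace_on (Hom C (K a) (K a)) (Plus C) (Zer C (K a) (K a)) (Smul C)"
  using a by (intro hom_vspace) auto

lemma range_dpow: "range (\<lambda>n. dpow n a) \<subseteq> Hom C (K a) (K a)"
  using a by (auto simp: Hom_iff)

lemma ev_typing [simp]: "ev a f \<in> Arr C" "Src C (ev a f) = K a" "Tgt C (ev a f) = K a"
  using vspace_on.comb_closed[OF vspace_K range_dpow, of f] by (auto simp: ev_def Hom_iff)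

lemma ev_add: "ev a (f + g) = ev a f \<oplus> ev a g"
  by (simp add: ev_def vspace_on.comb_add[OF vspace_K range_dpow])

lemma ev_single: "ev a (Poly_Mapping.single n c) = c \<odot> dpow n a"
  by (simp add: ev_def vspace_on.comb_single[OF vspace_K range_dpow])

lemma ev_0: "ev a 0 = Zer C (K a) (K a)"
  by (simp add: ev_def vspace_on.comb_0[OF vspace_K])

lemma dpow_ev: "dpow k a \<cdot> ev a f = ev a (Poly_Mapping.single k 1 * f)"
  by (induction f rule: laurent_induct)
     (use a in \<open>simp_all add: ev_0 cmp_Zer ev_single mult_single cmp_smul dpow_add
        cmp_plus ev_add distrib_left\<close>)

lemma ev_scale: "c \<odot> ev a f = ev a (Poly_Mapping.single 0 c * f)"
  by (induction f rule: laurent_induct)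
     (use a in \<open>simp_all add: ev_0 ev_single mult_single smul_plus ev_add distrib_left\<close>)

lemma bubble_plus:
  assumes "f \<in> Hom C (K a) (K a)" "g \<in> Hom C (K a) (K a)"
  shows "bubble a (f \<oplus> g) = bubble a f \<oplus> bubble a g"
  using assms a by (simp add: bubble_def Hom_iff Km_plus plus_cmp cmp_plus)

lemma bubble_smul: "f \<in> Hom C (K a) (K a) \<Longrightarrow> bubble a (c \<odot> f) = c \<odot> bubble a f"
  using a by (simp add: bubble_def Hom_iff Km_smul smul_cmp cmp_smul)

lemma bubble_typing [simp]:
  assumes "f \<in> Arr C" "Src C f = K a" "Tgt C f = K a"
  shows "bubble a f \<in> Arr C" "Src C (bubble a f) = a" "Tgt C (bubble a f) = a"
  using a assms by (simp_all add: bubble_def)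

lemma curl_typing [simp]:
  assumes "f \<in> Arr C" "Src C f = K a" "Tgt C f = K a"
  shows "curl a f \<in> Arr C" "Src C (curl a f) = K a" "Tgt C (curl a f) = K a"
  using a assms by (simp_all add: curl_def)

lemma curl_plus:
  assumes "f \<in> Hom C (K a) (K a)" "g \<in> Hom C (K a) (K a)"
  shows "curl a (f \<oplus> g) = curl a f \<oplus> curl a g"
  using assms a by (simp add: curl_def Hom_iff Km_plus plus_cmp cmp_plus)

lemma curl_smul: "f \<in> Hom C (K a) (K a) \<Longrightarrow> curl a (c \<odot> f) = c \<odot> curl a f"
  using a by (simp add: curl_def Hom_iff Km_smul smul_cmp cmp_smul)

end

end


section \<open>Bubbles on a brick\<close>

text \<open>The polynomial in the dot by which a curl with \<open>n\<close> dots on its far side acts on a brick with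
  bubble values \<open>b\<close>, after multiplication by \<open>n\<close> dots to clear denominators.\<close>

definition curl_poly :: "'k::field \<Rightarrow> 'k \<Rightarrow> (int \<Rightarrow> 'k) \<Rightarrow> nat \<Rightarrow> 'k poly" where
  "curl_poly z t b n = [:inverse t:] + (\<Sum>k<n. monom (z * b (int k)) k - monom z (2 * k))"

locale kauffman_brick = kauffman_action C z t K Km x xi cap cup sp sm
  for C :: "('o, 'm, 'k::field, 'x) lincat_scheme" and z t K Km x xi cap cup sp sm +
  fixes L :: 'o and m :: "'k poly"
  assumes brick: "brick C L"
    and m_nonzero_at_0: "poly m 0 \<noteq> 0"
    and annihilator: "ev L f = Zer C (K L) (K L) \<longleftrightarrow> (\<exists>g. f = g * laurent_of_poly m)"
begin

lemma L_obj [simp]: "L \<in> Obj C"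
  using brick by (simp add: brick_def)

lemma smul_ident_inject: "c \<odot> \<one> L = d \<odot> \<one> L \<Longrightarrow> c = d"
  using brick by (auto simp: brick_def bij_betw_def inj_on_def)

lemma brick_scalar_unique: "brick_scalar C L (c \<odot> \<one> L) = c"
  by (auto simp: brick_scalar_def intro!: the_equality dest: smul_ident_inject)

lemma brick_scalar_eq:
  assumes "f \<in> Hom C L L"
  shows "f = brick_scalar C L f \<odot> \<one> L"
proof -
  obtain c where "f = c \<odot> \<one> L"
    using brick assms by (auto simp: brick_def bij_betw_def)
  then show ?thesis
    by (simp add: brick_scalar_unique)
qed

definition bubble_val :: "(int \<Rightarrow>\<^sub>0 'k) \<Rightarrow> 'k" where
  "bubble_val f = brick_scalar C L (bubble L (ev L f))"

definition b :: "int \<Rightarrow> 'k" where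
  "b n = bubble_val (Poly_Mapping.single n 1)"

lemma bubble_ev: "bubble L (ev L f) = bubble_val f \<odot> \<one> L"
  unfolding bubble_val_def by (rule brick_scalar_eq) (simp add: Hom_iff)

lemma bubble_dpow: "bubble L (dpow n L) = b n \<odot> \<one> L"
  using bubble_ev[of "Poly_Mapping.single n 1"] by (simp add: ev_single b_def)

lemma bubble_val_add: "bubble_val (f + g) = bubble_val f + bubble_val g"
proof (rule smul_ident_inject)
  show "bubble_val (f + g) \<odot> \<one> L = (bubble_val f + bubble_val g) \<odot> \<one> L"
    by (simp add: bubble_ev[symmetric] ev_add bubble_plus Hom_iff)
       (simp add: add_smul bubble_ev)
qed

lemma bubble_val_single: "bubble_val (Poly_Mapping.single n c) = c * b n"
proof (rule smul_ident_inject)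
  show "bubble_val (Poly_Mapping.single n c) \<odot> \<one> L = (c * b n) \<odot> \<one> L"
    by (simp add: bubble_ev[symmetric] ev_single bubble_smul Hom_iff bubble_dpow)
qed

lemma bubble_val_0: "bubble_val 0 = 0"
  using bubble_val_single[of 0 0] by simp

lemma bubble_val_sum: "bubble_val (\<Sum>i\<in>A. F i) = (\<Sum>i\<in>A. bubble_val (F i))"
  by (induction A rule: infinite_finite_induct) (simp_all add: bubble_val_0 bubble_val_add)

lemma b_0: "b 0 = (t - inverse t) / z + 1"
proof (rule smul_ident_inject)
  show "b 0 \<odot> \<one> L = ((t - inverse t) / z + 1) \<odot> \<one> L"
    using bubble_dpow[of 0] loop[of L] by (simp add: bubble_def Km_ident)
qed

text \<open>A bubble carrying \<open>u\<^sup>k m(u)\<close> is zero.\<close>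

lemma bubble_recurrence: "(\<Sum>i\<le>degree m. coeff m i * b (int i + k)) = 0"
proof -
  let ?f = "Poly_Mapping.single k 1 * laurent_of_poly m"
  have "bubble_val ?f \<odot> \<one> L = bubble L (0 \<odot> ev L ?f)"
    using annihilator[of ?f] by (auto simp: bubble_ev[symmetric])
  also have "\<dots> = 0 \<odot> \<one> L"
    using bubble_smul[of L "ev L ?f" 0] by (simp add: Hom_iff bubble_ev)
  finally have "bubble_val ?f = 0"
    by (rule smul_ident_inject)
  moreover have "?f = (\<Sum>i\<le>degree m. Poly_Mapping.single (int i + k) (coeff m i))"
    by (simp add: laurent_of_poly_def sum_distrib_left mult_single add.commute)
  ultimately show ?thesis
    by (simp add: bubble_val_sum bubble_val_single)
qed

abbreviation D where "D \<equiv> curl_poly z t b"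

lemma curl_Zer: "curl L (Zer C (K L) (K L)) = Zer C (K L) (K L)"
  using curl_smul[of L "\<one> (K L)" 0] by (simp add: smul_0 Hom_iff)

text \<open>Induction with \<open>curl_dot\<close>: the dot that leaves the curl cancels against one of the extra
  dots and costs one bubble and one strand with \<open>2 n\<close> dots.\<close>

lemma curl_dpow: "dpow (int n) L \<cdot> curl L (dpow (int n) L) = ev L (laurent_of_poly (D n))"
proof (induction n)
  case 0
  have "curl L (\<one> (K L)) = inverse t \<odot> \<one> (K L)"
    using curl_undotted[of L] by (simp add: curl_def Km_ident)
  then show ?case
    using laurent_of_poly_monom[of "inverse t" 0] by (simp add: curl_poly_def ev_single monom_0)
next
  case (Suc n)
  let ?X = "dpow (int n) L"
  have "dpow (int (Suc n)) L \<cdot> curl L (dpow (int (Suc n)) L) = ?X \<cdot> x L \<cdot> curl L (?X \<cdot> x L)"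
  proof -
    have "dpow (int (Suc n)) L = ?X \<cdot> x L"
      by (simp add: dpow_x add.commute)
    then show ?thesis
      by (simp add: assoc)
  qed
  also have "\<dots> = ?X \<cdot> (curl L ?X \<oplus> (z \<odot> Km (bubble L ?X) \<oplus> (- z) \<odot> ?X))"
    by (simp add: curl_dot)
  also have "\<dots> = ?X \<cdot> curl L ?X \<oplus> ((z * b (int n)) \<odot> ?X \<oplus> (- z) \<odot> dpow (int n + int n) L)"
    by (simp add: cmp_plus cmp_smul dpow_add bubble_dpow Km_smul Km_ident)
  also have "\<dots> = ev L (laurent_of_poly (D n + monom (z * b (int n)) n + monom (- z) (n + n)))"
    by (simp add: Suc laurent_of_poly_add laurent_of_poly_monom ev_add ev_single plus_assoc)
  also have "D n + monom (z * b (int n)) n + monom (- z) (n + n) = D (Suc n)"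
    by (simp add: curl_poly_def minus_monom[symmetric] mult_2)
  finally show ?case .
qed

text \<open>The extra \<open>N\<close> dots are a common denominator for the curls with up to \<open>N\<close> dots.\<close>

lemma curl_partial_sum:
  assumes "n \<le> Suc N"
  shows "dpow (int N) L \<cdot> curl L (ev L (laurent_of_poly (\<Sum>i<n. monom (coeff m i) i)))
    = ev L (laurent_of_poly (\<Sum>i<n. monom (coeff m i) (N - i) * D i))"
  using assms
proof (induction n)
  case 0
  show ?case by (simp add: ev_0 curl_Zer cmp_Zer)
next
  case (Suc n)
  let ?X = "dpow (int n) L" and ?Y = "dpow (int (N - n)) L" and ?c = "coeff m n"
  have "dpow (int N) L \<cdot> curl L (?c \<odot> ?X) = ?c \<odot> (dpow (int N) L \<cdot> curl L ?X)"
    by (simp add: curl_smul Hom_iff cmp_smul)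
  also have "dpow (int N) L \<cdot> curl L ?X = (?Y \<cdot> ?X) \<cdot> curl L ?X"
    using Suc.prems by (simp add: dpow_add of_nat_diff)
  also have "\<dots> = ?Y \<cdot> ev L (laurent_of_poly (D n))"
    by (simp add: assoc curl_dpow)
  also have "?c \<odot> \<dots> = ev L (laurent_of_poly (monom ?c (N - n) * D n))"
    by (simp add: dpow_ev ev_scale laurent_of_poly_mult laurent_of_poly_monom mult.assoc[symmetric]
        mult_single)
  finally show ?case
    using Suc by (simp add: laurent_of_poly_add laurent_of_poly_monom ev_add ev_single curl_plus
        Hom_iff cmp_plus)
qed

text \<open>A curl whose far side carries \<open>m\<close> vanishes.  Expanding it instead by removing the dots from the
  curl produces another polynomial that annihilates the dot.\<close>

theorem min_poly_dvd_curl_poly: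
  "m dvd (\<Sum>i\<le>degree m. monom (coeff m i) (degree m - i) * D i)" (is "m dvd ?G")
proof -
  have m: "ev L (laurent_of_poly m) = Zer C (K L) (K L)"
    using annihilator[of "laurent_of_poly m"] by (metis mult_1)
  have "ev L (laurent_of_poly ?G) = Zer C (K L) (K L)"
    using curl_partial_sum[of "Suc (degree m)" "degree m"]
    by (simp add: lessThan_Suc_atMost poly_as_sum_of_monoms m curl_Zer cmp_Zer)
  then obtain g where "laurent_of_poly ?G = g * laurent_of_poly m"
    using annihilator by blast
  then show ?thesis
    using laurent_multiple_imp_dvd m_nonzero_at_0 by blast
qed

end


section \<open>Bubble values of a brick\<close>

lemma coeff_mult_top:
  fixes p q :: "'a::comm_semiring_0 poly"
  assumes "degree p \<le> n"
  shows "coeff (p * q) (n + degree q) = coeff p n * lead_coeff q"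
proof (cases "degree p = n")
  case True
  then show ?thesis using coeff_mult_degree_sum[of p q] by simp
next
  case False
  then have "degree (p * q) < n + degree q"
    using degree_mult_le[of p q] assms by linarith
  then show ?thesis
    using False assms by (simp add: coeff_eq_0)
qed

lemma power2_minus_1_dvd:
  "([:- 1, 0, 1:] :: 'a::field poly) dvd monom z n - (if even n then [:z:] else [:0, z:])"
proof (induction n rule: less_induct)
  case (less n)
  consider "n = 0" | "n = 1" | k where "n = Suc (Suc k)"
    by (metis One_nat_def not0_implies_Suc)
  then show ?case
  proof cases
    case 3
    have "monom z n - (if even n then [:z:] else [:0, z:])
        = [:- 1, 0, 1:] * monom z k + (monom z k - (if even k then [:z:] else [:0, z:]))"
      by (simp add: 3 monom_Suc)
    then show ?thesis
      using less[of k] 3 by (metis dvd_add dvd_triv_left lessI less_SucI)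
  qed (simp_all add: monom_0 monom_Suc)
qed

text \<open>What remains after the category has been eliminated: a two-sided sequence \<open>b\<close> in the ground
  field with a linear recurrence, and one divisibility.\<close>

locale bubble_values =
  fixes z t :: "'k::field" and b :: "int \<Rightarrow> 'k" and m :: "'k poly"
  assumes z_nonzero: "z \<noteq> 0" and t_nonzero: "t \<noteq> 0"
    and b_0: "b 0 = (t - inverse t) / z + 1"
    and m_monic: "lead_coeff m = 1"
    and m_nonzero_at_0: "poly m 0 \<noteq> 0"
    and recurrence: "\<And>k. (\<Sum>i\<le>degree m. coeff m i * b (int i + k)) = 0"
    and curl: "m dvd (\<Sum>i\<le>degree m. monom (coeff m i) (degree m - i) * curl_poly z t b i)"
begin

abbreviation d where "d \<equiv> degree m"
abbreviation M where "M \<equiv> poly m 0"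
abbreviation w :: "'k poly" where "w \<equiv> [:- 1, 0, 1:]"

text \<open>The numerator of the rational function \<open>\<Sum>\<^sub>n b\<^sub>n v\<^sup>n\<close>, \<open>n \<ge> 0\<close>, whose denominator is
  \<open>reflect_poly m\<close>.\<close>

definition Q :: "'k poly" where
  "Q = (\<Sum>i\<le>d. \<Sum>k<i. monom (coeff m i * b (int k)) (d - i + k))"

lemma coeff_Q:
  "coeff Q n = (if n < d then \<Sum>i\<le>d. if d \<le> n + i then coeff m i * b (int n - int d + int i) else 0 else 0)"
proof -
  have "(\<Sum>k<i. if d - i + k = n then coeff m i * b (int k) else 0)
      = (if n < d \<and> d \<le> n + i then coeff m i * b (int n - int d + int i) else 0)"
    if "i \<le> d" for i
  proof -
    have "(\<Sum>k<i. if d - i + k = n then coeff m i * b (int k) else 0)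
        = (\<Sum>k<i. if k = n + i - d then if d \<le> n + i then coeff m i * b (int k) else 0 else 0)"
      using that by (intro sum.cong) auto
    also have "\<dots> = (if n < d \<and> d \<le> n + i then coeff m i * b (int n - int d + int i) else 0)"
      using that by (auto simp: of_nat_diff algebra_simps)
    finally show ?thesis .
  qed
  then show ?thesis
    by (simp add: Q_def coeff_sum cong: if_cong)
qed

lemma reflect_m: "reflect_poly m = (\<Sum>i\<le>d. monom (coeff m i) (d - i))"
proof (rule poly_eqI)
  fix n
  have "(\<Sum>i\<le>d. if d - i = n then coeff m i else 0)
      = (\<Sum>i\<le>d. if i = d - n then if n \<le> d then coeff m i else 0 else 0)"
    by (intro sum.cong) auto
  then show "coeff (reflect_poly m) n = coeff (\<Sum>i\<le>d. monom (coeff m i) (d - i)) n"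
    by (simp add: coeff_sum coeff_reflect_poly)
qed

text \<open>The factor \<open>u\<^sup>2 - 1\<close> telescopes the terms with \<open>2 k\<close> dots.\<close>

lemma w_curl_poly:
  "w * curl_poly z t b i = smult (inverse t) w + [:z:] - monom z (2 * i)
    + smult z (w * (\<Sum>k<i. monom (b (int k)) k))"
proof (induction i)
  case (Suc i)
  have "w * curl_poly z t b (Suc i)
      = w * curl_poly z t b i + smult z (w * monom (b (int i)) i) - w * monom z (2 * i)"
  proof -
    have "curl_poly z t b (Suc i) = curl_poly z t b i + (smult z (monom (b (int i)) i) - monom z (2 * i))"
      by (simp add: curl_poly_def smult_monom)
    then show ?thesis
      by (simp only: distrib_left right_diff_distrib mult_smult_right add_diff_eq)
  qed
  also have "w * monom z (2 * i) = monom z (2 * Suc i) - monom z (2 * i)"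
    by (simp add: monom_Suc)
  finally show ?case
    by (simp add: Suc smult_add_right distrib_left del: mult_pCons_left)
qed (simp add: curl_poly_def monom_0)

lemma w_curl_sum:
  "w * (\<Sum>i\<le>d. monom (coeff m i) (d - i) * curl_poly z t b i)
    = (smult (inverse t) w + [:z:]) * reflect_poly m + smult z (w * Q) - monom z d * m"
proof -
  have term_eq: "w * (monom (coeff m i) (d - i) * curl_poly z t b i)
      = (smult (inverse t) w + [:z:]) * monom (coeff m i) (d - i)
        + smult z (w * (\<Sum>k<i. monom (coeff m i * b (int k)) (d - i + k)))
        - monom z d * monom (coeff m i) i"
    if "i \<le> d" for i
  proof -
    have "w * (monom (coeff m i) (d - i) * curl_poly z t b i)
        = monom (coeff m i) (d - i) * (w * curl_poly z t b i)"
      by (simp only: mult.left_commute)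
    also have "\<dots> = (smult (inverse t) w + [:z:]) * monom (coeff m i) (d - i)
        + smult z (w * (monom (coeff m i) (d - i) * (\<Sum>k<i. monom (b (int k)) k)))
        - monom (coeff m i) (d - i) * monom z (2 * i)"
      unfolding w_curl_poly by (simp only: algebra_simps mult_smult_right)
    also have "monom (coeff m i) (d - i) * monom z (2 * i) = monom z d * monom (coeff m i) i"
      using that by (simp add: mult_monom mult.commute add.commute)
    finally show ?thesis
      by (simp add: sum_distrib_left mult_monom)
  qed
  have "w * (\<Sum>i\<le>d. monom (coeff m i) (d - i) * curl_poly z t b i)
      = (\<Sum>i\<le>d. (smult (inverse t) w + [:z:]) * monom (coeff m i) (d - i)
        + smult z (w * (\<Sum>k<i. monom (coeff m i * b (int k)) (d - i + k)))
        - monom z d * monom (coeff m i) i)"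
    by (subst sum_distrib_left, rule sum.cong[OF HOL.refl], rule term_eq) simp
  also have "\<dots> = (smult (inverse t) w + [:z:]) * reflect_poly m + smult z (w * Q)
      - monom z d * (\<Sum>i\<le>d. monom (coeff m i) i)"
  proof -
    have "smult z (\<Sum>i\<le>d. F i) = (\<Sum>i\<le>d. smult z (F i))" for F :: "nat \<Rightarrow> 'k poly"
      using sum_distrib_left[of "[:z:]" F "{..d}"] by simp
    then show ?thesis
      unfolding reflect_m Q_def sum_distrib_left[of _ _ "{..d}"] sum_subtractf sum.distrib by simp
  qed
  finally show ?thesis
    by (simp add: poly_as_sum_of_monoms)
qed

lemma coeff_Q_0: "coeff Q 0 = b 0"
proof (cases "d = 0")
  case True
  then show ?thesis
    using recurrence[of 0] m_monic by (simp add: coeff_Q)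
next
  case False
  have "coeff Q 0 = (\<Sum>i\<le>d. if i = d then coeff m i * b (int i - int d) else 0)"
    using False by (auto simp: coeff_Q intro!: sum.cong)
  then show ?thesis
    using m_monic by simp
qed

text \<open>The quotient by \<open>m\<close> has degree at most two.  Its coefficient of \<open>u\<^sup>2\<close> and its constant term are
  read off from the left-hand side, and its residue modulo \<open>u\<^sup>2 - 1\<close> is that of \<open>z u\<^sup>d\<close>, because the
  sum in \<open>w_curl_sum\<close> is divisible by \<open>m\<close> before it is multiplied by \<open>u\<^sup>2 - 1\<close>.  These are four
  conditions on three coefficients, and the surplus one is the restriction on \<open>M\<close>.  Working modulo
  \<open>u\<^sup>2 - 1\<close>, instead of evaluating at \<open>\<plusminus>1\<close>, covers roots of \<open>m\<close> at \<open>\<plusminus>1\<close> and characteristic two.\<close>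

theorem key_identity:
  obtains q\<^sub>1 where
    "(smult (inverse t) w + [:z:]) * reflect_poly m + smult z (w * Q) = [:- (t / M), q\<^sub>1, M / t:] * m"
    "even d \<Longrightarrow> q\<^sub>1 = 0 \<and> M / t - t / M = z"
    "odd d \<Longrightarrow> q\<^sub>1 = z \<and> M / t - t / M = 0"
proof -
  let ?lhs = "(smult (inverse t) w + [:z:]) * reflect_poly m + smult z (w * Q)"
  obtain H where H: "(\<Sum>i\<le>d. monom (coeff m i) (d - i) * curl_poly z t b i) = m * H"
    using curl by (auto simp: dvd_def)
  define q where "q = w * H + monom z d"
  have q: "?lhs = q * m"
  proof -
    have "w * (m * H) = ?lhs - monom z d * m"
      using w_curl_sum unfolding H .
    then have "?lhs = w * (m * H) + monom z d * m"
      by (metis diff_add_cancel)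
    then show ?thesis
      by (simp only: q_def algebra_simps)
  qed
  have m0: "coeff m 0 = M"
    by (simp add: poly_0_coeff_0)
  have [simp]: "m \<noteq> 0" "M \<noteq> 0"
    using m_monic m_nonzero_at_0 by auto
  have deg_Q: "degree Q \<le> d"
    by (rule degree_le) (simp add: coeff_Q)
  have "degree (smult (inverse t) w + [:z:]) \<le> 2"
    by (rule degree_add_le) simp_all
  then have "degree ((smult (inverse t) w + [:z:]) * reflect_poly m) \<le> 2 + d"
    by (intro order_trans[OF degree_mult_le] add_mono degree_reflect_poly_le)
  moreover have "degree (w * Q) \<le> 2 + d"
    using degree_mult_le[of w Q] deg_Q by simp
  ultimately have "degree (q * m) \<le> 2 + d"
    unfolding q[symmetric] by (intro degree_add_le) (auto intro: order_trans[OF degree_smult_le])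
  then have deg_q: "degree q \<le> 2"
    by (cases "q = 0") (simp_all add: degree_mult_eq)
  have "coeff q 2 = coeff ?lhs (2 + d)"
    using coeff_mult_top[OF deg_q, of m] m_monic q by simp
  also have "\<dots> = M / t"
    by (simp add: coeff_Q coeff_reflect_poly m0 divide_inverse mult.commute)
  finally have q2: "coeff q 2 = M / t" .
  \<comment> \<open>This is where the value of the undotted bubble enters.\<close>
  have "coeff q 0 * M = coeff ?lhs 0"
    unfolding q by (simp add: coeff_mult m0)
  also have "\<dots> = z - inverse t - z * b 0"
    using m_monic by (simp add: coeff_Q_0)
  also have "\<dots> = - t"
    using z_nonzero by (simp add: b_0 field_simps)
  finally have q0: "coeff q 0 = - (t / M)"
    by (simp add: field_simps)
  define q\<^sub>1 where "q\<^sub>1 = coeff q 1"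
  have q_eq: "q = [:- (t / M), q\<^sub>1, M / t:]"
  proof (rule poly_eqI)
    fix n :: nat
    consider "n = 0" | "n = 1" | "n = 2" | "n > 2" by linarith
    then show "coeff q n = coeff [:- (t / M), q\<^sub>1, M / t:] n"
      using deg_q q0 q2
      by cases (simp_all add: q\<^sub>1_def coeff_eq_0 coeff_pCons numeral_2_eq_2 split: nat.split)
  qed
  let ?r = "if even d then [:z:] else [:0, z:]"
  have "w dvd w * H + (monom z d - ?r) - w * [:M / t:]"
    by (rule dvd_diff[OF dvd_add[OF dvd_triv_left power2_minus_1_dvd] dvd_triv_left])
  also have "w * H + (monom z d - ?r) - w * [:M / t:] = [:M / t - t / M, q\<^sub>1:] - ?r"
    using q_eq unfolding q_def by (simp add: algebra_simps)
  finally have "w dvd [:M / t - t / M, q\<^sub>1:] - ?r" .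
  moreover have "degree ([:M / t - t / M, q\<^sub>1:] - ?r) < degree w"
    by (auto simp: degree_diff_le intro!: le_less_trans[OF degree_diff_le[of _ 1]])
  ultimately have "[:M / t - t / M, q\<^sub>1:] - ?r = 0"
    using divides_degree by fastforce
  then have "even d \<Longrightarrow> q\<^sub>1 = 0 \<and> M / t - t / M = z" "odd d \<Longrightarrow> q\<^sub>1 = z \<and> M / t - t / M = 0"
    by simp_all
  then show thesis
    using that q unfolding q_eq by blast
qed

lemma right_series: "fps_of_poly (reflect_poly m) * Abs_fps (\<lambda>n. b (int n)) = fps_of_poly Q"
proof (rule fps_ext)
  fix e
  have "(fps_of_poly (reflect_poly m) * Abs_fps (\<lambda>n. b (int n))) $ e
      = (\<Sum>j=0..e. if j \<le> d then coeff m (d - j) * b (int (e - j)) else 0)"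
    by (auto simp: fps_mult_nth coeff_reflect_poly intro!: sum.cong)
  also have "\<dots> = (\<Sum>j\<in>{j. j \<le> e \<and> j \<le> d}. coeff m (d - j) * b (int (e - j)))"
    by (rule sum.mono_neutral_cong_right) auto
  also have "\<dots> = (\<Sum>i\<in>{i. i \<le> d \<and> d \<le> e + i}. coeff m i * b (int e - int d + int i))"
    by (rule sum.reindex_bij_witness[of _ "\<lambda>i. d - i" "\<lambda>j. d - j"]) (auto simp: of_nat_diff)
  also have "\<dots> = (\<Sum>i\<le>d. if d \<le> e + i then coeff m i * b (int e - int d + int i) else 0)"
    by (rule sum.mono_neutral_cong_left) auto
  also have "\<dots> = coeff Q e"
    using recurrence[of "int e - int d"] by (auto simp: coeff_Q add.commute)
  finally show "(fps_of_poly (reflect_poly m) * Abs_fps (\<lambda>n. b (int n))) $ e = fps_of_poly Q $ e"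
    by simp
qed

text \<open>By the recurrence, \<open>m\<close> annihilates the two-sided series of the \<open>b\<^sub>n u\<^sup>-\<^sup>n\<close>.  Hence its part
  with \<open>n \<ge> 0\<close> and minus its part with \<open>n < 0\<close> are the expansions of one rational function, at
  infinity and at zero.  The constant \<open>b\<^sub>0\<close> is counted in both series, which is the first term on the
  right; the second is \<open>Q\<close> with its coefficients reversed.\<close>

lemma left_series:
  "fps_of_poly m * Abs_fps (\<lambda>n. b (- int n))
    = fps_const (b 0) * fps_of_poly m - Abs_fps (\<lambda>n. if n \<le> d then coeff Q (d - n) else 0)"
proof (rule fps_ext)
  fix e
  have lhs: "(fps_of_poly m * Abs_fps (\<lambda>n. b (- int n))) $ e
      = (\<Sum>i\<le>e. coeff m i * b (int i - int e))"
    by (simp add: fps_mult_nth atLeast0AtMost of_nat_diff)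
  have upper: "(if e \<le> d then coeff Q (d - e) else 0)
      = (if e = 0 then 0 else \<Sum>i\<le>d. if e \<le> i then coeff m i * b (int i - int e) else 0)"
    by (auto simp: coeff_Q of_nat_diff intro!: sum.cong sum.neutral[symmetric])
  have "(\<Sum>i\<le>e. coeff m i * b (int i - int e)) = b 0 * coeff m e - (if e \<le> d then coeff Q (d - e) else 0)"
  proof (cases "e = 0")
    case False
    let ?F = "\<lambda>i. coeff m i * b (int i - int e)"
    let ?N = "max d e"
    have "(\<Sum>i\<le>d. ?F i) = (\<Sum>i\<le>?N. ?F i)"
      by (rule sum.mono_neutral_left) (auto simp: coeff_eq_0)
    also have "\<dots> = (\<Sum>i\<le>?N. (if i \<le> e then ?F i else 0) + (if e \<le> i then ?F i else 0)
        - (if i = e then ?F i else 0))"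
      by (rule sum.cong) auto
    also have "\<dots> = (\<Sum>i\<le>?N. if i \<le> e then ?F i else 0) + (\<Sum>i\<le>?N. if e \<le> i then ?F i else 0)
        - coeff m e * b 0"
      by (simp add: sum.distrib sum_subtractf)
    also have "(\<Sum>i\<le>?N. if i \<le> e then ?F i else 0) = (\<Sum>i\<le>e. ?F i)"
      by (rule sum.mono_neutral_cong_right) auto
    also have "(\<Sum>i\<le>?N. if e \<le> i then ?F i else 0) = (\<Sum>i\<le>d. if e \<le> i then ?F i else 0)"
      by (rule sum.mono_neutral_right) (auto simp: coeff_eq_0)
    also have "(\<Sum>i\<le>d. ?F i) = 0"
      using recurrence[of "- int e"] by simp
    finally show ?thesis
      using False unfolding upper by (simp add: algebra_simps)
  qed (simp add: coeff_Q mult.commute)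
  then show "(fps_of_poly m * Abs_fps (\<lambda>n. b (- int n))) $ e
      = (fps_const (b 0) * fps_of_poly m - Abs_fps (\<lambda>n. if n \<le> d then coeff Q (d - n) else 0)) $ e"
    by (simp add: lhs)
qed

end


section \<open>Values of rational functions\<close>

locale field_embedding =
  fixes \<iota> :: "'k::field \<Rightarrow> 'f::field"
  assumes embed_add: "\<iota> (c + d) = \<iota> c + \<iota> d"
    and embed_mult: "\<iota> (c * d) = \<iota> c * \<iota> d"
    and embed_1: "\<iota> 1 = 1"
begin

abbreviation value_at :: "'f \<Rightarrow> 'k poly \<Rightarrow> 'f" where
  "value_at y p \<equiv> poly (map_poly \<iota> p) y"

lemma embed_0: "\<iota> 0 = 0"
proof -
  have "\<iota> 0 + \<iota> 0 = \<iota> 0 + 0"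
    by (simp flip: embed_add)
  then show ?thesis
    by (rule add_left_imp_eq)
qed

lemma embed_minus: "\<iota> (- c) = - \<iota> c"
proof -
  have "\<iota> c + \<iota> (- c) = 0"
    by (simp add: embed_0 flip: embed_add)
  then show ?thesis
    by (rule minus_unique[symmetric])
qed

lemma embed_nonzero: "c \<noteq> 0 \<Longrightarrow> \<iota> c \<noteq> 0"
  using embed_mult[of c "inverse c"] embed_1 by auto

lemma value_0: "value_at y 0 = 0"
  by simp

lemma value_pCons: "value_at y (pCons c p) = \<iota> c + y * value_at y p"
  by (simp add: map_poly_pCons embed_0)

lemma value_add: "value_at y (p + q) = value_at y p + value_at y q"
  by (induction p q rule: poly_induct2) (simp_all add: value_pCons embed_add algebra_simps del: map_poly_pCons)

lemma value_smult: "value_at y (smult c p) = \<iota> c * value_at y p"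
  by (induction p) (simp_all add: value_pCons embed_mult algebra_simps del: map_poly_pCons)

lemma value_mult: "value_at y (p * q) = value_at y p * value_at y q"
  by (induction p)
     (simp_all add: value_pCons value_add value_smult embed_0 algebra_simps del: map_poly_pCons)

lemma value_sum: "degree p \<le> n \<Longrightarrow> value_at y p = (\<Sum>i\<le>n. \<iota> (coeff p i) * y ^ i)"
proof -
  assume n: "degree p \<le> n"
  have deg: "degree (map_poly \<iota> p) = degree p"
    by (rule degree_map_poly) (rule embed_nonzero)
  show ?thesis
    unfolding poly_altdef deg
    by (rule sum.mono_neutral_cong_left)
       (use n in \<open>auto simp: coeff_map_poly embed_0 coeff_eq_0\<close>)
qed

text \<open>Passage between the variables \<open>u\<close> and \<open>u\<^sup>-\<^sup>1\<close>.\<close>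

lemma value_reversed:
  assumes y: "y \<noteq> 0" and deg: "degree q \<le> n" and p: "\<And>i. coeff p i = (if i \<le> n then coeff q (n - i) else 0)"
  shows "value_at y p = y ^ n * value_at (inverse y) q"
proof -
  have "degree p \<le> n"
    by (rule degree_le) (simp add: p)
  then have "value_at y p = (\<Sum>i\<le>n. \<iota> (coeff p i) * y ^ i)"
    by (rule value_sum)
  also have "\<dots> = (\<Sum>i\<le>n. \<iota> (coeff q i) * y ^ (n - i))"
    by (rule sum.reindex_bij_witness[of _ "\<lambda>i. n - i" "\<lambda>i. n - i"]) (auto simp: p)
  also have "\<dots> = (\<Sum>i\<le>n. y ^ n * (\<iota> (coeff q i) * inverse y ^ i))"
  proof (rule sum.cong)
    fix i assume "i \<in> {..n}"
    then have "y ^ (n - i) = y ^ n * inverse y ^ i"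
      using y by (simp add: power_diff power_inverse divide_inverse)
    then show "\<iota> (coeff q i) * y ^ (n - i) = y ^ n * (\<iota> (coeff q i) * inverse y ^ i)"
      by (simp only: mult.left_commute)
  qed simp
  also have "\<dots> = y ^ n * value_at (inverse y) q"
    by (simp add: value_sum[OF deg] sum_distrib_left)
  finally show ?thesis .
qed

lemma eval_ratfun_Fract:
  assumes q: "value_at y q \<noteq> 0"
  shows "eval_ratfun \<iota> y (Fraction_Field.Fract p q) = value_at y p / value_at y q"
  unfolding eval_ratfun_def
proof (rule the_equality)
  show "\<exists>p' q'. Fraction_Field.Fract p q = Fraction_Field.Fract p' q' \<and> value_at y q' \<noteq> 0
      \<and> value_at y p / value_at y q = value_at y p' / value_at y q'"
    using q by blast
next
  fix s
  assume "\<exists>p' q'. Fraction_Field.Fract p q = Fraction_Field.Fract p' q' \<and> value_at y q' \<noteq> 0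
      \<and> s = value_at y p' / value_at y q'"
  then obtain p' q' where eq: "Fraction_Field.Fract p q = Fraction_Field.Fract p' q'"
    and q': "value_at y q' \<noteq> 0" and s: "s = value_at y p' / value_at y q'"
    by blast
  have "q \<noteq> 0" "q' \<noteq> 0"
    using q q' by auto
  then have "p * q' = p' * q"
    using eq by (simp add: eq_fract)
  then have "value_at y p * value_at y q' = value_at y p' * value_at y q"
    by (simp flip: value_mult)
  then show "s = value_at y p / value_at y q"
    using q q' by (simp add: s frac_eq_eq)
qed

end

interpretation laurent: field_embedding "fls_const :: 'k::field \<Rightarrow> 'k fls"
  by unfold_locales (simp_all add: fls_plus_const)

lemma value_at_fls_X: "laurent.value_at fls_X p = fps_to_fls (fps_of_poly p)"
proof (induction p)
  case (pCons c p)
  then show ?case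
    by (simp add: laurent.value_pCons fps_of_poly_pCons fls_times_fps_to_fls del: map_poly_pCons)
qed simp

lemma value_at_fls_X_inv_nonzero:
  assumes "p \<noteq> 0"
  shows "laurent.value_at fls_X_inv p \<noteq> 0"
proof
  assume "laurent.value_at fls_X_inv p = 0"
  then have "laurent.value_at fls_X (reflect_poly p) = 0"
    using laurent.value_reversed[of fls_X p "degree p" "reflect_poly p"]
    by (simp add: coeff_reflect_poly fls_inverse_X)
  then have "fps_of_poly (reflect_poly p) = 0"
    by (simp add: value_at_fls_X)
  then show False
    using assms by (metis fps_of_poly_0 fps_of_poly_eq_iff reflect_poly_eq_0_iff)
qed

lemma at_infinity_Fract:
  "q \<noteq> 0 \<Longrightarrow> at_infinity_fls (Fraction_Field.Fract p q)
    = laurent.value_at fls_X_inv p / laurent.value_at fls_X_inv q"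
  unfolding at_infinity_fls_def
  by (rule laurent.eval_ratfun_Fract) (rule value_at_fls_X_inv_nonzero)

lemma at_infinity_Fract_mult:
  "q \<noteq> 0 \<Longrightarrow> s \<noteq> 0 \<Longrightarrow> at_infinity_fls (Fraction_Field.Fract (p * r) (q * s))
    = laurent.value_at fls_X_inv p * laurent.value_at fls_X_inv r
      / (laurent.value_at fls_X_inv q * laurent.value_at fls_X_inv s)"
  by (simp only: at_infinity_Fract laurent.value_mult mult_eq_0_iff simp_thms)

lemma at_infinity_regular:
  assumes "q \<noteq> 0" "degree p \<le> degree q"
  shows "\<exists>f. at_infinity_fls (Fraction_Field.Fract p q) = fps_to_fls f"
proof -
  define n where "n = degree q"
  define p' where "p' = (\<Sum>i\<le>n. monom (coeff p (n - i)) i)"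
  have p': "coeff p' i = (if i \<le> n then coeff p (n - i) else 0)" for i
    by (simp add: p'_def coeff_sum)
  have q': "coeff (reflect_poly q) i = (if i \<le> n then coeff q (n - i) else 0)" for i
    by (simp add: coeff_reflect_poly n_def)
  have unit: "fps_of_poly (reflect_poly q) $ 0 \<noteq> 0"
    using assms by simp
  have "at_infinity_fls (Fraction_Field.Fract p q)
      = laurent.value_at fls_X p' / laurent.value_at fls_X (reflect_poly q)"
    using assms laurent.value_reversed[OF _ _ p', of fls_X] laurent.value_reversed[OF _ _ q', of fls_X]
    by (simp add: at_infinity_Fract n_def fls_inverse_X)
  also have "\<dots> = fps_to_fls (fps_of_poly p' * inverse (fps_of_poly (reflect_poly q)))"
    using unit by (simp add: value_at_fls_X fls_times_fps_to_fls divide_inverse fls_inverse_fps_to_fls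
        subdegree_eq_0_iff)
  finally show ?thesis by blast
qed

lemma series_at_infinity:
  assumes "q \<noteq> 0" "degree p \<le> degree q" "degree r \<le> degree q"
    and c: "\<And>n. c n = fls_nth (at_infinity_fls (Fraction_Field.Fract p q)) (int n)
      + (\<Sum>i\<le>n. fls_nth (at_infinity_fls (Fraction_Field.Fract r q)) (int (n - i)) * b i)"
  shows "fps_to_fls (Abs_fps c) = at_infinity_fls (Fraction_Field.Fract p q)
    + at_infinity_fls (Fraction_Field.Fract r q) * fps_to_fls (Abs_fps b)"
proof -
  obtain f g where fg: "at_infinity_fls (Fraction_Field.Fract p q) = fps_to_fls f"
    "at_infinity_fls (Fraction_Field.Fract r q) = fps_to_fls g"
    using at_infinity_regular assms(1-3) by blast
  have "Abs_fps c = f + Abs_fps b * g"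
    by (rule fps_ext) (auto simp: c fg fps_mult_nth atLeast0AtMost nat_diff_distrib
        intro!: sum.cong mult.commute)
  then show ?thesis
    by (simp add: fg fls_times_fps_to_fls)
qed

definition ratfun_const :: "'k::field \<Rightarrow> 'k poly fract" where
  "ratfun_const c = Fraction_Field.Fract [:c:] 1"

interpretation ratfun: field_embedding "ratfun_const :: 'k::field \<Rightarrow> 'k poly fract"
  by unfold_locales (simp_all add: ratfun_const_def One_fract_def one_pCons mult.commute)

lemma ratfun_value_at_variable:
  "ratfun.value_at (Fraction_Field.Fract [:0, 1:] 1) p = Fraction_Field.Fract p 1"
proof (induction p)
  case (pCons c p)
  show ?case
    unfolding ratfun.value_pCons pCons.IH by (simp add: ratfun_const_def)
qed (simp add: Zero_fract_def)

lemma invert_variable_eq: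
  "invert_variable = eval_ratfun ratfun_const (Fraction_Field.Fract 1 [:0, 1:])"
  by (simp add: invert_variable_def ratfun_const_def[abs_def])


section \<open>The series determined by the bubble values\<close>

text \<open>The next three lemmas are the computations in the field that contains the values of the
  polynomials.  \<open>P\<close>, \<open>S\<close> and \<open>q\<close> stand for the values of \<open>m\<close>, of its reversal and of \<open>Q\<close>; \<open>c\<close> and
  \<open>c'\<close> for \<open>m(0)\<close> and its inverse, \<open>i\<close> for \<open>t\<^sup>-\<^sup>1\<close>, and \<open>B\<close> for a bubble series.\<close>

lemma right_algebra:
  fixes u v :: "'f::field"
  assumes "u * v = 1" "S \<noteq> 0" "S * B = q"
    and key: "(i * (v * v - 1) + z) * S + z * (v * v - 1) * q = (k\<^sub>2 * v * v + k\<^sub>1 * v - k\<^sub>0) * P"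
    and "c * c' = 1"
  shows "((i - z) * u * u - i + z * (u * u - 1) * B) / D
    = (c * k\<^sub>0 * u * u - c * k\<^sub>1 * u - c * k\<^sub>2) * (c' * P) / (D * S)"
proof -
  let ?N = "c * k\<^sub>0 * u * u - c * k\<^sub>1 * u - c * k\<^sub>2"
  have v: "v \<noteq> 0"
    using assms(1) by auto
  have "((i - z) * u * u - i) * S * (v * v) + z * (u * u - 1) * q * (v * v)
      = ((i - z) * (u * v) * (u * v) - i * v * v) * S + z * ((u * v) * (u * v) - v * v) * q"
    by (simp add: algebra_simps)
  also have "\<dots> = - ((i * (v * v - 1) + z) * S + z * (v * v - 1) * q)"
    unfolding assms(1) by (simp add: algebra_simps)
  also have "\<dots> = (c * c') * - ((k\<^sub>2 * v * v + k\<^sub>1 * v - k\<^sub>0) * P)"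
    unfolding key using assms by simp
  also have "\<dots> = (c * k\<^sub>0 * (u * v) * (u * v) - c * k\<^sub>1 * (u * v) * v - c * k\<^sub>2 * v * v) * (c' * P)"
    unfolding assms(1) by (simp add: algebra_simps)
  also have "\<dots> = ?N * (c' * P) * (v * v)"
    by (simp add: algebra_simps)
  finally have "(((i - z) * u * u - i) * S + z * (u * u - 1) * q) * (v * v) = ?N * (c' * P) * (v * v)"
    by (simp add: distrib_right)
  then have main: "((i - z) * u * u - i) * S + z * (u * u - 1) * q = ?N * (c' * P)"
    using v by simp
  have "((i - z) * u * u - i + z * (u * u - 1) * B) / D
      = (((i - z) * u * u - i + z * (u * u - 1) * B) * S) / (D * S)"
    using assms(2) by simp
  also have "((i - z) * u * u - i + z * (u * u - 1) * B) * S
      = ((i - z) * u * u - i) * S + z * (u * u - 1) * (S * B)"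
    by (simp add: algebra_simps)
  finally show ?thesis
    unfolding assms(3) main .
qed

lemma left_algebra:
  fixes u :: "'f::field"
  assumes "S \<noteq> 0" "S * B = \<beta> * S - q" "z * \<beta> = t - i + z"
    and key: "(i * (u * u - 1) + z) * S + z * (u * u - 1) * q
      = (n\<^sub>2 * c * u * u + n\<^sub>1 * c * u - n\<^sub>0 * c) * P"
    and "c * c' = 1"
  shows "((t + z) * u * u - t - z * (u * u - 1) * B) / D
    = (n\<^sub>2 * u * u + n\<^sub>1 * u - n\<^sub>0) * P / (D * (c' * S))"
proof -
  have c': "c' \<noteq> 0"
    using assms(5) by auto
  have "((t + z) * u * u - t - z * (u * u - 1) * B) * S
      = ((t + z) * u * u - t) * S - z * (u * u - 1) * (S * B)"
    by (simp add: algebra_simps)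
  also have "\<dots> = ((t + z) * u * u - t) * S - (z * \<beta>) * (u * u - 1) * S + z * (u * u - 1) * q"
    unfolding assms(2) by (simp add: algebra_simps)
  also have "\<dots> = (i * (u * u - 1) + z) * S + z * (u * u - 1) * q"
    unfolding assms(3) by (simp add: algebra_simps)
  also have "\<dots> = (n\<^sub>2 * u * u + n\<^sub>1 * u - n\<^sub>0) * P * c"
    unfolding key by (simp add: algebra_simps)
  finally have "((t + z) * u * u - t - z * (u * u - 1) * B) * (c' * S)
      = (n\<^sub>2 * u * u + n\<^sub>1 * u - n\<^sub>0) * P * (c * c')"
    by (simp only: mult.assoc mult.left_commute[of _ c'] mult.commute[of c c'])
  then have "(n\<^sub>2 * u * u + n\<^sub>1 * u - n\<^sub>0) * P
      = ((t + z) * u * u - t - z * (u * u - 1) * B) * (c' * S)"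
    using assms(5) by simp
  then show ?thesis
    using c' assms(1) by simp
qed

lemma invert_algebra:
  fixes U V :: "'f::field"
  assumes "V * U = 1" "c * c' = 1"
  shows "(c * c * n\<^sub>0 * V * V - c * c * n\<^sub>1 * V - c * c * n\<^sub>2) * (c' * (V ^ d * P)) / ((V * V - z * V - 1) * (V ^ d * S))
    = (n\<^sub>2 * U * U + n\<^sub>1 * U - n\<^sub>0) * P / ((U * U + z * U - 1) * (c' * S))"
proof -
  have nz: "V \<noteq> 0" "c \<noteq> 0" "c' \<noteq> 0"
    using assms by auto
  have num: "c * c * n\<^sub>0 * V * V - c * c * n\<^sub>1 * V - c * c * n\<^sub>2
      = - (V * V) * (c * c * (n\<^sub>2 * U * U + n\<^sub>1 * U - n\<^sub>0))"
  proof -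
    have "- (V * V) * (c * c * (n\<^sub>2 * U * U + n\<^sub>1 * U - n\<^sub>0))
        = c * c * n\<^sub>0 * V * V - c * c * n\<^sub>1 * V * (V * U) - c * c * n\<^sub>2 * (V * U) * (V * U)"
      by (simp add: algebra_simps)
    then show ?thesis
      by (simp add: assms(1))
  qed
  have den: "V * V - z * V - 1 = - (V * V) * (U * U + z * U - 1)"
  proof -
    have "- (V * V) * (U * U + z * U - 1) = V * V - z * V * (V * U) - (V * U) * (V * U)"
      by (simp add: algebra_simps)
    then show ?thesis
      by (simp add: assms(1))
  qed
  have "(- (V * V) * (c * c * (n\<^sub>2 * U * U + n\<^sub>1 * U - n\<^sub>0))) * (c' * (V ^ d * P))
      = (- (V * V) * V ^ d) * ((c * c') * c * ((n\<^sub>2 * U * U + n\<^sub>1 * U - n\<^sub>0) * P))"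
    by (simp only: mult_ac)
  moreover have "(- (V * V) * (U * U + z * U - 1)) * (V ^ d * S)
      = (- (V * V) * V ^ d) * ((c * c') * ((U * U + z * U - 1) * S))"
    unfolding assms(2) by (simp only: mult_ac mult_1_left)
  moreover have "(- (V * V) * V ^ d) * ((c * c') * ((U * U + z * U - 1) * S))
      = (- (V * V) * V ^ d) * (c * ((U * U + z * U - 1) * (c' * S)))"
    by (simp only: mult_ac)
  moreover have "- (V * V) * V ^ d \<noteq> 0"
    using nz by simp
  ultimately show ?thesis
    unfolding num den using nz(2) by (simp only: assms(2) mult_1_left mult_divide_mult_cancel_left simp_thms)
qed

context bubble_values
begin

lemma reflect_coeffs:
  "coeff (reflect_poly m) i = (if i \<le> d then coeff m (d - i) else 0)"
  "coeff m i = (if i \<le> d then coeff (reflect_poly m) (d - i) else 0)"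
  by (auto simp: coeff_reflect_poly coeff_eq_0)

lemma M_nonzero: "M \<noteq> 0" and m_nonzero: "m \<noteq> 0"
  using m_nonzero_at_0 by auto

text \<open>The restriction on \<open>M\<close> merges the two cases of the definition.\<close>

lemma O_poly_uniform:
  obtains q\<^sub>1 where
    "(smult (inverse t) w + [:z:]) * reflect_poly m + smult z (w * Q) = [:- (t / M), q\<^sub>1, M / t:] * m"
    "O_poly z t m = Fraction_Field.Fract ([:- (M * M / t), - (M * q\<^sub>1), t:] * check_poly m)
      ([:- 1, - z, 1:] * m)"
    "O_tilde_poly z t m = Fraction_Field.Fract ([:- (t / (M * M)), q\<^sub>1 / M, inverse t:] * m)
      ([:- 1, z, 1:] * check_poly m)"
proof -
  obtain q\<^sub>1 where q: "(smult (inverse t) w + [:z:]) * reflect_poly m + smult z (w * Q)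
      = [:- (t / M), q\<^sub>1, M / t:] * m"
    "even d \<Longrightarrow> q\<^sub>1 = 0 \<and> M / t - t / M = z"
    "odd d \<Longrightarrow> q\<^sub>1 = z \<and> M / t - t / M = 0"
    using key_identity by blast
  show thesis
  proof (rule that[OF q(1)])
    have "M * M / t = z * M + t" "z * inverse M - inverse t = - (t / (M * M))" if "even d"
    proof -
      have z: "z = M / t - t / M"
        using q(2)[OF that] by simp
      show "M * M / t = z * M + t" "z * inverse M - inverse t = - (t / (M * M))"
        unfolding z using M_nonzero t_nonzero by (simp_all add: field_simps)
    qed
    moreover have "M * M / t = t" "inverse t = t / (M * M)" if "odd d"
      using q(3)[OF that] M_nonzero t_nonzero by (auto simp: field_simps)
    ultimately have
      "(if even d then [:- (z * M) - t, 0, t:] else [:- t, - (z * M), t:])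
        = [:- (M * M / t), - (M * q\<^sub>1), t:]"
      "(if even d then [:z * inverse M - inverse t, 0, inverse t:]
          else [:- inverse t, z * inverse M, inverse t:])
        = [:- (t / (M * M)), q\<^sub>1 / M, inverse t:]"
      using q(2,3) by (auto simp: divide_inverse mult.commute)
    then show "O_poly z t m = Fraction_Field.Fract ([:- (M * M / t), - (M * q\<^sub>1), t:] * check_poly m)
      ([:- 1, - z, 1:] * m)"
      "O_tilde_poly z t m = Fraction_Field.Fract ([:- (t / (M * M)), q\<^sub>1 / M, inverse t:] * m)
      ([:- 1, z, 1:] * check_poly m)"
      unfolding O_poly_def O_tilde_poly_def if_distrib[of "\<lambda>p. Fraction_Field.Fract p _", symmetric]
      by (simp_all only: mult_fract)
  qed
qed

lemma check_nonzero: "check_poly m \<noteq> 0"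
  using M_nonzero m_nonzero by (simp add: check_poly_def)

text \<open>The bubble series is \<open>Q(v) / reflect_poly m (v)\<close> at \<open>v = u\<^sup>-\<^sup>1\<close>, so the key identity is used at
  \<open>v\<close>.\<close>

theorem right_bubble_series:
  "at_infinity_fls (Fraction_Field.Fract [:- inverse t, 0, inverse t - z:] [:- 1, - z, 1:])
    + at_infinity_fls (Fraction_Field.Fract [:- z, 0, z:] [:- 1, - z, 1:])
      * fps_to_fls (Abs_fps (\<lambda>n. b (int n)))
    = at_infinity_fls (O_poly z t m)"
proof -
  obtain q\<^sub>1 where key: "(smult (inverse t) w + [:z:]) * reflect_poly m + smult z (w * Q)
      = [:- (t / M), q\<^sub>1, M / t:] * m"
    and O: "O_poly z t m = Fraction_Field.Fract ([:- (M * M / t), - (M * q\<^sub>1), t:] * check_poly m)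
      ([:- 1, - z, 1:] * m)"
    using O_poly_uniform by metis
  let ?c = "fls_const :: 'k \<Rightarrow> 'k fls"
  define u v where "u = (fls_X_inv :: 'k fls)" and "v = (fls_X :: 'k fls)"
  have u: "u = inverse v"
    by (simp add: u_def v_def fls_inverse_X)
  have v: "v \<noteq> 0"
    by (simp add: v_def)
  define P S where "P = laurent.value_at v m" and "S = laurent.value_at v (reflect_poly m)"
  define q where "q = laurent.value_at v Q"
  define B where "B = fps_to_fls (Abs_fps (\<lambda>n. b (int n)))"
  define D where "D = laurent.value_at u [:- 1, - z, 1:]"
  have SB: "S * B = q"
    unfolding S_def q_def v_def value_at_fls_X B_def
    by (simp add: right_series flip: fls_times_fps_to_fls)
  have S: "S = v ^ d * laurent.value_at u m"
    unfolding S_def u by (rule laurent.value_reversed[OF v order_refl reflect_coeffs(1)])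
  have P: "P = v ^ d * laurent.value_at u (reflect_poly m)"
    unfolding P_def u by (rule laurent.value_reversed[OF v degree_reflect_poly_le reflect_coeffs(2)])
  have nz: "D \<noteq> 0" "laurent.value_at u m \<noteq> 0"
    unfolding D_def u_def using m_nonzero by (intro value_at_fls_X_inv_nonzero; simp)+
  have S0: "S \<noteq> 0"
    unfolding S using nz v by simp
  have key': "(?c (inverse t) * (v * v - 1) + ?c z) * S + ?c z * (v * v - 1) * q
      = (?c (M / t) * v * v + ?c q\<^sub>1 * v - ?c (t / M)) * P"
    using arg_cong[OF key, of "laurent.value_at v"]
    unfolding laurent.value_add laurent.value_mult laurent.value_smult S_def P_def q_def
    by (simp add: laurent.value_pCons algebra_simps del: map_poly_pCons mult_pCons_left)
  have coeffs: "?c M * ?c (t / M) = ?c t" "?c M * ?c q\<^sub>1 = ?c (M * q\<^sub>1)"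
    "?c M * ?c (M / t) = ?c (M * M / t)" "?c M * ?c (inverse M) = 1"
    using M_nonzero by simp_all
  have "at_infinity_fls (Fraction_Field.Fract [:- inverse t, 0, inverse t - z:] [:- 1, - z, 1:])
      + at_infinity_fls (Fraction_Field.Fract [:- z, 0, z:] [:- 1, - z, 1:]) * B
      = ((?c (inverse t) - ?c z) * u * u - ?c (inverse t) + ?c z * (u * u - 1) * B) / D"
    by (simp add: at_infinity_Fract laurent.value_pCons D_def u_def add_divide_distrib
        diff_divide_distrib algebra_simps fls_minus_const[symmetric] del: map_poly_pCons)
  also have "\<dots> = (?c t * u * u - ?c (M * q\<^sub>1) * u - ?c (M * M / t)) * (?c (inverse M) * P) / (D * S)"
    using right_algebra[OF _ S0 SB key' coeffs(4), of u D] v unfolding coeffs by (simp add: u)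
  also have "\<dots> = (?c t * u * u - ?c (M * q\<^sub>1) * u - ?c (M * M / t))
      * (?c (inverse M) * laurent.value_at u (reflect_poly m)) / (D * laurent.value_at u m)"
    unfolding P S using v by (simp only: mult.left_commute[of _ "v ^ d"]) simp
  also have "\<dots> = at_infinity_fls (O_poly z t m)"
  proof -
    have "at_infinity_fls (O_poly z t m) = laurent.value_at u [:- (M * M / t), - (M * q\<^sub>1), t:]
        * laurent.value_at u (check_poly m) / (D * laurent.value_at u m)"
      unfolding O D_def u_def by (rule at_infinity_Fract_mult) (simp_all add: m_nonzero)
    moreover have "laurent.value_at u [:- (M * M / t), - (M * q\<^sub>1), t:]
        = ?c t * u * u - ?c (M * q\<^sub>1) * u - ?c (M * M / t)"
      by (simp add: laurent.value_pCons algebra_simps del: map_poly_pCons)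
    ultimately show ?thesis
      by (simp only: check_poly_def laurent.value_smult)
  qed
  finally show ?thesis
    by (simp add: B_def)
qed

text \<open>Here \<open>left_series\<close> expresses the bubble series through values at \<open>u\<close> itself, so the key identity
  is used at \<open>u\<close>; the term with \<open>b\<^sub>0\<close> combines with the first summand of the left-hand side.\<close>

theorem left_bubble_series:
  "at_infinity_fls (Fraction_Field.Fract [:- t, 0, t + z:] [:- 1, z, 1:])
    + at_infinity_fls (Fraction_Field.Fract [:z, 0, - z:] [:- 1, z, 1:])
      * fps_to_fls (Abs_fps (\<lambda>n. b (- int n)))
    = at_infinity_fls (O_tilde_poly z t m)"
proof -
  obtain q\<^sub>1 where key: "(smult (inverse t) w + [:z:]) * reflect_poly m + smult z (w * Q)
      = [:- (t / M), q\<^sub>1, M / t:] * m"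
    and O: "O_tilde_poly z t m = Fraction_Field.Fract ([:- (t / (M * M)), q\<^sub>1 / M, inverse t:] * m)
      ([:- 1, z, 1:] * check_poly m)"
    using O_poly_uniform by metis
  let ?c = "fls_const :: 'k \<Rightarrow> 'k fls"
  define u v where "u = (fls_X_inv :: 'k fls)" and "v = (fls_X :: 'k fls)"
  have u: "u = inverse v"
    by (simp add: u_def v_def fls_inverse_X)
  have v: "v \<noteq> 0"
    by (simp add: v_def)
  define P S where "P = laurent.value_at u m" and "S = laurent.value_at u (reflect_poly m)"
  define q where "q = laurent.value_at u Q"
  define B where "B = fps_to_fls (Abs_fps (\<lambda>n. b (- int n)))"
  define D where "D = laurent.value_at u [:- 1, z, 1:]"
  define Q' where "Q' = (\<Sum>n\<le>d. monom (coeff Q (d - n)) n)"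
  have Q': "coeff Q' n = (if n \<le> d then coeff Q (d - n) else 0)" for n
    by (simp add: Q'_def coeff_sum)
  have deg_Q: "degree Q \<le> d"
    by (rule degree_le) (simp add: coeff_Q)
  have "fps_of_poly m * Abs_fps (\<lambda>n. b (- int n)) = fps_const (b 0) * fps_of_poly m - fps_of_poly Q'"
    unfolding left_series by (rule fps_ext) (simp add: Q')
  then have "laurent.value_at v m * B = ?c (b 0) * laurent.value_at v m - laurent.value_at v Q'"
    unfolding B_def v_def value_at_fls_X fls_times_fps_to_fls[symmetric]
    by (simp add: fls_times_fps_to_fls)
  moreover have "laurent.value_at v m = v ^ d * S"
    unfolding S_def u by (rule laurent.value_reversed[OF v degree_reflect_poly_le reflect_coeffs(2)])
  moreover have "laurent.value_at v Q' = v ^ d * q"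
    unfolding q_def u by (rule laurent.value_reversed[OF v deg_Q Q'])
  ultimately have "v ^ d * (S * B) = v ^ d * (?c (b 0) * S - q)"
    by (simp add: algebra_simps)
  then have SB: "S * B = ?c (b 0) * S - q"
    using v by simp
  have nz: "D \<noteq> 0" "S \<noteq> 0"
    unfolding D_def S_def u_def using m_nonzero by (intro value_at_fls_X_inv_nonzero; simp)+
  have "inverse t * M = M / t" "q\<^sub>1 / M * M = q\<^sub>1" "t / (M * M) * M = t / M"
    using M_nonzero by (simp_all add: field_simps)
  then have coeffs: "?c (inverse t) * ?c M = ?c (M / t)" "?c (q\<^sub>1 / M) * ?c M = ?c q\<^sub>1"
    "?c (t / (M * M)) * ?c M = ?c (t / M)" "?c M * ?c (inverse M) = 1"
    unfolding fls_const_mult_const using M_nonzero by simp_all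
  have key': "(?c (inverse t) * (u * u - 1) + ?c z) * S + ?c z * (u * u - 1) * q
      = (?c (inverse t) * ?c M * u * u + ?c (q\<^sub>1 / M) * ?c M * u - ?c (t / (M * M)) * ?c M) * P"
    using arg_cong[OF key, of "laurent.value_at u"]
    unfolding laurent.value_add laurent.value_mult laurent.value_smult S_def P_def q_def coeffs
    by (simp add: laurent.value_pCons algebra_simps del: map_poly_pCons mult_pCons_left)
  have zb: "?c z * ?c (b 0) = ?c t - ?c (inverse t) + ?c z"
  proof -
    have "z * b 0 = t - inverse t + z"
      using z_nonzero by (simp add: b_0 field_simps)
    then show ?thesis
      by (simp add: fls_plus_const[symmetric] fls_minus_const[symmetric])
  qed
  have "at_infinity_fls (Fraction_Field.Fract [:- t, 0, t + z:] [:- 1, z, 1:])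
      + at_infinity_fls (Fraction_Field.Fract [:z, 0, - z:] [:- 1, z, 1:]) * B
      = ((?c t + ?c z) * u * u - ?c t - ?c z * (u * u - 1) * B) / D"
    by (simp add: at_infinity_Fract laurent.value_pCons D_def u_def add_divide_distrib
        diff_divide_distrib algebra_simps fls_plus_const[symmetric] del: map_poly_pCons)
  also have "\<dots> = (?c (inverse t) * u * u + ?c (q\<^sub>1 / M) * u - ?c (t / (M * M))) * P
      / (D * (?c (inverse M) * S))"
    by (rule left_algebra[OF nz(2) SB zb key' coeffs(4)])
  also have "\<dots> = at_infinity_fls (O_tilde_poly z t m)"
  proof -
    have "at_infinity_fls (O_tilde_poly z t m) = laurent.value_at u [:- (t / (M * M)), q\<^sub>1 / M, inverse t:]
        * P / (D * laurent.value_at u (check_poly m))"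
      unfolding O D_def P_def u_def by (rule at_infinity_Fract_mult) (simp_all add: check_nonzero)
    moreover have "laurent.value_at u [:- (t / (M * M)), q\<^sub>1 / M, inverse t:]
        = ?c (inverse t) * u * u + ?c (q\<^sub>1 / M) * u - ?c (t / (M * M))"
      by (simp add: laurent.value_pCons algebra_simps del: map_poly_pCons)
    ultimately show ?thesis
      by (simp only: check_poly_def laurent.value_smult S_def)
  qed
  finally show ?thesis
    by (simp add: B_def)
qed

theorem O_tilde_poly_eq_inverted: "O_tilde_poly z t m = invert_variable (O_poly z t m)"
proof -
  obtain q\<^sub>1 where
    O: "O_poly z t m = Fraction_Field.Fract ([:- (M * M / t), - (M * q\<^sub>1), t:] * check_poly m)
      ([:- 1, - z, 1:] * m)"
    and O': "O_tilde_poly z t m = Fraction_Field.Fract ([:- (t / (M * M)), q\<^sub>1 / M, inverse t:] * m)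
      ([:- 1, z, 1:] * check_poly m)"
    using O_poly_uniform by metis
  let ?c = "ratfun_const :: 'k \<Rightarrow> 'k poly fract"
  define U V :: "'k poly fract" where "U = Fraction_Field.Fract [:0, 1:] 1"
    and "V = Fraction_Field.Fract 1 [:0, 1:]"
  have VU: "V * U = 1" and V: "V \<noteq> 0" and U: "U = inverse V"
    by (simp_all add: U_def V_def One_fract_def Zero_fract_def eq_fract)
  define P S where "P = ratfun.value_at U m" and "S = ratfun.value_at U (reflect_poly m)"
  have mV: "ratfun.value_at V m = V ^ d * S"
    unfolding S_def U by (rule ratfun.value_reversed[OF V degree_reflect_poly_le reflect_coeffs(2)])
  have SV: "ratfun.value_at V (reflect_poly m) = V ^ d * P"
    unfolding P_def U by (rule ratfun.value_reversed[OF V order_refl reflect_coeffs(1)])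
  have nonzero: "ratfun.value_at U p \<noteq> 0" if "p \<noteq> 0" for p
    using that by (simp add: U_def ratfun_value_at_variable Zero_fract_def eq_fract)
  let ?DV = "V * V - ?c z * V - 1" and ?DU = "U * U + ?c z * U - 1"
  let ?N = "?c (inverse t) * U * U + ?c (q\<^sub>1 / M) * U - ?c (t / (M * M))"
  have DU: "ratfun.value_at U [:- 1, z, 1:] = ?DU"
    by (simp add: ratfun.value_pCons ratfun.embed_minus ratfun.embed_1 algebra_simps del: map_poly_pCons)
  have DV: "ratfun.value_at V [:- 1, - z, 1:] = ?DV"
    by (simp add: ratfun.value_pCons ratfun.embed_minus ratfun.embed_1 algebra_simps del: map_poly_pCons)
  have NU: "ratfun.value_at U [:- (t / (M * M)), q\<^sub>1 / M, inverse t:] = ?N"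
    by (simp add: ratfun.value_pCons ratfun.embed_minus algebra_simps del: map_poly_pCons)
  have cc: "?c M * ?c (inverse M) = 1"
    unfolding ratfun.embed_mult[symmetric] using M_nonzero by (simp add: ratfun.embed_1)
  have "t = M * M * (t / (M * M))" "M * q\<^sub>1 = M * M * (q\<^sub>1 / M)" "M * M / t = M * M * inverse t"
    using M_nonzero by simp_all (simp_all add: divide_inverse)
  then have "[:- (M * M / t), - (M * q\<^sub>1), t:]
      = [:- (M * M * inverse t), - (M * M * (q\<^sub>1 / M)), M * M * (t / (M * M)):]"
    by simp
  then have NV: "ratfun.value_at V [:- (M * M / t), - (M * q\<^sub>1), t:]
      = ?c M * ?c M * ?c (t / (M * M)) * V * V - ?c M * ?c M * ?c (q\<^sub>1 / M) * V
        - ?c M * ?c M * ?c (inverse t)"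
    by (simp only: ratfun.value_pCons ratfun.embed_minus ratfun.embed_mult ratfun.value_0)
       (simp add: algebra_simps)
  have "?DU \<noteq> 0" "S \<noteq> 0"
    unfolding DU[symmetric] S_def using m_nonzero by (intro nonzero; simp)+
  moreover have "?DV = - (V * V) * ?DU"
  proof -
    have "- (V * V) * ?DU = V * V - ?c z * V * (V * U) - (V * U) * (V * U)"
      by (simp add: algebra_simps)
    then show ?thesis
      by (simp only: VU mult_1_right)
  qed
  ultimately have "ratfun.value_at V ([:- 1, - z, 1:] * m) \<noteq> 0"
    unfolding ratfun.value_mult DV mV using V by simp
  then have "invert_variable (O_poly z t m)
      = ratfun.value_at V ([:- (M * M / t), - (M * q\<^sub>1), t:] * check_poly m)
        / ratfun.value_at V ([:- 1, - z, 1:] * m)"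
    unfolding invert_variable_eq O V_def by (rule ratfun.eval_ratfun_Fract)
  also have "\<dots> = ?N * P / (?DU * (?c (inverse M) * S))"
    unfolding ratfun.value_mult check_poly_def ratfun.value_smult NV DV mV SV
    by (rule invert_algebra[OF VU cc])
  also have "\<dots> = O_tilde_poly z t m"
  proof -
    have "O_tilde_poly z t m = ratfun.value_at U ([:- (t / (M * M)), q\<^sub>1 / M, inverse t:] * m)
        / ratfun.value_at U ([:- 1, z, 1:] * check_poly m)"
      unfolding O' U_def ratfun_value_at_variable by simp
    then show ?thesis
      unfolding ratfun.value_mult check_poly_def ratfun.value_smult NU DU P_def S_def by simp
  qed
  finally show ?thesis ..
qed

theorem parity_restriction:
  "even d \<Longrightarrow> z = inverse t * M - t * inverse M"
  "odd d \<Longrightarrow> M = t \<or> M = - t"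
proof -
  obtain q\<^sub>1 where q: "even d \<Longrightarrow> q\<^sub>1 = 0 \<and> M / t - t / M = z" "odd d \<Longrightarrow> q\<^sub>1 = z \<and> M / t - t / M = 0"
    using key_identity by metis
  show "z = inverse t * M - t * inverse M" if "even d"
    using q(1)[OF that] by (simp add: divide_inverse mult.commute)
  show "M = t \<or> M = - t" if "odd d"
    using q(2)[OF that] M_nonzero t_nonzero by (simp add: field_simps square_eq_iff)
qed

end


section \<open>Module categories over the affine Kauffman category\<close>

lemma ak_class_eqI:
  assumes "ak_eq z t m n r s"
  shows "ak_class z t m n r = ak_class z t m n s"
proof -
  have "ak_eq z t m n r q \<longleftrightarrow> ak_eq z t m n s q" for q
    using assms ak_eq.sym ak_eq.trans by metis
  then show ?thesis
    by (simp add: ak_class_def)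
qed

lemma ak_eq_rep: "ak_typed m n r \<Longrightarrow> ak_eq z t m n r (ak_rep (ak_class z t m n r))"
  unfolding ak_rep_def ak_class_def by (simp, rule someI, rule ak_eq.refl)

lemma ak_class_hom: "ak_typed m n r \<Longrightarrow> ak_class z t m n r \<in> Hom (AK z t) m n"
  by (auto simp: Hom_def AK_def ak_class_def)

lemma AK_operations:
  "Ident (AK z t) n = ak_class z t n n (Idt n)"
  "ak_typed m n r \<Longrightarrow> ak_typed n p s \<Longrightarrow>
    Cmp (AK z t) (ak_class z t n p s) (ak_class z t m n r) = ak_class z t m p (Comp s r)"
  "ak_typed m n r \<Longrightarrow> ak_typed m n s \<Longrightarrow>
    Plus (AK z t) (ak_class z t m n r) (ak_class z t m n s) = ak_class z t m n (Add r s)"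
  "ak_typed m n r \<Longrightarrow> Smul (AK z t) c (ak_class z t m n r) = ak_class z t m n (Scal c r)"
  "ak_typed m n r \<Longrightarrow> ak_typed m' n' s \<Longrightarrow>
    TensM (AK z t) (ak_class z t m n r) (ak_class z t m' n' s)
      = ak_class z t (m + m') (n + n') (Tens r s)"
proof -
  have fst_class: "fst (ak_class z t m n r) = m" "fst (snd (ak_class z t m n r)) = n" for m n r
    by (simp_all add: ak_class_def)
  note [simp] = AK_def fst_class
  show "Ident (AK z t) n = ak_class z t n n (Idt n)"
    by simp
  show "Cmp (AK z t) (ak_class z t n p s) (ak_class z t m n r) = ak_class z t m p (Comp s r)"
    if "ak_typed m n r" "ak_typed n p s"
    using that by (auto intro!: ak_class_eqI ak_eq.sym[OF ak_eq.comp_cong] ak_eq_rep)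
  show "Plus (AK z t) (ak_class z t m n r) (ak_class z t m n s) = ak_class z t m n (Add r s)"
    if "ak_typed m n r" "ak_typed m n s"
    using that by (auto intro!: ak_class_eqI ak_eq.sym[OF ak_eq.add_cong] ak_eq_rep)
  show "Smul (AK z t) c (ak_class z t m n r) = ak_class z t m n (Scal c r)" if "ak_typed m n r"
    using that by (auto intro!: ak_class_eqI ak_eq.sym[OF ak_eq.scal_cong] ak_eq_rep)
  show "TensM (AK z t) (ak_class z t m n r) (ak_class z t m' n' s)
      = ak_class z t (m + m') (n + n') (Tens r s)" if "ak_typed m n r" "ak_typed m' n' s"
    using that by (auto intro!: ak_class_eqI ak_eq.sym[OF ak_eq.tens_cong] ak_eq_rep)
qed

text \<open>\<open>F n\<close> is the functor attached to \<open>n\<close> strands, and \<open>act m n r a\<close> the component at \<open>a\<close> of the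
  transformation attached to \<open>r\<close>.\<close>

locale ak_module = lin_category R
  for R :: "('o, 'm, 'k::field) lincat" +
  fixes z t :: 'k
    and \<Psi> :: "(nat, 'k ak_arr, ('o, 'm) endofunct, ('o, 'm) endotrans) funct"
  assumes t_nonzero: "t \<noteq> 0"
    and mon: "strict_mon_functor (AK z t) (End_cat R) \<Psi>"
begin

abbreviation cmp_R (infixr \<open>\<cdot>\<close> 70) where "g \<cdot> f \<equiv> Cmp R g f"
abbreviation plus_R (infixl \<open>\<oplus>\<close> 65) where "f \<oplus> g \<equiv> Plus R f g"
abbreviation smul_R (infixr \<open>\<odot>\<close> 75) where "c \<odot> f \<equiv> Smul R c f"
abbreviation ident_R (\<open>\<one>\<close>) where "\<one> a \<equiv> Ident R a"
abbreviation act where "act \<equiv> ak_act z t \<Psi>"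
abbreviation F :: "nat \<Rightarrow> 'o \<Rightarrow> 'o" where "F n \<equiv> FObj (FObj \<Psi> n)"
abbreviation Fm :: "nat \<Rightarrow> 'm \<Rightarrow> 'm" where "Fm n \<equiv> FArr (FObj \<Psi> n)"

lemma \<Psi>_functor: "lin_functor (AK z t) (End_cat R) \<Psi>"
  using mon by (simp add: strict_mon_functor_def)

lemma F_functor: "lin_functor R R (FObj \<Psi> n)"
  using \<Psi>_functor by (auto simp: lin_functor_def AK_def End_cat_def)

lemma F_obj: "a \<in> Obj R \<Longrightarrow> F n a \<in> Obj R"
  using F_functor[of n] by (simp add: lin_functor_def)

lemma Fm_hom: "f \<in> Hom R a b \<Longrightarrow> Fm n f \<in> Hom R (F n a) (F n b)"
  using F_functor[of n] by (simp add: lin_functor_def)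

lemma Fm_ident: "a \<in> Obj R \<Longrightarrow> Fm n (\<one> a) = \<one> (F n a)"
  using F_functor[of n] by (simp add: lin_functor_def)

lemma F_0: "a \<in> Obj R \<Longrightarrow> F 0 a = a" "f \<in> Arr R \<Longrightarrow> Fm 0 f = f"
  using mon by (simp_all add: strict_mon_functor_def AK_def End_cat_def id_functor_def)

lemma F_add:
  "a \<in> Obj R \<Longrightarrow> F (m + n) a = F m (F n a)"
  "f \<in> Arr R \<Longrightarrow> Fm (m + n) f = Fm m (Fm n f)"
proof -
  have "FObj \<Psi> (m + n) = comp_functor R (FObj \<Psi> m) (FObj \<Psi> n)"
    using mon by (simp add: strict_mon_functor_def AK_def End_cat_def)
  then show "a \<in> Obj R \<Longrightarrow> F (m + n) a = F m (F n a)"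
    "f \<in> Arr R \<Longrightarrow> Fm (m + n) f = Fm m (Fm n f)"
    by (simp_all add: comp_functor_def compose_def)
qed

lemma F_2: "a \<in> Obj R \<Longrightarrow> F 2 a = F 1 (F 1 a)" "f \<in> Arr R \<Longrightarrow> Fm 2 f = Fm 1 (Fm 1 f)"
  using F_add[of _ 1 1] by (simp_all only: one_add_one)

lemma \<Psi>_arr:
  assumes "ak_typed m n r"
  shows "FArr \<Psi> (ak_class z t m n r) \<in> Hom (End_cat R) (FObj \<Psi> m) (FObj \<Psi> n)"
  using \<Psi>_functor ak_class_hom[OF assms] by (simp add: lin_functor_def)

lemma \<Psi>_arr_eq:
  assumes "ak_typed m n r"
  shows "fst (FArr \<Psi> (ak_class z t m n r)) = FObj \<Psi> m"
    "fst (snd (FArr \<Psi> (ak_class z t m n r))) = FObj \<Psi> n"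
  using \<Psi>_arr[OF assms] by (auto simp: Hom_def End_cat_def)

lemma act_nat_trans:
  assumes "ak_typed m n r"
  shows "nat_trans R R (FObj \<Psi> m) (FObj \<Psi> n) (act m n r)"
  using \<Psi>_arr[OF assms] by (auto simp: Hom_def End_cat_def ak_act_def[abs_def] component_def)

lemma act_hom: "ak_typed m n r \<Longrightarrow> a \<in> Obj R \<Longrightarrow> act m n r a \<in> Hom R (F m a) (F n a)"
  using act_nat_trans[of m n r] by (simp add: nat_trans_def)

lemma act_nat: "ak_typed m n r \<Longrightarrow> f \<in> Hom R a b \<Longrightarrow> act m n r b \<cdot> Fm m f = Fm n f \<cdot> act m n r a"
  using act_nat_trans[of m n r] by (simp add: nat_trans_def)

lemma act_eqI: "ak_eq z t m n r s \<Longrightarrow> act m n r a = act m n s a"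
  by (simp add: ak_act_def ak_class_eqI)

lemma act_Idt: "a \<in> Obj R \<Longrightarrow> act n n (Idt n) a = \<one> (F n a)"
proof -
  have "FArr \<Psi> (Ident (AK z t) n) = Ident (End_cat R) (FObj \<Psi> n)"
    using \<Psi>_functor by (simp add: lin_functor_def AK_def)
  then show "a \<in> Obj R \<Longrightarrow> act n n (Idt n) a = \<one> (F n a)"
    by (simp add: ak_act_def AK_operations End_cat_def component_def)
qed

lemma act_Comp:
  assumes "ak_typed m n r" "ak_typed n p s" "a \<in> Obj R"
  shows "act m p (Comp s r) a = act n p s a \<cdot> act m n r a"
proof -
  have "FArr \<Psi> (Cmp (AK z t) (ak_class z t n p s) (ak_class z t m n r))
      = Cmp (End_cat R) (FArr \<Psi> (ak_class z t n p s)) (FArr \<Psi> (ak_class z t m n r))"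
    using \<Psi>_functor ak_class_hom[OF assms(1), of z t] ak_class_hom[OF assms(2), of z t]
    unfolding lin_functor_def by blast
  then show ?thesis
    using assms by (simp add: ak_act_def AK_operations(2)[OF assms(1,2)] End_cat_def component_def)
qed

lemma act_Add:
  assumes "ak_typed m n r" "ak_typed m n s" "a \<in> Obj R"
  shows "act m n (Add r s) a = act m n r a \<oplus> act m n s a"
proof -
  have "FArr \<Psi> (Plus (AK z t) (ak_class z t m n r) (ak_class z t m n s))
      = Plus (End_cat R) (FArr \<Psi> (ak_class z t m n r)) (FArr \<Psi> (ak_class z t m n s))"
    using \<Psi>_functor ak_class_hom[OF assms(1), of z t] ak_class_hom[OF assms(2), of z t]
    unfolding lin_functor_def by blast
  then show ?thesis
    using assms by (simp add: ak_act_def AK_operations(3)[OF assms(1,2)] End_cat_def component_def)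
qed

lemma act_Scal:
  assumes "ak_typed m n r" "a \<in> Obj R"
  shows "act m n (Scal c r) a = c \<odot> act m n r a"
proof -
  have "FArr \<Psi> (Smul (AK z t) c (ak_class z t m n r))
      = Smul (End_cat R) c (FArr \<Psi> (ak_class z t m n r))"
    using \<Psi>_functor ak_class_hom[OF assms(1)] unfolding lin_functor_def by blast
  then show ?thesis
    using assms by (simp add: ak_act_def AK_operations(4)[OF assms(1)] End_cat_def component_def)
qed

lemma act_Tens:
  assumes "ak_typed m n r" "ak_typed m' n' s" "a \<in> Obj R" "i = m + m'" "j = n + n'"
  shows "act i j (Tens r s) a = act m n r (F n' a) \<cdot> Fm m (act m' n' s a)"
proof -
  have "FArr \<Psi> (TensM (AK z t) (ak_class z t m n r) (ak_class z t m' n' s))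
      = TensM (End_cat R) (FArr \<Psi> (ak_class z t m n r)) (FArr \<Psi> (ak_class z t m' n' s))"
    using mon ak_class_hom[OF assms(1), of z t] ak_class_hom[OF assms(2), of z t]
    unfolding strict_mon_functor_def Hom_def by blast
  then show ?thesis
    using assms by (simp add: ak_act_def AK_operations(5)[OF assms(1,2)] End_cat_def component_def
        \<Psi>_arr_eq[OF assms(1)] \<Psi>_arr_eq[OF assms(2)])
qed

lemma act_Tens_left:
  assumes "ak_typed m n r" "a \<in> Obj R" "i = 1 + m" "j = 1 + n"
  shows "act i j (Tens (Idt 1) r) a = Fm 1 (act m n r a)"
proof -
  have "Fm 1 (act m n r a) \<in> Hom R (F 1 (F m a)) (F 1 (F n a))"
    using assms by (intro Fm_hom act_hom)
  then show ?thesis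
    using act_Tens[OF ak_typed.intros(7)[of 1] assms(1,2)] assms F_obj
    by (simp add: act_Idt Hom_iff del: One_nat_def)
qed

lemma act_Tens_right:
  assumes "ak_typed m n r" "a \<in> Obj R" "i = m + 1" "j = n + 1"
  shows "act i j (Tens r (Idt 1)) a = act m n r (F 1 a)"
proof -
  have "act m n r (F 1 a) \<in> Hom R (F m (F 1 a)) (F n (F 1 a))"
    using assms F_obj by (intro act_hom)
  then show ?thesis
    using act_Tens[OF assms(1) ak_typed.intros(7)[of 1] assms(2)] assms F_obj
    by (simp add: act_Idt Fm_ident Hom_iff del: One_nat_def)
qed

text \<open>Functors are only required to preserve sums and multiples, and the zero morphism is reached as
  \<open>r + (- 1) r\<close>.\<close>

lemma act_Zero:
  assumes "a \<in> Obj R"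
  shows "act m n (Zero m n) a = Zer R (F m a) (F n a)"
proof -
  let ?V = "Hom R (F m a) (F n a)" and ?f = "act m n (Zero m n) a"
  have typed: "ak_typed m n (Zero m n)"
    by (rule ak_typed.intros)
  have f: "?f \<in> ?V"
    using assms typed by (rule act_hom[rotated])
  have "act m n (ak_minus (Zero m n) (Zero m n)) a = ?f"
    using typed by (intro act_eqI ak_eq.add_inverse)
  then have "?f = ?f \<oplus> (- 1) \<odot> ?f"
    using assms typed by (simp add: act_Add act_Scal ak_typed.intros)
  also have "\<dots> = Zer R (F m a) (F n a)"
    using assms F_obj f by (intro vspace_on.add_minus[OF hom_vspace])
  finally show ?thesis .
qed

lemma act_ak_sum:
  assumes "\<forall>r\<in>set rs. ak_typed m n r" "a \<in> Obj R"
  shows "ak_typed m n (ak_sum m n rs)"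
    and "act m n (ak_sum m n rs) a = foldr (Plus R) (map (\<lambda>r. act m n r a) rs) (Zer R (F m a) (F n a))"
proof -
  have "ak_typed m n (ak_sum m n rs) \<and>
    act m n (ak_sum m n rs) a = foldr (Plus R) (map (\<lambda>r. act m n r a) rs) (Zer R (F m a) (F n a))"
    using assms by (induction rs) (auto simp: ak_sum_def act_Zero act_Add intro: ak_typed.intros)
  then show "ak_typed m n (ak_sum m n rs)"
    "act m n (ak_sum m n rs) a = foldr (Plus R) (map (\<lambda>r. act m n r a) rs) (Zer R (F m a) (F n a))"
    by blast+
qed

lemma typed:
  "ak_typed 2 0 Cap" "ak_typed 0 2 Cup" "ak_typed 2 2 CrossP" "ak_typed 2 2 CrossM"
  "ak_typed 1 1 Dot" "ak_typed 1 1 DotInv" "ak_typed n n (Idt n)"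
  "ak_typed i j r \<Longrightarrow> ak_typed j k s \<Longrightarrow> ak_typed i k (Comp s r)"
  "ak_typed i j r \<Longrightarrow> i' = 1 + i \<Longrightarrow> j' = 1 + j \<Longrightarrow> ak_typed i' j' (Tens (Idt 1) r)"
  "ak_typed i j r \<Longrightarrow> i' = i + 1 \<Longrightarrow> j' = j + 1 \<Longrightarrow> ak_typed i' j' (Tens r (Idt 1))"
  "ak_typed i j r \<Longrightarrow> ak_typed i j s \<Longrightarrow> ak_typed i j (Add r s)"
  "ak_typed i j r \<Longrightarrow> ak_typed i j (Scal c r)"
  using ak_typed.intros(10)[OF ak_typed.intros(7)[of 1], of i j r]
    ak_typed.intros(10)[OF _ ak_typed.intros(7)[of 1], of i j r]
  by (auto intro: ak_typed.intros simp del: One_nat_def)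

text \<open>Each axiom of the action is a defining relation of the category, or the naturality of a
  generator, read at one object.\<close>

sublocale strand: kauffman_action R z t "F 1" "Fm 1" "act 1 1 Dot" "act 1 1 DotInv" "act 2 0 Cap"
    "act 0 2 Cup" "act 2 2 CrossP" "act 2 2 CrossM"
proof
  show "t \<noteq> 0" by (rule t_nonzero)
  fix a assume a: "a \<in> Obj R"
  note [simp] = a F_obj F_0 F_2
  note [simp del] = One_nat_def
  show "F 1 a \<in> Obj R"
    by (simp add: F_obj)
  show "Fm 1 (\<one> a) = \<one> (F 1 a)"
    using a by (rule Fm_ident)
  show "act 1 1 Dot a \<in> Hom R (F 1 a) (F 1 a)" "act 1 1 DotInv a \<in> Hom R (F 1 a) (F 1 a)"
    using a by (auto intro!: act_hom typed)
  show "act 2 0 Cap a \<in> Hom R (F 1 (F 1 a)) a"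
    using act_hom[OF typed(1) a] by simp
  show "act 0 2 Cup a \<in> Hom R a (F 1 (F 1 a))"
    using act_hom[OF typed(2) a] by simp
  show "act 2 2 CrossP a \<in> Hom R (F 1 (F 1 a)) (F 1 (F 1 a))"
    using act_hom[OF typed(3) a] by simp
  show "act 2 2 CrossM a \<in> Hom R (F 1 (F 1 a)) (F 1 (F 1 a))"
    using act_hom[OF typed(4) a] by simp
  show "act 2 2 CrossP a \<cdot> act 2 2 CrossM a = \<one> (F 1 (F 1 a))"
    using act_eqI[OF ak_eq.cross_pm[of z t], of a] by (simp add: act_Comp[OF typed(4,3) a] act_Idt[OF a])
  show "act 2 2 CrossM a \<cdot> act 2 2 CrossP a = \<one> (F 1 (F 1 a))"
    using act_eqI[OF ak_eq.cross_mp[of z t], of a] by (simp add: act_Comp[OF typed(3,4) a] act_Idt[OF a])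
  have tens_typed: "ak_typed 3 1 (Tens (Idt 1) Cap)" "ak_typed 3 1 (Tens Cap (Idt 1))"
    "ak_typed 1 3 (Tens (Idt 1) Cup)" "ak_typed 1 3 (Tens Cup (Idt 1))"
    "ak_typed 3 3 (Tens (Idt 1) CrossP)" "ak_typed 3 3 (Tens CrossM (Idt 1))"
    "ak_typed 2 2 (Tens (Idt 1) Dot)" "ak_typed 2 2 (Tens (Idt 1) DotInv)"
    "ak_typed 2 2 (Tens Dot (Idt 1))"
    by (rule typed(9,10), rule typed, simp, simp)+
  have tens_act: "act 3 1 (Tens (Idt 1) Cap) a = Fm 1 (act 2 0 Cap a)"
    "act 3 1 (Tens Cap (Idt 1)) a = act 2 0 Cap (F 1 a)"
    "act 1 3 (Tens (Idt 1) Cup) a = Fm 1 (act 0 2 Cup a)"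
    "act 1 3 (Tens Cup (Idt 1)) a = act 0 2 Cup (F 1 a)"
    "act 3 3 (Tens (Idt 1) CrossP) a = Fm 1 (act 2 2 CrossP a)"
    "act 3 3 (Tens CrossM (Idt 1)) a = act 2 2 CrossM (F 1 a)"
    "act 2 2 (Tens (Idt 1) Dot) a = Fm 1 (act 1 1 Dot a)"
    "act 2 2 (Tens (Idt 1) DotInv) a = Fm 1 (act 1 1 DotInv a)"
    "act 2 2 (Tens Dot (Idt 1)) a = act 1 1 Dot (F 1 a)"
    by (rule act_Tens_left act_Tens_right, rule typed, rule a, simp, simp)+
  show "Fm 1 (act 2 0 Cap a) \<cdot> act 0 2 Cup (F 1 a) = \<one> (F 1 a)"
    using act_eqI[OF ak_eq.zigzag_left[of z t], of a]
    by (simp only: act_Comp[OF tens_typed(4,1) a] tens_act act_Idt[OF a])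
  show "act 2 0 Cap (F 1 a) \<cdot> Fm 1 (act 0 2 Cup a) = \<one> (F 1 a)"
    using act_eqI[OF ak_eq.zigzag_right[of z t], of a]
    by (simp only: act_Comp[OF tens_typed(3,2) a] tens_act act_Idt[OF a])
  show "act 2 0 Cap a \<cdot> act 2 2 CrossM a = t \<odot> act 2 0 Cap a"
    using act_eqI[OF ak_eq.curl[of z t], of a]
    by (simp only: act_Comp[OF typed(4,1) a] act_Scal[OF typed(1) a])
  show "Fm 1 (act 2 0 Cap a) \<cdot> act 2 2 CrossM (F 1 a) = act 2 0 Cap (F 1 a) \<cdot> Fm 1 (act 2 2 CrossP a)"
    using act_eqI[OF ak_eq.cap_cross[of z t], of a]
    by (simp only: act_Comp[OF tens_typed(6,1) a] act_Comp[OF tens_typed(5,2) a] tens_act)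
  show "act 2 2 CrossP a \<oplus> (- 1) \<odot> act 2 2 CrossM a
      = z \<odot> (\<one> (F 1 (F 1 a)) \<oplus> (- 1) \<odot> (act 0 2 Cup a \<cdot> act 2 0 Cap a))"
    using act_eqI[OF ak_eq.skein[of z t], of a]
    by (simp add: act_Add[OF typed(3) typed(12)[OF typed(4)] a] act_Scal[OF typed(4) a]
        act_Scal[OF typed(11)[OF typed(7) typed(12)[OF typed(8)[OF typed(1,2)]]] a]
        act_Add[OF typed(7) typed(12)[OF typed(8)[OF typed(1,2)]] a]
        act_Scal[OF typed(8)[OF typed(1,2)] a] act_Comp[OF typed(1,2) a] act_Idt[OF a])
  show "act 2 0 Cap a \<cdot> act 0 2 Cup a = ((t - inverse t) / z + 1) \<odot> \<one> a"
    using act_eqI[OF ak_eq.loop[of z t], of a]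
    by (simp add: act_Comp[OF typed(2,1) a] act_Scal[OF typed(7) a] act_Idt[OF a])
  show "act 2 2 CrossM a \<cdot> act 1 1 Dot (F 1 a) = Fm 1 (act 1 1 Dot a) \<cdot> act 2 2 CrossP a"
    using act_eqI[OF ak_eq.dot_cross[of z t], of a]
    by (simp only: act_Comp[OF tens_typed(9) typed(4) a] act_Comp[OF typed(3) tens_typed(7) a] tens_act)
  show "act 2 0 Cap a \<cdot> act 1 1 Dot (F 1 a) = act 2 0 Cap a \<cdot> Fm 1 (act 1 1 DotInv a)"
    using act_eqI[OF ak_eq.dot_cap[of z t], of a]
    by (simp only: act_Comp[OF tens_typed(9) typed(1) a] act_Comp[OF tens_typed(8) typed(1) a] tens_act)
  show "act 1 1 DotInv a \<cdot> act 1 1 Dot a = \<one> (F 1 a)"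
    using act_eqI[OF ak_eq.dot_inv_left[of z t], of a]
    by (simp only: act_Comp[OF typed(5,6) a] act_Idt[OF a])
  show "act 1 1 Dot a \<cdot> act 1 1 DotInv a = \<one> (F 1 a)"
    using act_eqI[OF ak_eq.dot_inv_right[of z t], of a]
    by (simp only: act_Comp[OF typed(6,5) a] act_Idt[OF a])
next
  fix f a b assume f: "f \<in> Hom R a b"
  then have arr: "f \<in> Arr R" "a \<in> Obj R" "b \<in> Obj R"
    using src_obj tgt_obj by (auto simp: Hom_iff)
  show "Fm 1 f \<in> Hom R (F 1 a) (F 1 b)"
    using f by (rule Fm_hom)
  show "Fm 1 (s \<odot> f) = s \<odot> Fm 1 f" for s
    using F_functor[of 1] f by (simp add: lin_functor_def)
  show "Fm 1 (f \<oplus> g) = Fm 1 f \<oplus> Fm 1 g" if "g \<in> Hom R a b" for g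
    using F_functor[of 1] f that by (simp add: lin_functor_def)
  show "Fm 1 (g \<cdot> f) = Fm 1 g \<cdot> Fm 1 f" if "g \<in> Hom R b c" for g c
    using F_functor[of 1] f that unfolding lin_functor_def by blast
  show "act 1 1 Dot b \<cdot> Fm 1 f = Fm 1 f \<cdot> act 1 1 Dot a"
    by (rule act_nat[OF typed(5) f])
  show "act 1 1 DotInv b \<cdot> Fm 1 f = Fm 1 f \<cdot> act 1 1 DotInv a"
    by (rule act_nat[OF typed(6) f])
  show "act 2 0 Cap b \<cdot> Fm 1 (Fm 1 f) = f \<cdot> act 2 0 Cap a"
    using act_nat[OF typed(1) f] by (simp only: F_0(2)[OF arr(1)] F_2(2)[OF arr(1)])
  show "act 0 2 Cup b \<cdot> f = Fm 1 (Fm 1 f) \<cdot> act 0 2 Cup a"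
    using act_nat[OF typed(2) f] by (simp only: F_0(2)[OF arr(1)] F_2(2)[OF arr(1)])
  show "act 2 2 CrossP b \<cdot> Fm 1 (Fm 1 f) = Fm 1 (Fm 1 f) \<cdot> act 2 2 CrossP a"
    using act_nat[OF typed(3) f] by (simp only: F_2(2)[OF arr(1)])
qed

lemma dot_pow_typed: "ak_typed 1 1 (dot_pow n :: 'k ak_term)"
proof -
  have "ak_typed 1 1 ((Comp Dot ^^ k) (Idt 1 :: 'k ak_term))"
    "ak_typed 1 1 ((Comp DotInv ^^ k) (Idt 1 :: 'k ak_term))" for k
    by (induction k) (auto intro: typed simp del: One_nat_def)
  then show ?thesis
    by (simp add: dot_pow_def del: One_nat_def)
qed

lemma act_dot_pow:
  assumes a: "a \<in> Obj R"
  shows "act 1 1 (dot_pow n) a = strand.dpow n a"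
proof -
  have iterate: "ak_typed 1 1 ((Comp r ^^ k) (Idt 1))
      \<and> act 1 1 ((Comp r ^^ k) (Idt 1)) a = ((\<cdot>) (act 1 1 r a) ^^ k) (\<one> (F 1 a))"
    if r: "ak_typed 1 1 r" for r k
    by (induction k) (auto intro: typed r simp: act_Idt[OF a] act_Comp[OF _ r a] simp del: One_nat_def)
  show ?thesis
    using iterate[OF typed(5)] iterate[OF typed(6)]
    by (simp add: dot_pow_def strand.dpow_def del: One_nat_def)
qed

lemma act_laurent_at_dot:
  assumes a: "a \<in> Obj R"
  shows "act 1 1 (laurent_at_dot f) a = strand.ev a f"
proof -
  let ?ns = "sorted_list_of_set (Poly_Mapping.keys f)"
  have "act 1 1 (laurent_at_dot f) a = foldr (Plus R)
      (map (\<lambda>n. act 1 1 (Scal (Poly_Mapping.lookup f n) (dot_pow n)) a) ?ns) (Zer R (F 1 a) (F 1 a))"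
    unfolding laurent_at_dot_def
    by (subst act_ak_sum(2)) (auto intro: typed dot_pow_typed a simp: comp_def simp del: One_nat_def)
  also have "(\<lambda>n. act 1 1 (Scal (Poly_Mapping.lookup f n) (dot_pow n)) a)
      = (\<lambda>n. Poly_Mapping.lookup f n \<odot> strand.dpow n a)"
    by (simp only: act_Scal[OF dot_pow_typed a] act_dot_pow[OF a])
  finally show ?thesis
    unfolding strand.ev_def vspace_on.comb_def[OF strand.vspace_K[OF a]]
      vspace_on.comb_over_def[OF strand.vspace_K[OF a]] .
qed

lemma act_bubble_r:
  assumes a: "a \<in> Obj R"
  shows "ak_typed 0 0 (bubble_r n :: 'k ak_term)"
    and "act 0 0 (bubble_r n) a = strand.bubble a (strand.dpow (int n) a)"
proof -
  have tens: "ak_typed 2 2 (Tens (Idt 1) (dot_pow (int n)) :: 'k ak_term)"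
    by (rule typed(9)[OF dot_pow_typed]) simp_all
  show "ak_typed 0 0 (bubble_r n :: 'k ak_term)"
    unfolding bubble_r_def by (intro typed(8)[OF typed(8)[OF typed(2) tens] typed(1)])
  have "act 2 2 (Tens (Idt 1) (dot_pow (int n))) a = Fm 1 (strand.dpow (int n) a)"
    unfolding act_dot_pow[OF a, symmetric] by (rule act_Tens_left[OF dot_pow_typed a]) simp_all
  then show "act 0 0 (bubble_r n) a = strand.bubble a (strand.dpow (int n) a)"
    unfolding bubble_r_def strand.bubble_def
    by (simp only: act_Comp[OF typed(8)[OF typed(2) tens] typed(1) a] act_Comp[OF typed(2) tens a])
qed

lemma act_bubble_l:
  assumes a: "a \<in> Obj R"
  shows "ak_typed 0 0 (bubble_l n :: 'k ak_term)"
    and "act 0 0 (bubble_l n) a = strand.bubble a (strand.dpow (- int n) a)"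
proof -
  have tens: "ak_typed 2 2 (Tens (dot_pow (int n)) (Idt 1) :: 'k ak_term)"
    by (rule typed(10)[OF dot_pow_typed]) simp_all
  show "ak_typed 0 0 (bubble_l n :: 'k ak_term)"
    unfolding bubble_l_def by (intro typed(8)[OF typed(8)[OF typed(2) tens] typed(1)])
  have "act 2 2 (Tens (dot_pow (int n)) (Idt 1)) a = strand.dpow (int n) (F 1 a)"
    unfolding act_dot_pow[OF F_obj[OF a], symmetric]
    by (rule act_Tens_right[OF dot_pow_typed a]) simp_all
  then show "act 0 0 (bubble_l n) a = strand.bubble a (strand.dpow (- int n) a)"
    unfolding bubble_l_def strand.bubble_left[OF a, symmetric]
    by (simp only: act_Comp[OF typed(8)[OF typed(2) tens] typed(1) a] act_Comp[OF typed(2) tens a])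
qed

lemma act_bubble_coeff:
  assumes a: "a \<in> Obj R"
    and c: "\<And>i. ak_typed 0 0 (c i)" "\<And>i. act 0 0 (c i) a = \<beta> i \<odot> \<one> a"
  shows "act 0 0 (bubble_coeff f g c n) a
    = (fls_nth (at_infinity_fls f) (int n)
      + (\<Sum>i\<le>n. fls_nth (at_infinity_fls g) (int (n - i)) * \<beta> i)) \<odot> \<one> a"
proof -
  let ?s = "\<lambda>i. fls_nth (at_infinity_fls g) (int (n - i))"
  let ?rs = "map (\<lambda>i. Scal (?s i) (c i)) [0..<Suc n]"
  have rs: "\<forall>r\<in>set ?rs. ak_typed 0 0 r"
    using typed(12)[OF c(1)] by auto
  have "foldr (Plus R) (map (\<lambda>r. act 0 0 r a) (map (\<lambda>i. Scal (?s i) (c i)) is)) (Zer R a a)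
      = (\<Sum>i\<leftarrow>is. ?s i * \<beta> i) \<odot> \<one> a" for "is"
    by (induction "is") (simp_all add: a smul_0 act_Scal[OF c(1) a] c(2) add_smul)
  then have "act 0 0 (ak_sum 0 0 ?rs) a = (\<Sum>i\<leftarrow>[0..<Suc n]. ?s i * \<beta> i) \<odot> \<one> a"
    unfolding act_ak_sum(2)[OF rs a] F_0(1)[OF a] .
  also have "(\<Sum>i\<leftarrow>[0..<Suc n]. ?s i * \<beta> i) = (\<Sum>i\<le>n. ?s i * \<beta> i)"
    by (simp only: interv_sum_list_conv_sum_set_nat atLeast0LessThan lessThan_Suc_atMost
        set_upt distinct_upt sum_list_distinct_conv_sum_set)
  finally have sum: "act 0 0 (ak_sum 0 0 ?rs) a = (\<Sum>i\<le>n. ?s i * \<beta> i) \<odot> \<one> a" .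
  have "act 0 0 (bubble_coeff f g c n) a
      = fls_nth (at_infinity_fls f) (int n) \<odot> \<one> a \<oplus> (\<Sum>i\<le>n. ?s i * \<beta> i) \<odot> \<one> a"
    unfolding bubble_coeff_def
    by (subst act_Add[OF typed(12)[OF typed(7)] act_ak_sum(1)[OF rs a] a], subst sum)
       (simp only: act_Scal[OF typed(7) a] act_Idt[OF a] F_0(1)[OF a])
  then show ?thesis
    by (simp add: add_smul a)
qed

end


section \<open>Bubble series and minimal polynomial of a brick\<close>

theorem theorem5p6:
  fixes z t :: "'k::field"
    and R :: "('o, 'm, 'k) lincat"
    and \<Psi> :: "(nat, 'k ak_arr, ('o, 'm) endofunct, ('o, 'm) endotrans) funct"
    and L :: 'o
    and m\<^sub>L :: "'k poly"
  assumes "z \<noteq> 0" and "t \<noteq> 0"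
    and "AK_module_category z t R \<Psi>"
    and "locally_finite_abelian R \<or> schurian TYPE('i) TYPE('a) R"
    and "brick R L"
    and "is_dot_min_poly z t R \<Psi> L m\<^sub>L"
  shows "fps_to_fls (O_brick z t R \<Psi> L) = at_infinity_fls (O_poly z t m\<^sub>L) \<and>
         fps_to_fls (O_tilde_brick z t R \<Psi> L) = at_infinity_fls (O_tilde_poly z t m\<^sub>L) \<and>
         O_tilde_poly z t m\<^sub>L = invert_variable (O_poly z t m\<^sub>L) \<and>
         (even (degree m\<^sub>L) \<longrightarrow> z = inverse t * poly m\<^sub>L 0 - t * inverse (poly m\<^sub>L 0)) \<and>
         (odd (degree m\<^sub>L) \<longrightarrow> poly m\<^sub>L 0 = t \<or> poly m\<^sub>L 0 = - t)"
proof -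
  interpret ak_module R z t \<Psi>
    using assms by (auto simp: AK_module_category_def ak_module_def ak_module_axioms_def)
  have L: "L \<in> Obj R"
    using assms by (simp add: brick_def)
  interpret br: kauffman_brick R z t "F 1" "Fm 1" "act 1 1 Dot" "act 1 1 DotInv" "act 2 0 Cap"
    "act 0 2 Cup" "act 2 2 CrossP" "act 2 2 CrossM" L m\<^sub>L
  proof
    fix f
    have "strand.ev L f = Zer R (F 1 L) (F 1 L) \<longleftrightarrow> f \<in> dot_ideal z t R \<Psi> L"
      unfolding dot_ideal_def mem_Collect_eq act_laurent_at_dot[OF L] ..
    then show "strand.ev L f = Zer R (F 1 L) (F 1 L) \<longleftrightarrow> (\<exists>g. f = g * laurent_of_poly m\<^sub>L)"
      using assms(6) by (simp add: is_dot_min_poly_def)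
  qed (use assms in \<open>auto simp: is_dot_min_poly_def\<close>)
  interpret val: bubble_values z t br.b m\<^sub>L
    using assms(1,2,6) br.b_0 br.bubble_recurrence br.min_poly_dvd_curl_poly
    by unfold_locales (simp_all add: is_dot_min_poly_def)
  have right: "act 0 0 (bubble_r i) L = br.b (int i) \<odot> \<one> L"
    and left: "act 0 0 (bubble_l i) L = br.b (- int i) \<odot> \<one> L" for i
    by (simp_all only: act_bubble_r(2)[OF L] act_bubble_l(2)[OF L] br.bubble_dpow)
  have "fps_to_fls (O_brick z t R \<Psi> L) = at_infinity_fls (O_poly z t m\<^sub>L)"
    unfolding O_brick_def val.right_bubble_series[symmetric] beta_r_def
    by (rule series_at_infinity)
       (simp_all add: act_bubble_coeff[OF L act_bubble_r(1)[OF L] right] br.brick_scalar_unique)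
  moreover have "fps_to_fls (O_tilde_brick z t R \<Psi> L) = at_infinity_fls (O_tilde_poly z t m\<^sub>L)"
    unfolding O_tilde_brick_def val.left_bubble_series[symmetric] beta_l_def
    by (rule series_at_infinity)
       (simp_all add: act_bubble_coeff[OF L act_bubble_l(1)[OF L] left] br.brick_scalar_unique)
  ultimately show ?thesis
    using val.O_tilde_poly_eq_inverted val.parity_restriction by blast
qed

end
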